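(* Let $\Omega\subset\mathbb R^N$ be a bounded Lipschitz domain, $s\in(0,1)$, $t>0$, and let $1\le\lambda_1\le\lambda_2\le\cdots\to\infty$ be the eigenvalues (repeated according to multiplicity) of $A_s=I+(-\Delta)^s$. For $0<\alpha\le e^{-2t}$, the equation $\lambda^{-1}e^{-2t\lambda}=\alpha$ has a unique solution $\lambda^*(\alpha)\ge1$ among $\lambda\ge1$, given explicitly by $$\lambda^*(\alpha)=\frac1{2t}\,W\!\left(\frac{2t}{\alpha}\right),$$ where $W$ denotes the principal branch of the Lambert $W$ function. As $\alpha\to0^+$, $$\lambda^*(\alpha)\sim\frac1{2t}\log\frac1\alpha .$$ Consequently, the number of modes $j^*(\alpha):=\#\{j:\lambda_j\le\lambda^*(\alpha)\}$ satisfies $$j^*(\alpha)\sim(2\pi)^{-N}\omega_N|\Omega|\left(\frac1{2t}\log\frac1\alpha\right)^{N/(2s)}\qquad(\alpha\to0^+).$$ In particular, for $0<\beta\le1$ and $\alpha=\delta^{2/(2\beta+1)}$, the effective bandwidth $j^*(\delta):=j^*(\delta^{2/(2\beta+1)})$ grows only poly-logarithmically in the inverse noise level: $$j^*(\delta)\sim(2\pi)^{-N}\omega_N|\Omega|\left(\frac1{t(2\beta+1)}\log\frac1\delta\right)^{N/(2s)}\qquad(\delta\to0^+).$$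
   Context: $f\sim g$ means $f/g\to1$; $\omega_N=|\{\xi\in\mathbb R^N:|\xi|<1\}|$. $H_0^s(\Omega)$ is the space of functions $u\in H^s(\mathbb R^N)$ with $u=0$ a.e. in $\mathbb R^N\setminus\Omega$ (also regarded as functions on $\Omega$). On it consider the closed, symmetric, coercive bilinear form $$a_s(u,v)=\int_\Omega uv\,dx+\frac{C_{N,s}}{2}\iint_{\mathbb R^{2N}}\frac{(u(x)-u(y))(v(x)-v(y))}{|x-y|^{N+2s}}\,dx\,dy,$$ where $C_{N,s}=\frac{4^s s\,\Gamma(N/2+s)}{\pi^{N/2}\Gamma(1-s)}$ is the standard normalization constant of the integral fractional Laplacian (so that the second term with $u=v$ equals $\int_{\mathbb R^N}|\xi|^{2s}|\hat u(\xi)|^2d\xi$ for the unitary Fourier transform). $A_s=I+(-\Delta)^s$ is the unique positive self-adjoint operator on $L^2(\Omega)$ associated with $a_s$; it has compact resolvent. The quantities $\sigma_j^2=\lambda_j^{-1}e^{-2t\lambda_j}$ are the eigenvalues of $B^*B$ for $B=e^{-tA_s}A_s^{-1/2}$, so $\lambda^*(\alpha)$ is the threshold where $\sigma_j^2=\alpha$. *)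

theory Defs
  imports "HOL-Analysis.Analysis" "HOL-Library.Landau_Symbols"
begin

text \<open>
  Functions are real valued on \<open>real ^ 'n\<close>, so \<open>N = CARD('n)\<close>.  Elements of \<open>L\<^sup>2\<close> are represented
  by Borel functions; wherever it matters, they are compared up to Lebesgue null sets.
\<close>

text \<open>
  In the definition below \<open>e\<close> is the direction of the last coordinate of a rotated coordinate
  system, \<open>x \<bullet> e\<close> is that coordinate and \<open>x - (x \<bullet> e) *\<^sub>R e\<close> stands for the remaining \<open>N - 1\<close>
  coordinates, so \<open>\<gamma>\<close> is a Lipschitz function on an \<open>(N - 1)\<close>-dimensional space.
\<close>

definition lipschitz_boundary :: "(real ^ 'n) set \<Rightarrow> bool" where
  "lipschitz_boundary \<Omega> \<longleftrightarrow>
     (\<forall>p \<in> frontier \<Omega>. \<exists>r > 0. \<exists>e \<gamma> L. norm e = 1 \<and> L-lipschitz_on {y. y \<bullet> e = 0} \<gamma> \<and>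
        (\<forall>x \<in> ball p r. x \<in> \<Omega> \<longleftrightarrow> \<gamma> (x - (x \<bullet> e) *\<^sub>R e) < x \<bullet> e))"

definition bounded_lipschitz_domain :: "(real ^ 'n) set \<Rightarrow> bool" where
  "bounded_lipschitz_domain \<Omega> \<longleftrightarrow>
     \<Omega> \<noteq> {} \<and> open \<Omega> \<and> connected \<Omega> \<and> bounded \<Omega> \<and> lipschitz_boundary \<Omega>"

definition L2_on :: "(real ^ 'n) set \<Rightarrow> (real ^ 'n \<Rightarrow> real) set" where
  "L2_on \<Omega> = {f. set_borel_measurable lborel \<Omega> f \<and> set_integrable lborel \<Omega> (\<lambda>x. (f x)\<^sup>2)}"

text \<open>The integrands with kernel \<open>norm (x - y) powr - (N + 2 s)\<close> are \<open>0\<close> on the diagonal, a null set.\<close>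

definition sobolev_H :: "real \<Rightarrow> (real ^ 'n \<Rightarrow> real) set" where
  "sobolev_H s = {u \<in> L2_on UNIV.
     integrable (lborel \<Otimes>\<^sub>M lborel)
       (\<lambda>(x, y). (u x - u y)\<^sup>2 / norm (x - y) powr (real CARD('n) + 2 * s))}"

definition sobolev_H0 :: "real \<Rightarrow> (real ^ 'n) set \<Rightarrow> (real ^ 'n \<Rightarrow> real) set" where
  "sobolev_H0 s \<Omega> = {u \<in> sobolev_H s. AE x in lborel. x \<notin> \<Omega> \<longrightarrow> u x = 0}"

definition frac_laplacian_const :: "nat \<Rightarrow> real \<Rightarrow> real" where
  "frac_laplacian_const N s =
     4 powr s * s * Gamma (real N / 2 + s) / (pi powr (real N / 2) * Gamma (1 - s))"

definition form_a ::
    "real \<Rightarrow> (real ^ 'n) set \<Rightarrow> (real ^ 'n \<Rightarrow> real) \<Rightarrow> (real ^ 'n \<Rightarrow> real) \<Rightarrow> real" where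
  "form_a s \<Omega> u v =
     (LINT x:\<Omega>|lborel. u x * v x) +
     frac_laplacian_const CARD('n) s / 2 *
       (\<integral>(x, y). (u x - u y) * (v x - v y) / norm (x - y) powr (real CARD('n) + 2 * s)
          \<partial>(lborel \<Otimes>\<^sub>M lborel))"

text \<open>
  The graph of the operator \<open>A\<^sub>s = I + (-\<Delta>)\<^sup>s\<close> on \<open>L\<^sup>2(\<Omega>)\<close> associated with the form:
  \<open>u\<close> is in its domain and \<open>A\<^sub>s u = f\<close>.
\<close>

definition op_A_graph ::
    "real \<Rightarrow> (real ^ 'n) set \<Rightarrow> ((real ^ 'n \<Rightarrow> real) \<times> (real ^ 'n \<Rightarrow> real)) set" where
  "op_A_graph s \<Omega> = {(u, f). u \<in> sobolev_H0 s \<Omega> \<and> f \<in> L2_on \<Omega> \<and>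
     (\<forall>v \<in> sobolev_H0 s \<Omega>. form_a s \<Omega> u v = (LINT x:\<Omega>|lborel. f x * v x))}"

definition eigenspace_A :: "real \<Rightarrow> (real ^ 'n) set \<Rightarrow> real \<Rightarrow> (real ^ 'n \<Rightarrow> real) set" where
  "eigenspace_A s \<Omega> \<mu> = {u. (u, \<lambda>x. \<mu> * u x) \<in> op_A_graph s \<Omega>}"

text \<open>
  \<open>has_L2_dim \<Omega> E k\<close>: the subspace \<open>E\<close> of \<open>L\<^sup>2(\<Omega>)\<close>, given by representatives, has a basis
  of length \<open>k\<close> modulo equality almost everywhere on \<open>\<Omega>\<close>.
\<close>

definition has_L2_dim :: "(real ^ 'n) set \<Rightarrow> (real ^ 'n \<Rightarrow> real) set \<Rightarrow> nat \<Rightarrow> bool" where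
  "has_L2_dim \<Omega> E k \<longleftrightarrow> (\<exists>b :: nat \<Rightarrow> real ^ 'n \<Rightarrow> real.
     (\<forall>i<k. b i \<in> E) \<and>
     (\<forall>c. (AE x\<in>\<Omega> in lborel. (\<Sum>i<k. c i * b i x) = 0) \<longrightarrow> (\<forall>i<k. c i = 0)) \<and>
     (\<forall>u\<in>E. \<exists>c. AE x\<in>\<Omega> in lborel. u x = (\<Sum>i<k. c i * b i x)))"

text \<open>
  The sequence lists all eigenvalues of \<open>A\<^sub>s\<close> in increasing order, each as often as its
  multiplicity; a \<open>\<mu>\<close> that is not an eigenvalue has multiplicity \<open>0\<close>.  Sequences start at index \<open>0\<close>.
\<close>

definition eigenvalue_sequence_A :: "real \<Rightarrow> (real ^ 'n) set \<Rightarrow> (nat \<Rightarrow> real) \<Rightarrow> bool" where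
  "eigenvalue_sequence_A s \<Omega> ev \<longleftrightarrow> incseq ev \<and>
     (\<forall>\<mu>. finite {j. ev j = \<mu>} \<and> has_L2_dim \<Omega> (eigenspace_A s \<Omega> \<mu>) (card {j. ev j = \<mu>}))"

text \<open>The principal real branch, defined on \<open>[-1/e, \<infinity>)\<close>; elsewhere the value is a dummy.\<close>

definition Lambert_W0 :: "real \<Rightarrow> real" where
  "Lambert_W0 x = (if x < - exp (- 1) then - 1 else THE w. - 1 \<le> w \<and> w * exp w = x)"

definition lambda_star :: "real \<Rightarrow> real \<Rightarrow> real" where
  "lambda_star t \<alpha> = (THE l. 1 \<le> l \<and> inverse l * exp (- 2 * t * l) = \<alpha>)"

definition j_star :: "(nat \<Rightarrow> real) \<Rightarrow> real \<Rightarrow> real \<Rightarrow> nat" where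
  "j_star ev t \<alpha> = card {j. ev j \<le> lambda_star t \<alpha>}"

end

theory Submission
  imports Defs "HOL-Probability.Characteristic_Functions" "HOL-Complex_Analysis.Great_Picard"
    "HOL-Library.Diagonal_Subsequence" "HOL-Real_Asymp.Real_Asymp"
begin

text \<open>
  The eigenvalue counting function is controlled through its Riesz means
  \<open>R \<Lambda> = (\<Sum>j. max 0 (\<Lambda> - ev j))\<close>, following Berezin, Li and Yau.  For the upper bound, the Fourier
  transform turns the form into the symbol \<open>1 + norm \<xi> powr (2 s)\<close>, and Bessel's inequality for the
  exponentials restricted to \<open>\<Omega>\<close> bounds the sum of the \<open>|u\<^sub>j(\<xi>)|\<^sup>2\<close> by the volume of \<open>\<Omega>\<close>.  For the lower
  bound, modulated cutoffs \<open>\<phi>(x) cis (\<xi> \<bullet> x)\<close> serve as coherent states: their fractional energy exceeds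
  \<open>norm \<xi> powr (2 s)\<close> times the square norm of \<open>\<phi>\<close> by at most the fractional energy of \<open>\<phi>\<close>, uniformly
  in \<open>\<xi>\<close>.  Hence \<open>R \<Lambda>\<close> grows like a constant times \<open>\<Lambda> powr (1 + N / (2 s))\<close>, and as \<open>R\<close> is convex with
  slope the counting function, difference quotients of \<open>R\<close> yield Weyl's law.

  All Fourier analysis is reduced to Gaussian integrals: the kernel \<open>norm h powr - (N + 2 s)\<close> is a
  superposition of Gaussians in \<open>h\<close>, and Plancherel's identity holds because the Gaussian energies of a
  function in \<open>H\<^sup>s\<close> vanish in the limit.  The lower bound also needs that no form value below \<open>\<Lambda>\<close> is left
  over on the orthogonal complement of the eigenfunctions; there a minimiser of the Rayleigh quotient
  would be a further eigenfunction.  It exists by compactness, which comes from the theorem of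
  Arzela and Ascoli applied to Gaussian smoothings.
\<close>

section \<open>Gaussian integrals and the fractional kernel\<close>

text \<open>Riesz means replace the counting function because \<open>max 0 (\<Lambda> - x)\<close>
  is convex in \<open>x\<close>: trial functions bound its trace from both sides, while a step
  function admits no such inequality. The spectrum is given only through dimensions of eigenspaces,
  without an orthonormal basis of the whole space. Every estimate therefore uses a finite
  orthonormal family of eigenfunctions, and the remainder is handled by a variational argument. The
  coherent states lose twice. The energy of the cutoff costs a term of order
  \<open>\<Lambda> powr (N / (2 * s))\<close>, one power of \<Lambda> below the main term, and the
  square norm of the cutoff stands in for the volume of the domain. Hence the cutoff stays fixed
  while \<Lambda> tends to infinity and exhausts the domain only afterwards. The summand
  \<open>I\<close> of the operator is a shift that disappears in the same way. Boundedness of the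
  domain puts its square integrable functions into L^1, so their Fourier transforms are absolutely
  convergent integrals. When the frequency side is damped by a Gaussian, the deficit from the square
  norm is exactly a multiple of a Gaussian energy; Bessel, Plancherel and compactness all come from
  this one identity.\<close>

lemma gauss_cis_real:
  fixes \<tau> t :: real
  assumes "0 < \<tau>"
  shows "has_bochner_integral lborel (\<lambda>x. of_real (exp (- \<tau> * x\<^sup>2)) * cis (t * x))
           (of_real (sqrt (pi / \<tau>) * exp (- t\<^sup>2 / (4 * \<tau>))) :: complex)"
proof -
  \<comment> \<open>Rescaling by \<open>c\<close> turns the exponent of the standard normal density,
    whose characteristic function is known, into \<open>- \<tau> * x^2\<close>.\<close>
  define c where "c = sqrt (2 * \<tau>)"
  have c: "c > 0" "c\<^sup>2 = 2 * \<tau>" using assms by (auto simp: c_def)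
  have "char std_normal_distribution (t / c) = of_real (exp (- (t / c)\<^sup>2 / 2))"
    by (simp add: char_std_normal_distribution)
  then have I: "(CLINT x|lborel. std_normal_density x *\<^sub>R iexp (t / c * x)) = of_real (exp (- (t / c)\<^sup>2 / 2))"
    unfolding char_def by (subst (asm) integral_density) auto
  have i: "integrable lborel (\<lambda>x. std_normal_density x *\<^sub>R iexp (t / c * x))"
    by (rule Bochner_Integration.integrable_bound[OF integrable_normal_density[of 1 0]])
       (auto simp: normal_density_def)
  have "has_bochner_integral lborel (\<lambda>x. std_normal_density x *\<^sub>R iexp (t / c * x)) (of_real (exp (- (t / c)\<^sup>2 / 2)))"
    using I i by (simp add: has_bochner_integral_iff)
  then have "has_bochner_integral lborel (\<lambda>x. std_normal_density (0 + c * x) *\<^sub>R iexp (t / c * (0 + c * x))) (of_real (exp (- (t / c)\<^sup>2 / 2)) /\<^sub>R \<bar>c\<bar>)"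
    using c by (subst (asm) lborel_has_bochner_integral_real_affine_iff[of c _ _ 0]) auto
  then have "has_bochner_integral lborel (\<lambda>x. complex_of_real (sqrt (2 * pi)) * (std_normal_density (0 + c * x) *\<^sub>R iexp (t / c * (0 + c * x)))) (of_real (sqrt (2 * pi)) * (of_real (exp (- (t / c)\<^sup>2 / 2)) /\<^sub>R \<bar>c\<bar>))"
    by (rule has_bochner_integral_mult_right) 
  moreover have "complex_of_real (sqrt (2 * pi)) * (std_normal_density (0 + c * x) *\<^sub>R iexp (t / c * (0 + c * x))) = of_real (exp (- \<tau> * x\<^sup>2)) * cis (t * x)" for x
    using c by (simp add: normal_density_def cis_conv_exp scaleR_conv_of_real power_mult_distrib)
  moreover have "sqrt (2 * pi) / c = sqrt (pi / \<tau>)"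
    using assms by (simp add: c_def real_sqrt_divide[symmetric])
  then have "complex_of_real (sqrt (2 * pi)) * (of_real (exp (- (t / c)\<^sup>2 / 2)) /\<^sub>R \<bar>c\<bar>) = of_real (sqrt (pi / \<tau>) * exp (- t\<^sup>2 / (4 * \<tau>)))"
    using c by (simp add: scaleR_conv_of_real power_divide field_simps flip: of_real_mult)
  ultimately show ?thesis by simp
qed

text \<open>Both the Gaussian and the character factor over the coordinates, so the integral is a
  product of one-dimensional ones.\<close>

lemma gauss_cis:
  fixes \<xi> :: "'a::euclidean_space"
  assumes "0 < \<tau>"
  shows "has_bochner_integral lborel (\<lambda>x. of_real (exp (- \<tau> * (norm x)\<^sup>2)) * cis (\<xi> \<bullet> x))
           (of_real ((pi / \<tau>) powr (DIM('a) / 2) * exp (- (norm \<xi>)\<^sup>2 / (4 * \<tau>))) :: complex)"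
proof -
  interpret product_sigma_finite "\<lambda>b::'a. lborel :: real measure"
    by standard
  let ?f = "\<lambda>b x. of_real (exp (- \<tau> * x\<^sup>2)) * cis ((\<xi> \<bullet> b) * x)"
  note g = gauss_cis_real[OF assms, unfolded has_bochner_integral_iff]
  have p: "of_real (exp (- \<tau> * (norm (\<Sum>b\<in>Basis. f b *\<^sub>R b))\<^sup>2)) * cis (\<xi> \<bullet> (\<Sum>b\<in>Basis. f b *\<^sub>R b))
      = (\<Prod>b\<in>Basis. ?f b (f b))" for f :: "'a \<Rightarrow> real"
  proof -
    have "(norm (\<Sum>b\<in>Basis. f b *\<^sub>R b))\<^sup>2 = (\<Sum>b\<in>Basis. (f b)\<^sup>2)"
      unfolding dot_square_norm[symmetric]
      by (subst euclidean_inner) (simp add: power2_eq_square inner_sum_left_Basis)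
    moreover have "\<xi> \<bullet> (\<Sum>b\<in>Basis. f b *\<^sub>R b) = (\<Sum>b\<in>Basis. (\<xi> \<bullet> b) * f b)"
      by (simp add: inner_sum_right mult.commute)
    moreover have "cis (sum h A) = (\<Prod>b\<in>A. cis (h b))" for h and A :: "'a set"
      by (induction A rule: infinite_finite_induct) (auto simp: cis_mult[symmetric])
    ultimately show ?thesis
      by (simp add: sum_distrib_left exp_sum prod.distrib sum_negf[symmetric] del: sum_negf)
  qed
  have i: "integrable (\<Pi>\<^sub>M b\<in>Basis. lborel) (\<lambda>f. \<Prod>b\<in>Basis. ?f b (f b))"
    by (rule product_integrable_prod) (use g in auto)
  have "(LINT f|(\<Pi>\<^sub>M b\<in>Basis. lborel). (\<Prod>b\<in>Basis. ?f b (f b))) = (\<Prod>b\<in>(Basis::'a set). (LINT x|lborel. ?f b x))"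
    by (rule product_integral_prod) (use g in auto)
  also have "\<dots> = (\<Prod>b\<in>(Basis::'a set). of_real (sqrt (pi / \<tau>) * exp (- (\<xi> \<bullet> b)\<^sup>2 / (4 * \<tau>))))"
    using g by simp
  also have "\<dots> = of_real ((pi / \<tau>) powr (DIM('a) / 2) * exp (- (norm \<xi>)\<^sup>2 / (4 * \<tau>)))"
  proof -
    have "sqrt (pi / \<tau>) ^ DIM('a) = (pi / \<tau>) powr (DIM('a) / 2)"
      using assms by (simp add: powr_half_sqrt[symmetric] powr_powr flip: powr_realpow)
    moreover have "(\<Prod>b\<in>(Basis::'a set). exp (- (\<xi> \<bullet> b)\<^sup>2 / (4 * \<tau>))) = exp (- (norm \<xi>)\<^sup>2 / (4 * \<tau>))"
      unfolding dot_square_norm[symmetric]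
      by (subst euclidean_inner) (simp add: exp_sum[symmetric] sum_negf power2_eq_square flip: sum_divide_distrib)
    ultimately show ?thesis by (simp only: of_real_prod[symmetric] prod.distrib prod_constant)
  qed
  finally have I: "(LINT f|(\<Pi>\<^sub>M b\<in>(Basis::'a set). lborel). (\<Prod>b\<in>Basis. ?f b (f b))) = \<dots>" .
  have "has_bochner_integral (\<Pi>\<^sub>M b\<in>(Basis::'a set). lborel)
      (\<lambda>f. of_real (exp (- \<tau> * (norm (\<Sum>b\<in>Basis. f b *\<^sub>R b))\<^sup>2)) * cis (\<xi> \<bullet> (\<Sum>b\<in>Basis. f b *\<^sub>R b)))
      (of_real ((pi / \<tau>) powr (DIM('a) / 2) * exp (- (norm \<xi>)\<^sup>2 / (4 * \<tau>))) :: complex)"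
    unfolding p has_bochner_integral_iff using i I by blast
  then show ?thesis
    by (subst lborel_eq, intro has_bochner_integral_distr borel_measurable_continuous_onI)
       (auto intro!: continuous_intros)
qed

lemma gauss_cos:
  fixes \<xi> :: "'a::euclidean_space"
  assumes "0 < \<tau>"
  shows "has_bochner_integral lborel (\<lambda>x. exp (- \<tau> * (norm x)\<^sup>2) * cos (\<xi> \<bullet> x))
           ((pi / \<tau>) powr (DIM('a) / 2) * exp (- (norm \<xi>)\<^sup>2 / (4 * \<tau>)))"
  using has_bochner_integral_Re[OF gauss_cis[OF assms, of \<xi>]] by simp

lemma gauss_integral:
  assumes "0 < \<tau>"
  shows "has_bochner_integral lborel (\<lambda>x::'a::euclidean_space. exp (- \<tau> * (norm x)\<^sup>2)) ((pi / \<tau>) powr (DIM('a) / 2))"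
  using gauss_cos[OF assms, of "0::'a"] by simp

section \<open>Gamma-type integrals on the half-line\<close>

lemma nn_integral_powr_exp:
  fixes b x :: real
  assumes "0 < b" "0 < x"
  shows "(\<integral>\<^sup>+\<tau>. ennreal (indicator {0<..} \<tau> * (\<tau> powr (x - 1) * exp (- b * \<tau>))) \<partial>lborel) = ennreal (Gamma x / b powr x)"
proof -
  have "ennreal (Gamma x) = (\<integral>\<^sup>+t. ennreal (indicator {0..} t * t powr (x - 1) / exp t) \<partial>lborel)"
    by (rule Gamma_conv_nn_integral_real) fact
  \<comment> \<open>At \<open>t = 0\<close> the factor \<open>t powr (x - 1)\<close> is
    \<open>0\<close>, so the two integrands agree at every point.\<close>
  also have "\<dots> = (\<integral>\<^sup>+t. ennreal (indicator {0<..} t * t powr (x - 1) / exp t) \<partial>lborel)"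
    by (intro nn_integral_cong) (auto split: split_indicator)
  also have "\<dots> = \<bar>b\<bar> * (\<integral>\<^sup>+t. ennreal (indicator {0<..} (0 + b * t) * (0 + b * t) powr (x - 1) / exp (0 + b * t)) \<partial>lborel)"
    using assms by (intro nn_integral_real_affine) auto
  also have "\<dots> = (\<integral>\<^sup>+t. ennreal (b powr x) * ennreal (indicator {0<..} t * (t powr (x - 1) * exp (- b * t))) \<partial>lborel)"
    using assms
    by (subst nn_integral_cmult[symmetric])
       (auto intro!: nn_integral_cong simp: ennreal_mult[symmetric] powr_mult exp_minus field_simps
          powr_diff zero_less_mult_iff split: split_indicator)
  also have "\<dots> = ennreal (b powr x) * (\<integral>\<^sup>+t. ennreal (indicator {0<..} t * (t powr (x - 1) * exp (- b * t))) \<partial>lborel)"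
    by (rule nn_integral_cmult) auto
  finally have *: "ennreal (Gamma x) = ennreal (b powr x) * (\<integral>\<^sup>+t. ennreal (indicator {0<..} t * (t powr (x - 1) * exp (- b * t))) \<partial>lborel)" .
  have "ennreal (Gamma x / b powr x) = ennreal (1 / b powr x) * ennreal (Gamma x)"
    using assms by (simp add: ennreal_mult[symmetric] Gamma_real_nonneg)
  also have "\<dots> = (\<integral>\<^sup>+t. ennreal (indicator {0<..} t * (t powr (x - 1) * exp (- b * t))) \<partial>lborel)"
    unfolding * using assms by (simp add: mult.assoc[symmetric] ennreal_mult[symmetric])
  finally show ?thesis ..
qed

lemma nn_integral_exp:
  fixes b :: real
  assumes "0 < b"
  shows "(\<integral>\<^sup>+\<tau>. ennreal (indicator {0<..} \<tau> * exp (- b * \<tau>)) \<partial>lborel) = ennreal (1 / b)"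
proof -
  have "(\<integral>\<^sup>+\<tau>. ennreal (indicator {0<..} \<tau> * exp (- b * \<tau>)) \<partial>lborel)
      = (\<integral>\<^sup>+\<tau>. ennreal (indicator {0<..} \<tau> * (\<tau> powr (1 - 1) * exp (- b * \<tau>))) \<partial>lborel)"
    by (intro nn_integral_cong) (auto split: split_indicator)
  also have "\<dots> = ennreal (1 / b)"
    using nn_integral_powr_exp[OF assms, of 1] assms by simp
  finally show ?thesis .
qed

text \<open>Tonelli's theorem in the form in which it is applied below: both iterated integrals come
  with their inner integrals already evaluated, and exceptional null sets such as the origin are
  allowed.\<close>

lemma nn_integral_swap:
  fixes f :: "'a::euclidean_space \<Rightarrow> 'b::euclidean_space \<Rightarrow> ennreal"
  assumes "case_prod f \<in> borel_measurable (lborel \<Otimes>\<^sub>M lborel)"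
    and "AE x in lborel. (\<integral>\<^sup>+y. f x y \<partial>lborel) = g x" and "AE y in lborel. (\<integral>\<^sup>+x. f x y \<partial>lborel) = h y"
  shows "(\<integral>\<^sup>+x. g x \<partial>lborel) = (\<integral>\<^sup>+y. h y \<partial>lborel)"
  using lborel_pair.Fubini'[OF assms(1)] nn_integral_cong_AE[OF assms(2)] nn_integral_cong_AE[OF assms(3)]
  by simp

text \<open>Writing \<open>1 / (1 + \<tau>)\<close> as the integral of
  \<open>exp (- (1 + \<tau>) * r)\<close> and integrating in \<tau> first leaves
  \<open>Gamma s * r powr - s * exp (- r)\<close>, which is again a Gamma integral.\<close>

lemma nn_integral_powr_div_add_one:
  fixes s :: real
  assumes "0 < s" "s < 1"
  shows "(\<integral>\<^sup>+\<tau>. ennreal (indicator {0<..} \<tau> * (\<tau> powr (s - 1) / (1 + \<tau>))) \<partial>lborel) = ennreal (Gamma s * Gamma (1 - s))"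
proof -
  have "(\<integral>\<^sup>+\<tau>. ennreal (indicator {0<..} \<tau> * (\<tau> powr (s - 1) / (1 + \<tau>))) \<partial>lborel)
    = (\<integral>\<^sup>+r. ennreal (Gamma s) * ennreal (indicator {0<..} r * (r powr ((1 - s) - 1) * exp (- 1 * r))) \<partial>lborel)"
  proof (rule nn_integral_swap[where f = "\<lambda>\<tau> r. ennreal (indicator {0<..} \<tau> * \<tau> powr (s - 1)) * ennreal (indicator {0<..} r * exp (- (1 + \<tau>) * r))"];
         (rule AE_I2)?)
    fix \<tau> :: real
    show "(\<integral>\<^sup>+r. ennreal (indicator {0<..} \<tau> * \<tau> powr (s - 1)) * ennreal (indicator {0<..} r * exp (- (1 + \<tau>) * r)) \<partial>lborel)
      = ennreal (indicator {0<..} \<tau> * (\<tau> powr (s - 1) / (1 + \<tau>)))"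
    proof (cases "\<tau> > 0")
      case True
      then have "(\<integral>\<^sup>+r. ennreal (indicator {0<..} r * exp (- (1 + \<tau>) * r)) \<partial>lborel) = ennreal (1 / (1 + \<tau>))"
        by (intro nn_integral_exp) auto
      moreover have "(\<lambda>r. ennreal (indicator {0<..} r * exp (- (1 + \<tau>) * r))) \<in> borel_measurable lborel"
        by measurable
      ultimately show ?thesis
        using True by (simp only: nn_integral_cmult) (simp add: ennreal_mult[symmetric])
    qed auto
  next
    fix r :: real
    show "(\<integral>\<^sup>+\<tau>. ennreal (indicator {0<..} \<tau> * \<tau> powr (s - 1)) * ennreal (indicator {0<..} r * exp (- (1 + \<tau>) * r)) \<partial>lborel)
      = ennreal (Gamma s) * ennreal (indicator {0<..} r * (r powr ((1 - s) - 1) * exp (- 1 * r)))"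
    proof (cases "r > 0")
      case True
      then have "ennreal (indicator {0<..} \<tau> * \<tau> powr (s - 1)) * ennreal (indicator {0<..} r * exp (- (1 + \<tau>) * r))
         = ennreal (exp (- r)) * ennreal (indicator {0<..} \<tau> * (\<tau> powr (s - 1) * exp (- r * \<tau>)))" for \<tau>
        by (auto simp: ennreal_mult[symmetric] exp_diff exp_minus field_simps exp_add split: split_indicator)
      moreover have m: "(\<lambda>\<tau>. ennreal (indicator {0<..} \<tau> * (\<tau> powr (s - 1) * exp (- r * \<tau>)))) \<in> borel_measurable lborel"
        by measurable
      ultimately show ?thesis
        using True assms by (simp only: nn_integral_cmult[OF m] nn_integral_powr_exp[OF True assms(1)])
          (simp add: ennreal_mult[symmetric] Gamma_real_nonneg powr_minus field_simps)
    qed auto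
  qed measurable
  also have "\<dots> = ennreal (Gamma s) * ennreal (Gamma (1 - s) / 1 powr (1 - s))"
    using nn_integral_powr_exp[of 1 "1 - s"] assms by (subst nn_integral_cmult) auto
  also have "\<dots> = ennreal (Gamma s * Gamma (1 - s))"
    using assms by (simp add: ennreal_mult[symmetric] Gamma_real_nonneg)
  finally show ?thesis .
qed

text \<open>By scaling, only the value at \<open>a = 1\<close> is unknown; integrating against \<open>exp (- a)\<close> determines it.\<close>

lemma nn_integral_one_minus_exp:
  fixes s a :: real
  assumes "0 < s" "s < 1" "0 \<le> a"
  shows "(\<integral>\<^sup>+\<tau>. ennreal (indicator {0<..} \<tau> * (\<tau> powr (s - 1) * (1 - exp (- a / \<tau>)))) \<partial>lborel) = ennreal (Gamma (1 - s) / s * a powr s)"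
proof -
  define J where "J a = (\<integral>\<^sup>+\<tau>. ennreal (indicator {0<..} \<tau> * (\<tau> powr (s - 1) * (1 - exp (- a / \<tau>)))) \<partial>lborel)" for a
  have J: "J a = ennreal (a powr s) * J 1" if "a > 0" for a
  proof -
    have "J a = \<bar>a\<bar> * (\<integral>\<^sup>+\<tau>. ennreal (indicator {0<..} (0 + a * \<tau>) * ((0 + a * \<tau>) powr (s - 1) * (1 - exp (- a / (0 + a * \<tau>))))) \<partial>lborel)"
      unfolding J_def using that by (intro nn_integral_real_affine) auto
    also have "\<dots> = (\<integral>\<^sup>+\<tau>. ennreal (a powr s) * ennreal (indicator {0<..} \<tau> * (\<tau> powr (s - 1) * (1 - exp (- 1 / \<tau>)))) \<partial>lborel)"
      using that
      by (subst nn_integral_cmult[symmetric])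
         (auto intro!: nn_integral_cong simp: ennreal_mult[symmetric] powr_mult powr_diff field_simps zero_less_mult_iff split: split_indicator)
    also have "\<dots> = ennreal (a powr s) * J 1"
      unfolding J_def by (rule nn_integral_cmult) auto
    finally show ?thesis .
  qed
  have inner: "(\<integral>\<^sup>+a. ennreal (indicator {0<..} a * (exp (- a) * (1 - exp (- a / \<tau>)))) \<partial>lborel) = ennreal (1 / (1 + \<tau>))"
    if "\<tau> > 0" for \<tau> :: real
  proof -
    have "(\<integral>\<^sup>+a. ennreal (indicator {0<..} a * (exp (- a) * (1 - exp (- a / \<tau>)))) \<partial>lborel)
      = (\<integral>\<^sup>+a. ennreal (indicator {0<..} a * exp (- 1 * a)) - ennreal (indicator {0<..} a * exp (- (1 + 1 / \<tau>) * a)) \<partial>lborel)"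
    proof (intro nn_integral_cong)
      fix a :: real
      have "exp (- (1 + 1 / \<tau>) * a) = exp (- a) * exp (- a / \<tau>)"
        unfolding exp_add[symmetric] by (rule arg_cong[of _ _ exp]) (simp add: algebra_simps)
      then show "ennreal (indicator {0<..} a * (exp (- a) * (1 - exp (- a / \<tau>))))
        = ennreal (indicator {0<..} a * exp (- 1 * a)) - ennreal (indicator {0<..} a * exp (- (1 + 1 / \<tau>) * a))"
        by (simp add: ennreal_minus right_diff_distrib)
    qed
    also have "\<dots> = ennreal (1 / 1) - ennreal (1 / (1 + 1 / \<tau>))"
    proof -
      have c: "0 < 1 + 1 / \<tau>" using that by (simp add: add_pos_pos)
      have "ennreal (indicator {0<..} a * exp (- (1 + 1 / \<tau>) * a)) \<le> ennreal (indicator {0<..} a * exp (- 1 * a))" for a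
        using that by (intro ennreal_leI) (auto simp: algebra_simps split: split_indicator)
      moreover have "(\<integral>\<^sup>+a. ennreal (indicator {0<..} a * exp (- (1 + 1 / \<tau>) * a)) \<partial>lborel) \<noteq> \<infinity>"
        by (simp only: nn_integral_exp[OF c]) simp
      ultimately show ?thesis
        by (subst nn_integral_diff) (simp_all only: nn_integral_exp[OF c] nn_integral_exp[OF zero_less_one], auto)
    qed
    also have "\<dots> = ennreal (1 / (1 + \<tau>))"
    proof -
      have "1 / 1 - 1 / (1 + 1 / \<tau>) = 1 / (1 + \<tau>)"
        using that by (simp add: divide_simps) (simp add: algebra_simps)?
      moreover have "0 \<le> 1 / (1 + 1 / \<tau>)" using that by simp
      ultimately show ?thesis by (simp only: ennreal_minus)
    qed
    finally show ?thesis .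
  qed
  \<comment> \<open>Scaling evaluates the integral of \<open>exp (- a) * J a\<close> as
    \<open>Gamma (1 + s) * J 1\<close>. In the other order, \<open>inner\<close> turns it into the
    integral of \<open>\<tau> powr (s - 1) / (1 + \<tau>)\<close>, which is known.\<close>
  have "ennreal (Gamma (1 + s)) * J 1 = (\<integral>\<^sup>+a. ennreal (indicator {0<..} a * (a powr ((1 + s) - 1) * exp (- 1 * a))) * J 1 \<partial>lborel)"
    using nn_integral_powr_exp[of 1 "1 + s"] assms by (subst nn_integral_multc) auto
  also have "\<dots> = (\<integral>\<^sup>+\<tau>. ennreal (indicator {0<..} \<tau> * (\<tau> powr (s - 1) / (1 + \<tau>))) \<partial>lborel)"
  proof (rule nn_integral_swap[where f = "\<lambda>a \<tau>. ennreal (indicator {0<..} a * exp (- a)) * ennreal (indicator {0<..} \<tau> * (\<tau> powr (s - 1) * (1 - exp (- a / \<tau>))))"];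
         (rule AE_I2)?)
    fix a :: real
    have "(\<integral>\<^sup>+\<tau>. ennreal (indicator {0<..} a * exp (- a)) * ennreal (indicator {0<..} \<tau> * (\<tau> powr (s - 1) * (1 - exp (- a / \<tau>)))) \<partial>lborel)
      = ennreal (indicator {0<..} a * exp (- a)) * J a"
      unfolding J_def by (rule nn_integral_cmult) measurable
    also have "\<dots> = ennreal (indicator {0<..} a * (a powr ((1 + s) - 1) * exp (- 1 * a))) * J 1"
    proof (cases "a > 0")
      case True
      then show ?thesis by (subst J[OF True]) (simp add: ennreal_mult mult_ac)
    qed simp
    finally show "(\<integral>\<^sup>+\<tau>. ennreal (indicator {0<..} a * exp (- a)) * ennreal (indicator {0<..} \<tau> * (\<tau> powr (s - 1) * (1 - exp (- a / \<tau>)))) \<partial>lborel) = \<dots>" .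
  next
    fix \<tau> :: real
    show "(\<integral>\<^sup>+a. ennreal (indicator {0<..} a * exp (- a)) * ennreal (indicator {0<..} \<tau> * (\<tau> powr (s - 1) * (1 - exp (- a / \<tau>)))) \<partial>lborel)
      = ennreal (indicator {0<..} \<tau> * (\<tau> powr (s - 1) / (1 + \<tau>)))"
    proof (cases "\<tau> > 0")
      case True
      then have "ennreal (indicator {0<..} a * exp (- a)) * ennreal (indicator {0<..} \<tau> * (\<tau> powr (s - 1) * (1 - exp (- a / \<tau>))))
        = ennreal (\<tau> powr (s - 1)) * ennreal (indicator {0<..} a * (exp (- a) * (1 - exp (- a / \<tau>))))" for a
        by (auto simp: ennreal_mult[symmetric] mult_ac split: split_indicator)
      moreover have m: "(\<lambda>a. ennreal (indicator {0<..} a * (exp (- a) * (1 - exp (- a / \<tau>))))) \<in> borel_measurable lborel"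
        by measurable
      ultimately show ?thesis
        using True by (simp only: nn_integral_cmult[OF m] inner[OF True]) (simp add: ennreal_mult[symmetric])
    qed auto
  qed measurable
  also have "\<dots> = ennreal (Gamma s * Gamma (1 - s))"
    by (rule nn_integral_powr_div_add_one) fact+
  finally have G: "ennreal (Gamma (1 + s)) * J 1 = ennreal (Gamma s * Gamma (1 - s))" .
  have g: "Gamma (1 + s) = s * Gamma s" "Gamma s > 0"
    using assms by (auto simp: Gamma_real_pos add.commute[of 1] intro!: Gamma_plus1 elim!: nonpos_Ints_cases)
  have g0: "Gamma s \<noteq> 0" using g(2) by (rule less_imp_neq[symmetric])
  have "J 1 = ennreal (1 / Gamma (1 + s)) * (ennreal (Gamma (1 + s)) * J 1)"
    using g(1) g0 assms by (simp add: mult.assoc[symmetric] ennreal_mult[symmetric])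
  also have "\<dots> = ennreal (Gamma (1 - s) / s)"
    unfolding G using g(1) g0 assms by (simp add: ennreal_mult[symmetric] Gamma_real_nonneg)
  finally have J1: "J 1 = ennreal (Gamma (1 - s) / s)" .
  show ?thesis
  proof (cases "a = 0")
    case False
    then show ?thesis
      using assms J[of a] unfolding J1 by (simp add: J_def ennreal_mult[symmetric] Gamma_real_nonneg mult.commute)
  qed simp
qed

section \<open>The kernel and the symbol as mixtures of Gaussians\<close>

text \<open>The mixing density for Gaussians of parameter \<tau>. The divisor
  \<open>Gamma (N / 2 + s)\<close> normalises the mixture to be exactly the kernel
  \<open>1 / norm h powr (N + 2 * s)\<close>.\<close>

definition heat_weight :: "nat \<Rightarrow> real \<Rightarrow> real \<Rightarrow> real" where
  "heat_weight N s \<tau> = indicator {0<..} \<tau> * (\<tau> powr (N / 2 + s - 1) / Gamma (N / 2 + s))"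

lemma heat_weight_nonneg [simp]: "0 < s \<Longrightarrow> 0 \<le> heat_weight N s \<tau>"
  by (auto simp: heat_weight_def Gamma_real_nonneg)

lemma heat_weight_eq_0 [simp]: "\<tau> \<le> 0 \<Longrightarrow> heat_weight N s \<tau> = 0"
  by (auto simp: heat_weight_def)

lemma heat_weight_measurable [measurable]: "heat_weight N s \<in> borel_measurable borel"
  unfolding heat_weight_def by measurable

lemma kernel_conv_heat:
  fixes h :: "'a::real_normed_vector"
  assumes "0 < s" "h \<noteq> 0"
  shows "(\<integral>\<^sup>+\<tau>. ennreal (heat_weight N s \<tau> * exp (- \<tau> * (norm h)\<^sup>2)) \<partial>lborel) = ennreal (1 / norm h powr (N + 2 * s))"
proof -
  define x where "x = N / 2 + s"
  have x: "0 < x" using assms by (simp add: x_def add_nonneg_pos)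
  have g: "0 < Gamma x" using x by (rule Gamma_real_pos)
  have "(\<integral>\<^sup>+\<tau>. ennreal (heat_weight N s \<tau> * exp (- \<tau> * (norm h)\<^sup>2)) \<partial>lborel)
     = (\<integral>\<^sup>+\<tau>. ennreal (1 / Gamma x) * ennreal (indicator {0<..} \<tau> * (\<tau> powr (x - 1) * exp (- (norm h)\<^sup>2 * \<tau>))) \<partial>lborel)"
    using g unfolding heat_weight_def x_def[symmetric]
    by (intro nn_integral_cong) (auto simp: ennreal_mult[symmetric] mult_ac split: split_indicator)
  also have "\<dots> = ennreal (1 / Gamma x) * ennreal (Gamma x / (norm h)\<^sup>2 powr x)"
    using assms x by (subst nn_integral_cmult, measurable, subst nn_integral_powr_exp, auto)
  also have "\<dots> = ennreal (1 / (norm h)\<^sup>2 powr x)"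
    using g by (simp add: ennreal_mult[symmetric])
  also have "(norm h)\<^sup>2 powr x = norm h powr (N + 2 * s)"
    using assms by (simp add: x_def powr_powr algebra_simps flip: powr_numeral)
  finally show ?thesis .
qed

lemma frac_laplacian_const_pos: "0 < s \<Longrightarrow> s < 1 \<Longrightarrow> 0 < frac_laplacian_const N s"
  by (auto simp: frac_laplacian_const_def add_nonneg_pos intro!: divide_pos_pos mult_pos_pos Gamma_real_pos)

text \<open>The factor \<open>(pi / \<tau>) powr (N / 2)\<close> cancels the dimension in the weight
  and leaves the integral of \<open>\<tau> powr (s - 1) * (1 - exp (- a / \<tau>))\<close> with
  \<open>a = r^2 / 4\<close>. Its value \<open>Gamma (1 - s) / s * a powr s\<close>, together with
  the powers of \<open>pi\<close> and the Gamma factor of the weight, is the origin of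
  \<open>frac_laplacian_const\<close>.\<close>

lemma symbol_conv_heat:
  fixes r s :: real
  assumes "0 < s" "s < 1" "0 \<le> r"
  shows "(\<integral>\<^sup>+\<tau>. ennreal (heat_weight N s \<tau> * ((pi / \<tau>) powr (N / 2) * (1 - exp (- r\<^sup>2 / (4 * \<tau>))))) \<partial>lborel)
    = ennreal (r powr (2 * s) / frac_laplacian_const N s)"
proof -
  define x where "x = N / 2 + s"
  have x: "0 < x" using assms by (simp add: x_def add_nonneg_pos)
  have g: "0 < Gamma x" "0 < Gamma (1 - s)" using x assms by (auto intro: Gamma_real_pos)
  have "(\<integral>\<^sup>+\<tau>. ennreal (heat_weight N s \<tau> * ((pi / \<tau>) powr (N / 2) * (1 - exp (- r\<^sup>2 / (4 * \<tau>))))) \<partial>lborel)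
    = (\<integral>\<^sup>+\<tau>. ennreal (pi powr (N / 2) / Gamma x) * ennreal (indicator {0<..} \<tau> * (\<tau> powr (s - 1) * (1 - exp (- (r\<^sup>2 / 4) / \<tau>)))) \<partial>lborel)"
  proof (intro nn_integral_cong)
    fix \<tau> :: real
    show "ennreal (heat_weight N s \<tau> * ((pi / \<tau>) powr (N / 2) * (1 - exp (- r\<^sup>2 / (4 * \<tau>)))))
      = ennreal (pi powr (N / 2) / Gamma x) * ennreal (indicator {0<..} \<tau> * (\<tau> powr (s - 1) * (1 - exp (- (r\<^sup>2 / 4) / \<tau>))))"
    proof (cases "\<tau> > 0")
      case True
      have "\<tau> powr (N / 2 + s - 1) * (pi / \<tau>) powr (N / 2) = pi powr (N / 2) * \<tau> powr (s - 1)"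
        using True by (simp add: powr_divide powr_add powr_diff)
      then have "\<tau> powr (x - 1) * ((pi / \<tau>) powr (N / 2) * (1 - exp (- r\<^sup>2 / (4 * \<tau>))))
        = pi powr (N / 2) * (\<tau> powr (s - 1) * (1 - exp (- (r\<^sup>2 / 4) / \<tau>)))"
        by (simp add: x_def mult.assoc[symmetric])
      moreover have "0 \<le> \<tau> powr (s - 1) * (1 - exp (- (r\<^sup>2 / 4) / \<tau>))" using True by simp
      ultimately show ?thesis
        using True g by (simp add: heat_weight_def x_def[symmetric] ennreal_mult[symmetric])
    qed simp
  qed
  also have "\<dots> = ennreal (pi powr (N / 2) / Gamma x) * ennreal (Gamma (1 - s) / s * (r\<^sup>2 / 4) powr s)"
    using assms by (subst nn_integral_cmult, measurable, subst nn_integral_one_minus_exp, auto)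
  also have "\<dots> = ennreal (r powr (2 * s) / frac_laplacian_const N s)"
  proof -
    have "(r\<^sup>2 / 4) powr s = r powr (2 * s) / 4 powr s"
      using assms by (cases "r = 0") (auto simp: powr_divide powr_powr simp flip: powr_numeral)
    then show ?thesis
      using g assms by (simp add: frac_laplacian_const_def x_def[symmetric] ennreal_mult[symmetric] mult_ac)
  qed
  finally show ?thesis .
qed

lemma AE_lborel_neq: "AE y in lborel. y \<noteq> (x::'a::euclidean_space)"
  by (rule AE_lborel_singleton)

text \<open>With the kernel written as a mixture, the integral over \<open>h\<close> is that of a
  Gaussian minus its Fourier transform, and the mixture of these values is the symbol.\<close>

lemma nn_integral_symbol:
  fixes \<xi> :: "'a::euclidean_space" and s :: real
  assumes "0 < s" "s < 1"
  shows "(\<integral>\<^sup>+h. ennreal ((1 - cos (\<xi> \<bullet> h)) / norm h powr (DIM('a) + 2 * s)) \<partial>lborel)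
    = ennreal (norm \<xi> powr (2 * s) / frac_laplacian_const DIM('a) s)"
proof -
  let ?w = "heat_weight DIM('a) s"
  have "(\<integral>\<^sup>+h. ennreal ((1 - cos (\<xi> \<bullet> h)) / norm h powr (DIM('a) + 2 * s)) \<partial>lborel)
    = (\<integral>\<^sup>+\<tau>. ennreal (?w \<tau> * ((pi / \<tau>) powr (DIM('a) / 2) * (1 - exp (- (norm \<xi>)\<^sup>2 / (4 * \<tau>))))) \<partial>lborel)"
  proof (rule nn_integral_swap[where f = "\<lambda>h \<tau>. ennreal (1 - cos (\<xi> \<bullet> h)) * ennreal (?w \<tau> * exp (- \<tau> * (norm h)\<^sup>2))"])
    show "AE h in lborel. (\<integral>\<^sup>+\<tau>. ennreal (1 - cos (\<xi> \<bullet> h)) * ennreal (?w \<tau> * exp (- \<tau> * (norm h)\<^sup>2)) \<partial>lborel)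
      = ennreal ((1 - cos (\<xi> \<bullet> h)) / norm h powr (DIM('a) + 2 * s))"
      using AE_lborel_neq[of "0::'a"]
    proof eventually_elim
      case (elim h)
      then show ?case
        using kernel_conv_heat[OF assms(1) elim, of "DIM('a)"]
        by (subst nn_integral_cmult) (auto simp: ennreal_mult[symmetric])
    qed
    show "AE \<tau> in lborel. (\<integral>\<^sup>+h. ennreal (1 - cos (\<xi> \<bullet> h)) * ennreal (?w \<tau> * exp (- \<tau> * (norm h)\<^sup>2)) \<partial>lborel)
      = ennreal (?w \<tau> * ((pi / \<tau>) powr (DIM('a) / 2) * (1 - exp (- (norm \<xi>)\<^sup>2 / (4 * \<tau>)))))"
    proof (rule AE_I2)
      fix \<tau> :: real
      show "(\<integral>\<^sup>+h. ennreal (1 - cos (\<xi> \<bullet> h)) * ennreal (?w \<tau> * exp (- \<tau> * (norm h)\<^sup>2)) \<partial>lborel)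
        = ennreal (?w \<tau> * ((pi / \<tau>) powr (DIM('a) / 2) * (1 - exp (- (norm \<xi>)\<^sup>2 / (4 * \<tau>)))))"
      proof (cases "\<tau> > 0")
        case True
        let ?g = "\<lambda>h. ?w \<tau> * (exp (- \<tau> * (norm h)\<^sup>2) - exp (- \<tau> * (norm h)\<^sup>2) * cos (\<xi> \<bullet> h))"
        have "has_bochner_integral lborel ?g
            (?w \<tau> * ((pi / \<tau>) powr (DIM('a) / 2) - (pi / \<tau>) powr (DIM('a) / 2) * exp (- (norm \<xi>)\<^sup>2 / (4 * \<tau>))))"
          by (intro has_bochner_integral_mult_right has_bochner_integral_diff gauss_integral gauss_cos True)
        then have "(\<integral>\<^sup>+h. ennreal (?g h) \<partial>lborel)
          = ennreal (?w \<tau> * ((pi / \<tau>) powr (DIM('a) / 2) - (pi / \<tau>) powr (DIM('a) / 2) * exp (- (norm \<xi>)\<^sup>2 / (4 * \<tau>))))"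
          unfolding has_bochner_integral_iff using assms
          by (subst nn_integral_eq_integral) (auto intro!: AE_I2 mult_nonneg_nonneg)
        moreover have "ennreal (1 - cos (\<xi> \<bullet> h)) * ennreal (?w \<tau> * exp (- \<tau> * (norm h)\<^sup>2)) = ennreal (?g h)" for h
          using assms by (simp add: ennreal_mult[symmetric] algebra_simps)
        ultimately show ?thesis by (simp add: algebra_simps)
      qed simp
    qed
  qed measurable
  also have "\<dots> = ennreal (norm \<xi> powr (2 * s) / frac_laplacian_const DIM('a) s)"
    using assms by (rule symbol_conv_heat) simp
  finally show ?thesis .
qed

section \<open>Fourier representation of the fractional energy\<close>

text \<open>Identities on the frequency side are proved for nonnegative extended integrals, where no
  integrability has to be known beforehand. This lemma and the next one extract integrability and
  the real statement from them.\<close>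

lemma nn_integral_cmult_leD:
  fixes f :: "'a \<Rightarrow> real"
  assumes f: "f \<in> borel_measurable M" "\<And>x. 0 \<le> f x" and k: "0 < k" "0 \<le> c"
    and le: "ennreal k * (\<integral>\<^sup>+x. ennreal (f x) \<partial>M) \<le> ennreal c"
  shows "integrable M f" "k * (LINT x|M. f x) \<le> c"
proof -
  have "(\<integral>\<^sup>+x. ennreal (f x) \<partial>M) \<noteq> \<infinity>"
    using le k by (auto simp: ennreal_mult_top top_unique)
  then show i: "integrable M f"
    using f by (intro integrableI_nonneg) (auto simp: top.not_eq_extremum)
  have "(\<integral>\<^sup>+x. ennreal (f x) \<partial>M) = ennreal (LINT x|M. f x)"
    using i f by (intro nn_integral_eq_integral) auto
  with le k show "k * (LINT x|M. f x) \<le> c"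
    by (simp add: ennreal_mult'[symmetric])
qed

lemma nn_integral_cmult_eqD:
  fixes f :: "'a \<Rightarrow> real"
  assumes f: "f \<in> borel_measurable M" "\<And>x. 0 \<le> f x" and k: "0 < k" "0 \<le> c"
    and eq: "ennreal k * (\<integral>\<^sup>+x. ennreal (f x) \<partial>M) = ennreal c"
  shows "integrable M f" "k * (LINT x|M. f x) = c"
proof -
  show i: "integrable M f"
    using nn_integral_cmult_leD[OF f k] eq by simp
  have "(\<integral>\<^sup>+x. ennreal (f x) \<partial>M) = ennreal (LINT x|M. f x)"
    using i f by (intro nn_integral_eq_integral) auto
  moreover have "0 \<le> (LINT x|M. f x)"
    using f by (intro Bochner_Integration.integral_nonneg) auto
  ultimately show "k * (LINT x|M. f x) = c"
    using eq k by (simp add: ennreal_mult'[symmetric])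
qed

lemma has_bochner_integral_pair_mult:
  fixes f :: "'a::euclidean_space \<Rightarrow> real" and g :: "'b::euclidean_space \<Rightarrow> real"
  assumes f: "integrable lborel f" and g: "integrable lborel g"
  shows "has_bochner_integral (lborel \<Otimes>\<^sub>M lborel) (\<lambda>(x, y). f x * g y)
           ((LINT x|lborel. f x) * (LINT y|lborel. g y))"
proof -
  note [measurable] = borel_measurable_integrable[OF f] borel_measurable_integrable[OF g]
  have i: "integrable (lborel \<Otimes>\<^sub>M lborel) (\<lambda>(x, y). f x * g y)"
    by (rule lborel_pair.Fubini_integrable) (use f g in \<open>auto simp: abs_mult\<close>)
  have "integral\<^sup>L (lborel \<Otimes>\<^sub>M lborel) (\<lambda>(x, y). f x * g y) = (LINT x|lborel. LINT y|lborel. f x * g y)"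
    using lborel_pair.integral_fst[OF i] by simp
  then show ?thesis using i by (simp add: has_bochner_integral_iff)
qed

lemma has_bochner_integral_pair_conv:
  fixes f g :: "'a::euclidean_space \<Rightarrow> real"
  assumes f: "integrable lborel f" and g: "integrable lborel g"
  shows "has_bochner_integral (lborel \<Otimes>\<^sub>M lborel) (\<lambda>(x, y). f x * g (x - y))
           ((LINT x|lborel. f x) * (LINT y|lborel. g y))"
proof -
  note [measurable] = borel_measurable_integrable[OF f] borel_measurable_integrable[OF g]
  \<comment> \<open>The reflection and translation \<open>y \<mapsto> x - y\<close> preserves
    Lebesgue measure.\<close>
  have ae: "lborel = distr lborel borel (\<lambda>y. x - y)" for x :: 'a
    by (subst lborel_affine[of "-1" x]) (simp_all add: density_1)
  have gi: "integrable lborel (\<lambda>y. g (x - y))" "(LINT y|lborel. g (x - y)) = (LINT y|lborel. g y)" if "integrable lborel g" for x and g :: "'a \<Rightarrow> real"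
  proof -
    have [measurable]: "g \<in> borel_measurable borel" using that by auto
    show "integrable lborel (\<lambda>y. g (x - y))"
      using that by (subst (asm) ae[of x]) (simp add: integrable_distr_eq)
    show "(LINT y|lborel. g (x - y)) = (LINT y|lborel. g y)"
      by (subst (2) ae[of x]) (simp add: integral_distr)
  qed
  have i: "integrable (lborel \<Otimes>\<^sub>M lborel) (\<lambda>(x, y). f x * g (x - y))"
    by (rule lborel_pair.Fubini_integrable) (use f g gi in \<open>auto simp: abs_mult gi(2)[OF integrable_abs]\<close>)
  have "integral\<^sup>L (lborel \<Otimes>\<^sub>M lborel) (\<lambda>(x, y). f x * g (x - y)) = (LINT x|lborel. LINT y|lborel. f x * g (x - y))"
    using lborel_pair.integral_fst[OF i] by simp
  then show ?thesis using i g by (simp add: has_bochner_integral_iff gi)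
qed

text \<open>The squared modulus of the Fourier transform without normalising factor; the unitary transform
  contributes the additional factor \<open>(2 * pi) powr - N\<close>.\<close>

definition fourier_sq :: "('a::euclidean_space \<Rightarrow> real) \<Rightarrow> 'a \<Rightarrow> real" where
  "fourier_sq u \<xi> = (LINT x|lborel. u x * cos (\<xi> \<bullet> x))\<^sup>2 + (LINT x|lborel. u x * sin (\<xi> \<bullet> x))\<^sup>2"

lemma fourier_sq_nonneg [simp]: "0 \<le> fourier_sq u \<xi>"
  by (simp add: fourier_sq_def)

lemma fourier_sq_measurable [measurable]:
  assumes [measurable]: "u \<in> borel_measurable borel"
  shows "fourier_sq u \<in> borel_measurable borel"
  unfolding fourier_sq_def by measurable

lemma inner_cos_sin_measurable [measurable]:
  "(\<lambda>x. cos (\<xi> \<bullet> x)) \<in> borel_measurable borel" "(\<lambda>x. sin (\<xi> \<bullet> x)) \<in> borel_measurable borel"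
  by (auto intro!: borel_measurable_continuous_onI continuous_intros)

lemma integrable_mult_bounded_real:
  fixes u g :: "'a \<Rightarrow> real"
  assumes "integrable M u" "g \<in> borel_measurable M" "\<And>x. \<bar>g x\<bar> \<le> B"
  shows "integrable M (\<lambda>x. u x * g x)"
proof (rule Bochner_Integration.integrable_bound[of _ "\<lambda>x. B * u x"])
  have "0 \<le> B" using assms(3) by (meson abs_ge_zero order_trans)
  then show "AE x in M. norm (u x * g x) \<le> norm (B * u x)"
    using assms(3) by (auto simp: abs_mult mult.commute[of "\<bar>u _\<bar>"] intro!: mult_right_mono)
qed (use assms in auto)

text \<open>The Gagliardo energy with its singular kernel replaced by a Gaussian; integrating it in
  \<tau> against \<open>heat_weight\<close> recovers \<open>gagliardo\<close>.\<close>

definition heat_energy :: "('a::euclidean_space \<Rightarrow> real) \<Rightarrow> real \<Rightarrow> real" where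
  "heat_energy u \<tau> = (\<integral>(x, y). (u x - u y)\<^sup>2 * exp (- \<tau> * (norm (x - y))\<^sup>2) \<partial>(lborel \<Otimes>\<^sub>M lborel))"

lemma heat_energy_nonneg: "0 \<le> heat_energy u \<tau>"
  unfolding heat_energy_def by (rule Bochner_Integration.integral_nonneg) auto

definition gagliardo :: "real \<Rightarrow> ('a::euclidean_space \<Rightarrow> real) \<Rightarrow> real" where
  "gagliardo s u = (\<integral>(x, y). (u x - u y)\<^sup>2 / norm (x - y) powr (real DIM('a) + 2 * s) \<partial>(lborel \<Otimes>\<^sub>M lborel))"

lemma gagliardo_nonneg: "0 \<le> gagliardo s u"
  unfolding gagliardo_def by (rule Bochner_Integration.integral_nonneg) auto

section \<open>Gaussian damping on the frequency side and Bessel's inequality\<close>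

context
  fixes u :: "'a::euclidean_space \<Rightarrow> real"
  assumes u1: "integrable lborel u" and u2: "integrable lborel (\<lambda>x. (u x)\<^sup>2)"
begin

private lemma um [measurable]: "u \<in> borel_measurable borel"
  using u1 by auto

lemma fourier_sq_double:
  "has_bochner_integral (lborel \<Otimes>\<^sub>M lborel) (\<lambda>(x, y). u x * u y * cos (\<xi> \<bullet> (x - y))) (fourier_sq u \<xi>)"
proof -
  have "has_bochner_integral (lborel \<Otimes>\<^sub>M lborel)
      (\<lambda>p. (case p of (x, y) \<Rightarrow> (u x * cos (\<xi> \<bullet> x)) * (u y * cos (\<xi> \<bullet> y))) + (case p of (x, y) \<Rightarrow> (u x * sin (\<xi> \<bullet> x)) * (u y * sin (\<xi> \<bullet> y))))
      (fourier_sq u \<xi>)"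
    unfolding fourier_sq_def power2_eq_square
    by (intro has_bochner_integral_add has_bochner_integral_pair_mult integrable_mult_bounded_real[OF u1, where B=1]) auto
  also have "(\<lambda>p. (case p of (x, y) \<Rightarrow> (u x * cos (\<xi> \<bullet> x)) * (u y * cos (\<xi> \<bullet> y))) + (case p of (x, y) \<Rightarrow> (u x * sin (\<xi> \<bullet> x)) * (u y * sin (\<xi> \<bullet> y))))
     = (\<lambda>(x, y). u x * u y * cos (\<xi> \<bullet> (x - y)))"
    by (auto simp: inner_diff_right cos_diff algebra_simps)
  finally show ?thesis .
qed

lemma heat_double_integrable:
  assumes "0 < \<tau>"
  shows "integrable (lborel \<Otimes>\<^sub>M lborel) (\<lambda>(x, y). u x * u y * exp (- \<tau> * (norm (x - y))\<^sup>2))"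
proof -
  have "integrable (lborel \<Otimes>\<^sub>M lborel) (\<lambda>p. (case p of (x, y) \<Rightarrow> u x * u y) * (case p of (x, y) \<Rightarrow> exp (- \<tau> * (norm (x - y))\<^sup>2)))"
    using has_bochner_integral_pair_mult[OF u1 u1] assms
    by (intro integrable_mult_bounded_real[where B=1]) (auto simp: has_bochner_integral_iff)
  then show ?thesis by (simp add: case_prod_unfold)
qed

text \<open>After inserting the double integral for \<open>fourier_sq\<close>, Fubini allows
  integrating in \<xi> first. The Gaussian with parameter \<open>1 / (4 * \<tau>)\<close> has a
  Fourier transform with parameter \<tau> in \<open>x - y\<close>.\<close>

lemma fourier_sq_gauss:
  assumes "0 < \<tau>"
  shows "has_bochner_integral lborel (\<lambda>\<xi>. exp (- (norm \<xi>)\<^sup>2 / (4 * \<tau>)) * fourier_sq u \<xi>)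
     ((4 * pi * \<tau>) powr (DIM('a) / 2) * (\<integral>(x, y). u x * u y * exp (- \<tau> * (norm (x - y))\<^sup>2) \<partial>(lborel \<Otimes>\<^sub>M lborel)))"
proof -
  define \<sigma> where "\<sigma> = 1 / (4 * \<tau>)"
  have \<sigma>: "0 < \<sigma>" using assms by (simp add: \<sigma>_def)
  let ?g = "\<lambda>\<xi>::'a. exp (- \<sigma> * (norm \<xi>)\<^sup>2)"
  let ?F = "\<lambda>\<xi> (p::'a \<times> 'a). ?g \<xi> * (u (fst p) * u (snd p) * cos (\<xi> \<bullet> (fst p - snd p)))"
  have gi: "integrable lborel ?g"
    using gauss_integral[OF \<sigma>, where 'a='a] by (simp add: has_bochner_integral_iff)
  have ui: "integrable lborel (\<lambda>p. u (fst p) * u (snd p))"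
    using has_bochner_integral_pair_mult[OF u1 u1] by (simp add: has_bochner_integral_iff lborel_prod case_prod_unfold)
  have Fm: "(\<lambda>(\<xi>, p). ?F \<xi> p) \<in> borel_measurable (lborel \<Otimes>\<^sub>M lborel)"
    by (simp add: lborel_prod[symmetric]) measurable
  have "integrable (lborel \<Otimes>\<^sub>M lborel) (\<lambda>(\<xi>, p). ?g \<xi> * (u (fst p) * u (snd p)))"
    using has_bochner_integral_pair_mult[OF gi ui] by (simp add: has_bochner_integral_iff)
  then have Fi: "integrable (lborel \<Otimes>\<^sub>M lborel) (\<lambda>(\<xi>, p). ?F \<xi> p)"
  proof (rule Bochner_Integration.integrable_bound[OF _ Fm], intro AE_I2)
    fix z :: "'a \<times> 'a \<times> 'a"
    have "\<bar>a * (b * cos c)\<bar> \<le> \<bar>a * b\<bar>" for a b c :: real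
      by (simp add: abs_mult mult_left_le mult.assoc[symmetric])
    then show "norm (case z of (\<xi>, p) \<Rightarrow> ?F \<xi> p) \<le> norm (case z of (\<xi>, p) \<Rightarrow> ?g \<xi> * (u (fst p) * u (snd p)))"
      by (simp add: case_prod_unfold)
  qed
  have 1: "(LINT p|lborel. ?F \<xi> p) = ?g \<xi> * fourier_sq u \<xi>" for \<xi>
    using fourier_sq_double[of \<xi>]
    by (simp add: has_bochner_integral_iff lborel_prod[symmetric] case_prod_unfold)
  have 2: "(LINT \<xi>|lborel. ?F \<xi> p) = (4 * pi * \<tau>) powr (DIM('a) / 2) * (u (fst p) * u (snd p) * exp (- \<tau> * (norm (fst p - snd p))\<^sup>2))" for p
  proof -
    have "(LINT \<xi>|lborel. exp (- \<sigma> * (norm \<xi>)\<^sup>2) * cos ((fst p - snd p) \<bullet> \<xi>)) = (pi / \<sigma>) powr (DIM('a) / 2) * exp (- (norm (fst p - snd p))\<^sup>2 / (4 * \<sigma>))"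
      using gauss_cos[OF \<sigma>, of "fst p - snd p"] by (simp add: has_bochner_integral_iff)
    moreover have "(LINT \<xi>|lborel. ?F \<xi> p) = (LINT \<xi>|lborel. (u (fst p) * u (snd p)) * (exp (- \<sigma> * (norm \<xi>)\<^sup>2) * cos ((fst p - snd p) \<bullet> \<xi>)))"
      by (simp add: mult_ac inner_commute)
    ultimately show ?thesis using assms by (simp add: \<sigma>_def mult_ac)
  qed
  have "integrable lborel (\<lambda>\<xi>. ?g \<xi> * fourier_sq u \<xi>)"
    using lborel_pair.integrable_fst[OF Fi] unfolding 1 .
  moreover have "(LINT \<xi>|lborel. ?g \<xi> * fourier_sq u \<xi>) = (LINT p|lborel. (LINT \<xi>|lborel. ?F \<xi> p))"
    using lborel_pair.integral_fst[OF Fi] lborel_pair.integral_snd[OF Fi] unfolding 1 by simp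
  moreover have "?g \<xi> = exp (- (norm \<xi>)\<^sup>2 / (4 * \<tau>))" for \<xi>
    by (simp add: \<sigma>_def)
  ultimately show ?thesis
    unfolding 2 by (simp add: has_bochner_integral_iff lborel_prod case_prod_unfold)
qed

text \<open>Expanding the square, each of the two pure terms is a convolution whose integral is the
  square norm times the total mass of the Gaussian; only the cross term keeps the interaction of
  \<open>x\<close> and \<open>y\<close>.\<close>

lemma heat_energy_eq:
  assumes "0 < \<tau>"
  shows "has_bochner_integral (lborel \<Otimes>\<^sub>M lborel) (\<lambda>(x, y). (u x - u y)\<^sup>2 * exp (- \<tau> * (norm (x - y))\<^sup>2))
    (2 * ((pi / \<tau>) powr (DIM('a) / 2) * (LINT x|lborel. (u x)\<^sup>2)
       - (\<integral>(x, y). u x * u y * exp (- \<tau> * (norm (x - y))\<^sup>2) \<partial>(lborel \<Otimes>\<^sub>M lborel))))"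
proof -
  let ?G = "\<lambda>h::'a. exp (- \<tau> * (norm h)\<^sup>2)"
  have G: "integrable lborel ?G" "(LINT h|lborel. ?G h) = (pi / \<tau>) powr (DIM('a) / 2)"
    using gauss_integral[OF assms, where 'a='a] by (simp_all add: has_bochner_integral_iff)
  have 1: "has_bochner_integral (lborel \<Otimes>\<^sub>M lborel) (\<lambda>(x, y). (u x)\<^sup>2 * ?G (x - y)) ((LINT x|lborel. (u x)\<^sup>2) * (pi / \<tau>) powr (DIM('a) / 2))"
    using has_bochner_integral_pair_conv[OF u2 G(1)] G(2) by simp
  have 2: "has_bochner_integral (lborel \<Otimes>\<^sub>M lborel) (\<lambda>(x, y). (u y)\<^sup>2 * ?G (x - y)) ((LINT x|lborel. (u x)\<^sup>2) * (pi / \<tau>) powr (DIM('a) / 2))"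
    using 1 lborel_pair.integrable_product_swap[of "\<lambda>(x, y). (u x)\<^sup>2 * ?G (x - y)"]
      lborel_pair.integral_product_swap[of "\<lambda>(x, y). (u x)\<^sup>2 * ?G (x - y)"]
    by (simp add: has_bochner_integral_iff norm_minus_commute borel_measurable_integrable)
  have 3: "has_bochner_integral (lborel \<Otimes>\<^sub>M lborel) (\<lambda>(x, y). u x * u y * ?G (x - y)) (\<integral>(x, y). u x * u y * ?G (x - y) \<partial>(lborel \<Otimes>\<^sub>M lborel))"
    using heat_double_integrable[OF assms] by (simp add: has_bochner_integral_iff)
  have "has_bochner_integral (lborel \<Otimes>\<^sub>M lborel)
     (\<lambda>p. (case p of (x, y) \<Rightarrow> (u x)\<^sup>2 * ?G (x - y)) + (case p of (x, y) \<Rightarrow> (u y)\<^sup>2 * ?G (x - y)) - 2 * (case p of (x, y) \<Rightarrow> u x * u y * ?G (x - y)))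
     ((LINT x|lborel. (u x)\<^sup>2) * (pi / \<tau>) powr (DIM('a) / 2) + (LINT x|lborel. (u x)\<^sup>2) * (pi / \<tau>) powr (DIM('a) / 2) - 2 * (\<integral>(x, y). u x * u y * ?G (x - y) \<partial>(lborel \<Otimes>\<^sub>M lborel)))"
    by (intro has_bochner_integral_add has_bochner_integral_diff has_bochner_integral_mult_right 1 2 3)
  also have "(\<lambda>p. (case p of (x, y) \<Rightarrow> (u x)\<^sup>2 * ?G (x - y)) + (case p of (x, y) \<Rightarrow> (u y)\<^sup>2 * ?G (x - y)) - 2 * (case p of (x, y) \<Rightarrow> u x * u y * ?G (x - y)))
    = (\<lambda>(x, y). (u x - u y)\<^sup>2 * ?G (x - y))"
    by (auto simp: power2_eq_square algebra_simps)
  finally show ?thesis by (simp add: algebra_simps)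
qed

text \<open>The cross term is eliminated between the two preceding identities. Discarding the energy
  gives Bessel's inequality, and letting it vanish as \<tau> grows gives Plancherel's
  identity.\<close>

lemma fourier_sq_gauss_energy:
  assumes "0 < \<tau>"
  shows "(2 * pi) powr (- DIM('a)) * (LINT \<xi>|lborel. exp (- (norm \<xi>)\<^sup>2 / (4 * \<tau>)) * fourier_sq u \<xi>)
    = (LINT x|lborel. (u x)\<^sup>2) - (\<tau> / pi) powr (DIM('a) / 2) * heat_energy u \<tau> / 2"
proof -
  let ?n = "DIM('a) / 2"
  have a: "(2 * pi) powr (- DIM('a)) * (4 * pi * \<tau>) powr ?n = (\<tau> / pi) powr ?n"
  proof -
    have "(2 * pi) powr (- DIM('a)) = ((2 * pi) powr 2) powr (- ?n)"
      unfolding powr_powr by simp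
    also have "(2 * pi) powr 2 = 4 * pi\<^sup>2"
      by (simp add: power_mult_distrib)
    finally have "(2 * pi) powr (- DIM('a)) * (4 * pi * \<tau>) powr ?n = (4 * pi * \<tau>) powr ?n / (4 * pi\<^sup>2) powr ?n"
      by (simp add: powr_minus_divide)
    also have "\<dots> = ((4 * pi * \<tau>) / (4 * pi\<^sup>2)) powr ?n"
      by (rule powr_divide[symmetric])
    also have "(4 * pi * \<tau>) / (4 * pi\<^sup>2) = \<tau> / pi"
      by (simp add: power2_eq_square)
    finally show ?thesis .
  qed
  have b: "(\<tau> / pi) powr ?n * (pi / \<tau>) powr ?n = 1"
    using assms by (simp add: powr_mult[symmetric])
  have gen: "a * I = X - a * (2 * (b * X - I)) / 2" if "a * b = 1" for a b I X :: real
    using that by (simp add: right_diff_distrib diff_divide_distrib mult.assoc[symmetric])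
  let ?I = "(\<integral>(x, y). u x * u y * exp (- \<tau> * (norm (x - y))\<^sup>2) \<partial>(lborel \<Otimes>\<^sub>M lborel))"
  have e: "heat_energy u \<tau> = 2 * ((pi / \<tau>) powr ?n * (LINT x|lborel. (u x)\<^sup>2) - ?I)"
    using heat_energy_eq[OF assms] by (simp add: has_bochner_integral_iff heat_energy_def)
  have "(2 * pi) powr (- DIM('a)) * (LINT \<xi>|lborel. exp (- (norm \<xi>)\<^sup>2 / (4 * \<tau>)) * fourier_sq u \<xi>)
    = (\<tau> / pi) powr ?n * ?I"
    using fourier_sq_gauss[OF assms] a by (simp add: has_bochner_integral_iff mult.assoc[symmetric])
  also have "\<dots> = (LINT x|lborel. (u x)\<^sup>2) - (\<tau> / pi) powr ?n * heat_energy u \<tau> / 2"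
    unfolding e by (rule gen[OF b])
  finally show ?thesis .
qed

lemma fourier_sq_gauss_le:
  assumes "0 < \<tau>"
  shows "(2 * pi) powr (- DIM('a)) * (LINT \<xi>|lborel. exp (- (norm \<xi>)\<^sup>2 / (4 * \<tau>)) * fourier_sq u \<xi>)
    \<le> (LINT x|lborel. (u x)\<^sup>2)"
  using fourier_sq_gauss_energy[OF assms] heat_energy_nonneg[of u \<tau>] by simp

lemma fourier_sq_gauss_limit:
  "(\<lambda>n. ennreal (LINT \<xi>|lborel. exp (- (norm \<xi>)\<^sup>2 / (4 * real (Suc n))) * fourier_sq u \<xi>))
     \<longlonglongrightarrow> (\<integral>\<^sup>+\<xi>. ennreal (fourier_sq u \<xi>) \<partial>lborel)"
proof -
  have "(\<lambda>n. \<integral>\<^sup>+\<xi>. ennreal (exp (- (norm \<xi>)\<^sup>2 / (4 * real (Suc n))) * fourier_sq u \<xi>) \<partial>lborel)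
     \<longlonglongrightarrow> (\<integral>\<^sup>+\<xi>. ennreal (fourier_sq u \<xi>) \<partial>lborel)"
  proof (rule nn_integral_LIMSEQ)
    show "incseq (\<lambda>n \<xi>. ennreal (exp (- (norm \<xi>)\<^sup>2 / (4 * real (Suc n))) * fourier_sq u \<xi>))"
      by (auto simp: incseq_def le_fun_def divide_simps mult_left_mono intro!: ennreal_leI mult_right_mono)
    show "(\<lambda>n. ennreal (exp (- (norm \<xi>)\<^sup>2 / (4 * real (Suc n))) * fourier_sq u \<xi>)) \<longlonglongrightarrow> ennreal (fourier_sq u \<xi>)" for \<xi>
    proof -
      have "(\<lambda>n. exp (- (norm \<xi>)\<^sup>2 / (4 * real (Suc n))) * fourier_sq u \<xi>) \<longlonglongrightarrow> exp 0 * fourier_sq u \<xi>"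
        by (intro tendsto_intros, real_asymp)
      then show ?thesis by (intro tendsto_ennrealI) simp
    qed
  qed auto
  moreover have "(\<integral>\<^sup>+\<xi>. ennreal (exp (- (norm \<xi>)\<^sup>2 / (4 * real (Suc n))) * fourier_sq u \<xi>) \<partial>lborel)
     = ennreal (LINT \<xi>|lborel. exp (- (norm \<xi>)\<^sup>2 / (4 * real (Suc n))) * fourier_sq u \<xi>)" for n
    using fourier_sq_gauss[of "real (Suc n)"]
    by (intro nn_integral_eq_integral) (auto simp: has_bochner_integral_iff)
  ultimately show ?thesis by simp
qed

text \<open>The damping factors increase to \<open>1\<close>, so the bound survives the limit. Only
  membership in L^1 and L^2 enters, which makes the inequality applicable to products of a cutoff
  and an eigenfunction.\<close>

lemma fourier_sq_bessel:
  "ennreal ((2 * pi) powr (- DIM('a))) * (\<integral>\<^sup>+\<xi>. ennreal (fourier_sq u \<xi>) \<partial>lborel) \<le> ennreal (LINT x|lborel. (u x)\<^sup>2)"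
proof (rule LIMSEQ_le_const2)
  show "(\<lambda>n. ennreal ((2 * pi) powr (- DIM('a))) * ennreal (LINT \<xi>|lborel. exp (- (norm \<xi>)\<^sup>2 / (4 * real (Suc n))) * fourier_sq u \<xi>))
    \<longlonglongrightarrow> ennreal ((2 * pi) powr (- DIM('a))) * (\<integral>\<^sup>+\<xi>. ennreal (fourier_sq u \<xi>) \<partial>lborel)"
    by (intro ennreal_tendsto_cmult fourier_sq_gauss_limit) simp
  show "\<exists>N. \<forall>n\<ge>N. ennreal ((2 * pi) powr (- DIM('a))) * ennreal (LINT \<xi>|lborel. exp (- (norm \<xi>)\<^sup>2 / (4 * real (Suc n))) * fourier_sq u \<xi>)
     \<le> ennreal (LINT x|lborel. (u x)\<^sup>2)"
  proof (intro exI[of _ 0] allI impI)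
    fix n
    show "ennreal ((2 * pi) powr (- DIM('a))) * ennreal (LINT \<xi>|lborel. exp (- (norm \<xi>)\<^sup>2 / (4 * real (Suc n))) * fourier_sq u \<xi>)
     \<le> ennreal (LINT x|lborel. (u x)\<^sup>2)"
      using fourier_sq_gauss_le[of "real (Suc n)"]
      by (subst ennreal_mult'[symmetric]) (simp_all del: of_nat_Suc add: ennreal_leI)
  qed
qed

section \<open>Plancherel's identity and the energy in terms of the symbol\<close>

context
  fixes s :: real
  assumes s: "0 < s" "s < 1"
    and uH: "integrable (lborel \<Otimes>\<^sub>M lborel) (\<lambda>(x, y). (u x - u y)\<^sup>2 / norm (x - y) powr (real DIM('a) + 2 * s))"
begin

text \<open>With \<open>q = N / 2 + s\<close>, raising \<open>y \<le> exp y\<close> at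
  \<open>y = \<tau> * r^2 / q\<close> to the power \<open>q\<close> bounds
  \<open>r powr (2 * q) * exp (- \<tau> * r^2)\<close> by \<open>q powr q * \<tau> powr - q\<close>.
  The prefactor consumes all of this decay but \<open>\<tau> powr - s\<close>, which drives both
  Plancherel's identity and compactness.\<close>

lemma heat_energy_le_gagliardo:
  assumes "0 < \<tau>"
  shows "(\<tau> / pi) powr (DIM('a) / 2) * heat_energy u \<tau>
    \<le> (DIM('a) / 2 + s) powr (DIM('a) / 2 + s) / pi powr (DIM('a) / 2) * \<tau> powr (- s) * gagliardo s u"
proof -
  define q where "q = DIM('a) / 2 + s"
  have q: "0 < q" using s by (simp add: q_def add_nonneg_pos)
  have *: "r powr (real DIM('a) + 2 * s) * exp (- \<tau> * r\<^sup>2) \<le> q powr q * \<tau> powr (- q)" if "0 \<le> r" for r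
  proof -
    have "\<tau> * r\<^sup>2 / q \<le> exp (\<tau> * r\<^sup>2 / q)"
      using exp_ge_add_one_self[of "\<tau> * r\<^sup>2 / q"] by linarith
    then have "(\<tau> * r\<^sup>2 / q) powr q \<le> exp (\<tau> * r\<^sup>2 / q) powr q"
      using q assms by (intro powr_mono2) auto
    also have "\<dots> = exp (\<tau> * r\<^sup>2)"
      using q by (simp add: powr_def)
    also have "(\<tau> * r\<^sup>2 / q) powr q = \<tau> powr q * r powr (real DIM('a) + 2 * s) / q powr q"
    proof -
      have "(r\<^sup>2) powr q = r powr (real DIM('a) + 2 * s)"
        using that q by (cases "r = 0") (auto simp: q_def powr_powr algebra_simps simp flip: powr_numeral)
      then show ?thesis using assms q by (simp add: powr_divide powr_mult)
    qed
    finally show ?thesis using assms q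
      by (simp add: exp_minus powr_minus field_simps)
  qed
  have "heat_energy u \<tau> \<le> (\<integral>p. q powr q * \<tau> powr (- q) * (case p of (x, y) \<Rightarrow> (u x - u y)\<^sup>2 / norm (x - y) powr (real DIM('a) + 2 * s)) \<partial>(lborel \<Otimes>\<^sub>M lborel))"
    unfolding heat_energy_def
  proof (rule integral_mono)
    show "integrable (lborel \<Otimes>\<^sub>M lborel) (\<lambda>(x, y). (u x - u y)\<^sup>2 * exp (- \<tau> * (norm (x - y))\<^sup>2))"
      using heat_energy_eq[OF assms] by (simp add: has_bochner_integral_iff)
    show "integrable (lborel \<Otimes>\<^sub>M lborel) (\<lambda>p. q powr q * \<tau> powr (- q) * (case p of (x, y) \<Rightarrow> (u x - u y)\<^sup>2 / norm (x - y) powr (real DIM('a) + 2 * s)))"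
      using uH by simp
    fix p :: "'a \<times> 'a"
    obtain x y where p: "p = (x, y)" by force
    show "(case p of (x, y) \<Rightarrow> (u x - u y)\<^sup>2 * exp (- \<tau> * (norm (x - y))\<^sup>2))
      \<le> q powr q * \<tau> powr (- q) * (case p of (x, y) \<Rightarrow> (u x - u y)\<^sup>2 / norm (x - y) powr (real DIM('a) + 2 * s))"
    proof (cases "x = y")
      case False
      then have "0 < norm (x - y) powr (real DIM('a) + 2 * s)" by simp
      then have "exp (- \<tau> * (norm (x - y))\<^sup>2) \<le> q powr q * \<tau> powr (- q) / norm (x - y) powr (real DIM('a) + 2 * s)"
        using *[of "norm (x - y)"] by (simp add: field_simps)
      then have "(u x - u y)\<^sup>2 * exp (- \<tau> * (norm (x - y))\<^sup>2) \<le> (u x - u y)\<^sup>2 * (q powr q * \<tau> powr (- q) / norm (x - y) powr (real DIM('a) + 2 * s))"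
        by (rule mult_left_mono) simp
      then show ?thesis by (simp add: p mult_ac)
    qed (simp add: p)
  qed
  also have "\<dots> = q powr q * \<tau> powr (- q) * gagliardo s u"
    unfolding gagliardo_def by simp
  finally have "(\<tau> / pi) powr (DIM('a) / 2) * heat_energy u \<tau> \<le> (\<tau> / pi) powr (DIM('a) / 2) * (q powr q * \<tau> powr (- q) * gagliardo s u)"
    by (rule mult_left_mono) simp
  also have "(\<tau> / pi) powr (DIM('a) / 2) * (q powr q * \<tau> powr (- q) * gagliardo s u) = q powr q / pi powr (DIM('a) / 2) * \<tau> powr (- s) * gagliardo s u"
  proof -
    have "(\<tau> / pi) powr (DIM('a) / 2) * \<tau> powr (- q) = \<tau> powr (- s) / pi powr (DIM('a) / 2)"
      using assms by (simp add: powr_divide powr_add[symmetric] q_def)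
    then show ?thesis by (simp add: mult_ac)
  qed
  finally show ?thesis by (simp add: q_def)
qed

text \<open>The deficit in the damped identity is at most a constant times
  \<open>\<tau> powr - s\<close>, hence tends to zero along \<tau> = 1, 2, and so on.\<close>

lemma plancherel:
  "ennreal ((2 * pi) powr (- DIM('a))) * (\<integral>\<^sup>+\<xi>. ennreal (fourier_sq u \<xi>) \<partial>lborel) = ennreal (LINT x|lborel. (u x)\<^sup>2)"
proof -
  let ?e = "\<lambda>n. (real (Suc n) / pi) powr (DIM('a) / 2) * heat_energy u (real (Suc n))"
  have "?e \<longlonglongrightarrow> 0"
  proof (rule tendsto_sandwich)
    show "\<forall>\<^sub>F n in sequentially. 0 \<le> ?e n"
      by (intro always_eventually allI mult_nonneg_nonneg heat_energy_nonneg) simp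
    let ?c = "(DIM('a) / 2 + s) powr (DIM('a) / 2 + s) / pi powr (DIM('a) / 2)"
    show "\<forall>\<^sub>F n in sequentially. ?e n \<le> ?c * real (Suc n) powr (- s) * gagliardo s u"
      by (intro always_eventually allI heat_energy_le_gagliardo) simp
    have "(\<lambda>n. real (Suc n) powr (- s)) \<longlonglongrightarrow> 0"
      using s by (intro tendsto_neg_powr filterlim_compose[OF filterlim_real_sequentially filterlim_Suc]) auto
    then show "(\<lambda>n. ?c * real (Suc n) powr (- s) * gagliardo s u) \<longlonglongrightarrow> 0"
      by (intro tendsto_mult_left_zero tendsto_mult_right_zero)
  qed simp
  then have "(\<lambda>n. (LINT x|lborel. (u x)\<^sup>2) - ?e n / 2) \<longlonglongrightarrow> (LINT x|lborel. (u x)\<^sup>2) - 0 / 2"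
    by (intro tendsto_intros) simp_all
  then have "(\<lambda>n. (2 * pi) powr (- DIM('a)) * (LINT \<xi>|lborel. exp (- (norm \<xi>)\<^sup>2 / (4 * real (Suc n))) * fourier_sq u \<xi>))
     \<longlonglongrightarrow> (LINT x|lborel. (u x)\<^sup>2)"
    by (subst fourier_sq_gauss_energy) auto
  then have 1: "(\<lambda>n. ennreal ((2 * pi) powr (- DIM('a))) * ennreal (LINT \<xi>|lborel. exp (- (norm \<xi>)\<^sup>2 / (4 * real (Suc n))) * fourier_sq u \<xi>))
     \<longlonglongrightarrow> ennreal (LINT x|lborel. (u x)\<^sup>2)"
    by (subst ennreal_mult'[symmetric]) (auto intro: tendsto_ennrealI)
  have 2: "(\<lambda>n. ennreal ((2 * pi) powr (- DIM('a))) * ennreal (LINT \<xi>|lborel. exp (- (norm \<xi>)\<^sup>2 / (4 * real (Suc n))) * fourier_sq u \<xi>))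
    \<longlonglongrightarrow> ennreal ((2 * pi) powr (- DIM('a))) * (\<integral>\<^sup>+\<xi>. ennreal (fourier_sq u \<xi>) \<partial>lborel)"
    by (intro ennreal_tendsto_cmult fourier_sq_gauss_limit) simp
  show ?thesis by (rule LIMSEQ_unique[OF 2 1])
qed

lemma fourier_sq_integrable: "integrable lborel (fourier_sq u)"
  and plancherel_real: "(2 * pi) powr (- DIM('a)) * (LINT \<xi>|lborel. fourier_sq u \<xi>) = (LINT x|lborel. (u x)\<^sup>2)"
  using nn_integral_cmult_eqD[OF _ _ _ _ plancherel] by auto

text \<open>This is Plancherel's identity minus its damped version, solved for the energy.\<close>

lemma heat_energy_fourier:
  assumes "0 < \<tau>"
  shows "ennreal (heat_energy u \<tau>) = ennreal (2 * (2 * pi) powr (- DIM('a))) *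
    (\<integral>\<^sup>+\<xi>. ennreal ((pi / \<tau>) powr (DIM('a) / 2) * (1 - exp (- (norm \<xi>)\<^sup>2 / (4 * \<tau>)))) * ennreal (fourier_sq u \<xi>) \<partial>lborel)"
proof -
  let ?n = "DIM('a) / 2" and ?K = "(2 * pi) powr (- DIM('a))"
  let ?E = "\<lambda>\<xi>::'a. exp (- (norm \<xi>)\<^sup>2 / (4 * \<tau>))"
  have gi: "integrable lborel (\<lambda>\<xi>. ?E \<xi> * fourier_sq u \<xi>)"
    using fourier_sq_gauss[OF assms] by (simp add: has_bochner_integral_iff)
  have di: "integrable lborel (\<lambda>\<xi>. (pi / \<tau>) powr ?n * (fourier_sq u \<xi> - ?E \<xi> * fourier_sq u \<xi>))"
    using gi fourier_sq_integrable by simp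
  have b: "(\<tau> / pi) powr ?n * (pi / \<tau>) powr ?n = 1"
    using assms by (simp add: powr_mult[symmetric])
  have "heat_energy u \<tau> = (pi / \<tau>) powr ?n * ((\<tau> / pi) powr ?n * heat_energy u \<tau>)"
    using b by (simp add: mult_ac)
  also have "(\<tau> / pi) powr ?n * heat_energy u \<tau> = 2 * ?K * (LINT \<xi>|lborel. fourier_sq u \<xi> - ?E \<xi> * fourier_sq u \<xi>)"
    using fourier_sq_gauss_energy[OF assms] plancherel_real gi fourier_sq_integrable
    by (simp add: Bochner_Integration.integral_diff algebra_simps)
  also have "(pi / \<tau>) powr ?n * (2 * ?K * (LINT \<xi>|lborel. fourier_sq u \<xi> - ?E \<xi> * fourier_sq u \<xi>))
    = 2 * ?K * (LINT \<xi>|lborel. (pi / \<tau>) powr ?n * (fourier_sq u \<xi> - ?E \<xi> * fourier_sq u \<xi>))"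
    by simp
  finally have *: "heat_energy u \<tau> = \<dots>" .
  have nn: "0 \<le> (pi / \<tau>) powr ?n * (fourier_sq u \<xi> - ?E \<xi> * fourier_sq u \<xi>)" for \<xi>
    using assms by (auto intro!: mult_nonneg_nonneg mult_left_le_one_le)
  have "ennreal (heat_energy u \<tau>) = ennreal (2 * ?K) * (\<integral>\<^sup>+\<xi>. ennreal ((pi / \<tau>) powr ?n * (fourier_sq u \<xi> - ?E \<xi> * fourier_sq u \<xi>)) \<partial>lborel)"
    unfolding * using di nn by (subst nn_integral_eq_integral) (auto simp: ennreal_mult')
  also have "(\<lambda>\<xi>. ennreal ((pi / \<tau>) powr ?n * (fourier_sq u \<xi> - ?E \<xi> * fourier_sq u \<xi>)))
    = (\<lambda>\<xi>. ennreal ((pi / \<tau>) powr ?n * (1 - ?E \<xi>)) * ennreal (fourier_sq u \<xi>))"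
    by (rule ext, subst ennreal_mult''[symmetric]) (simp_all add: algebra_simps)
  finally show ?thesis .
qed

text \<open>Both sides are integrated in \<tau> against \<open>heat_weight\<close>: in the variables
  \<open>x\<close> and \<open>y\<close> the Gaussians add up to the singular kernel, on the
  frequency side the damping factors add up to the symbol.\<close>

lemma gagliardo_fourier:
  "ennreal (frac_laplacian_const DIM('a) s / 2 * gagliardo s u)
    = ennreal ((2 * pi) powr (- DIM('a))) * (\<integral>\<^sup>+\<xi>. ennreal (norm \<xi> powr (2 * s) * fourier_sq u \<xi>) \<partial>lborel)"
proof -
  let ?w = "heat_weight DIM('a) s" and ?C = "frac_laplacian_const DIM('a) s" and ?K = "(2 * pi) powr (- DIM('a))"
  let ?P = "lborel \<Otimes>\<^sub>M lborel :: ('a \<times> 'a) measure"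
  let ?m = "\<lambda>\<tau> \<xi>. ?w \<tau> * ((pi / \<tau>) powr (DIM('a) / 2) * (1 - exp (- (norm (\<xi>::'a))\<^sup>2 / (4 * \<tau>))))"
  have C: "0 < ?C" using s by (rule frac_laplacian_const_pos)
  have "ennreal (gagliardo s u) = (\<integral>\<^sup>+p. ennreal (case p of (x, y) \<Rightarrow> (u x - u y)\<^sup>2 / norm (x - y) powr (real DIM('a) + 2 * s)) \<partial>?P)"
    unfolding gagliardo_def using uH by (intro nn_integral_eq_integral[symmetric]) auto
  also have "\<dots> = (\<integral>\<^sup>+\<tau>. ennreal (?w \<tau>) * ennreal (heat_energy u \<tau>) \<partial>lborel)"
    unfolding lborel_prod
  proof (rule nn_integral_swap[where f = "\<lambda>p \<tau>. ennreal (case p of (x, y) \<Rightarrow> (u x - u y)\<^sup>2) * ennreal (?w \<tau> * exp (- \<tau> * (norm (fst p - snd p))\<^sup>2))"];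
         (rule AE_I2)?)
    show "(\<lambda>(p, \<tau>). ennreal (case p of (x, y) \<Rightarrow> (u x - u y)\<^sup>2) * ennreal (?w \<tau> * exp (- \<tau> * (norm (fst p - snd p))\<^sup>2)))
      \<in> borel_measurable (lborel \<Otimes>\<^sub>M lborel)"
      by (simp add: lborel_prod[symmetric]) measurable
    fix p :: "'a \<times> 'a"
    obtain x y where p: "p = (x, y)" by force
    show "(\<integral>\<^sup>+\<tau>. ennreal (case p of (x, y) \<Rightarrow> (u x - u y)\<^sup>2) * ennreal (?w \<tau> * exp (- \<tau> * (norm (fst p - snd p))\<^sup>2)) \<partial>lborel)
      = ennreal (case p of (x, y) \<Rightarrow> (u x - u y)\<^sup>2 / norm (x - y) powr (real DIM('a) + 2 * s))"
    proof (cases "x = y")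
      case False
      then have k: "(\<integral>\<^sup>+\<tau>. ennreal (?w \<tau> * exp (- \<tau> * (norm (x - y))\<^sup>2)) \<partial>lborel) = ennreal (1 / norm (x - y) powr (real DIM('a) + 2 * s))"
        using s by (intro kernel_conv_heat) auto
      show ?thesis
        unfolding p prod.case fst_conv snd_conv
        by (subst nn_integral_cmult, measurable, subst k, simp add: ennreal_mult'[symmetric])
    qed (simp add: p)
  next
    fix \<tau> :: real
    show "(\<integral>\<^sup>+p. ennreal (case p of (x, y) \<Rightarrow> (u x - u y)\<^sup>2) * ennreal (?w \<tau> * exp (- \<tau> * (norm (fst p - snd p))\<^sup>2)) \<partial>lborel)
      = ennreal (?w \<tau>) * ennreal (heat_energy u \<tau>)"
      unfolding lborel_prod[symmetric]
    proof (cases "\<tau> > 0")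
      case True
      let ?h = "\<lambda>p. ennreal (case p of (x, y) \<Rightarrow> (u x - u y)\<^sup>2 * exp (- \<tau> * (norm (x - y))\<^sup>2))"
      have "(\<integral>\<^sup>+p. ennreal (case p of (x, y) \<Rightarrow> (u x - u y)\<^sup>2) * ennreal (?w \<tau> * exp (- \<tau> * (norm (fst p - snd p))\<^sup>2)) \<partial>?P)
        = (\<integral>\<^sup>+p. ennreal (?w \<tau>) * ?h p \<partial>?P)"
        using s by (intro nn_integral_cong) (auto simp: ennreal_mult'[symmetric] mult_ac split: prod.split)
      also have "\<dots> = ennreal (?w \<tau>) * (\<integral>\<^sup>+p. ?h p \<partial>?P)"
        by (rule nn_integral_cmult) measurable
      also have "(\<integral>\<^sup>+p. ?h p \<partial>?P) = ennreal (heat_energy u \<tau>)"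
        unfolding heat_energy_def using heat_energy_eq[OF True]
        by (intro nn_integral_eq_integral) (auto simp: has_bochner_integral_iff)
      finally show "(\<integral>\<^sup>+p. ennreal (case p of (x, y) \<Rightarrow> (u x - u y)\<^sup>2) * ennreal (?w \<tau> * exp (- \<tau> * (norm (fst p - snd p))\<^sup>2)) \<partial>?P)
        = ennreal (?w \<tau>) * ennreal (heat_energy u \<tau>)" .
    qed simp
  qed
  also have "\<dots> = (\<integral>\<^sup>+\<xi>. ennreal (2 * ?K / ?C) * ennreal (norm \<xi> powr (2 * s) * fourier_sq u \<xi>) \<partial>lborel)"
  proof (rule nn_integral_swap[where f = "\<lambda>\<tau> \<xi>. ennreal (2 * ?K) * (ennreal (?m \<tau> \<xi>) * ennreal (fourier_sq u \<xi>))"]; (rule AE_I2)?)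
    fix \<tau> :: real
    show "(\<integral>\<^sup>+\<xi>. ennreal (2 * ?K) * (ennreal (?m \<tau> \<xi>) * ennreal (fourier_sq u \<xi>)) \<partial>lborel) = ennreal (?w \<tau>) * ennreal (heat_energy u \<tau>)"
    proof (cases "\<tau> > 0")
      case True
      have "ennreal (?w \<tau>) * ennreal (heat_energy u \<tau>) = (\<integral>\<^sup>+\<xi>. ennreal (?w \<tau>) * (ennreal (2 * ?K) *
         (ennreal ((pi / \<tau>) powr (DIM('a) / 2) * (1 - exp (- (norm \<xi>)\<^sup>2 / (4 * \<tau>)))) * ennreal (fourier_sq u \<xi>))) \<partial>lborel)"
        unfolding heat_energy_fourier[OF True] by (simp add: nn_integral_cmult)
      also have "\<dots> = (\<integral>\<^sup>+\<xi>. ennreal (2 * ?K) * (ennreal (?m \<tau> \<xi>) * ennreal (fourier_sq u \<xi>)) \<partial>lborel)"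
        using s by (intro nn_integral_cong) (simp add: ennreal_mult' mult_ac)
      finally show ?thesis ..
    qed simp
  next
    fix \<xi> :: 'a
    have "(\<integral>\<^sup>+\<tau>. ennreal (2 * ?K) * (ennreal (?m \<tau> \<xi>) * ennreal (fourier_sq u \<xi>)) \<partial>lborel)
      = ennreal (2 * ?K) * ((\<integral>\<^sup>+\<tau>. ennreal (?m \<tau> \<xi>) \<partial>lborel) * ennreal (fourier_sq u \<xi>))"
      by (subst nn_integral_cmult, measurable, subst nn_integral_multc, auto)
    also have "\<dots> = ennreal (2 * ?K) * (ennreal (norm \<xi> powr (2 * s) / ?C) * ennreal (fourier_sq u \<xi>))"
      using s by (subst symbol_conv_heat) auto
    also have "\<dots> = ennreal (2 * ?K / ?C) * ennreal (norm \<xi> powr (2 * s) * fourier_sq u \<xi>)"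
      using C by (simp add: ennreal_mult'[symmetric])
    finally show "(\<integral>\<^sup>+\<tau>. ennreal (2 * ?K) * (ennreal (?m \<tau> \<xi>) * ennreal (fourier_sq u \<xi>)) \<partial>lborel) = \<dots>" .
  qed measurable
  also have "\<dots> = ennreal (2 * ?K / ?C) * (\<integral>\<^sup>+\<xi>. ennreal (norm \<xi> powr (2 * s) * fourier_sq u \<xi>) \<partial>lborel)"
    by (rule nn_integral_cmult) measurable
  finally have "ennreal (?C / 2) * ennreal (gagliardo s u) = ennreal (?C / 2) * (ennreal (2 * ?K / ?C) * (\<integral>\<^sup>+\<xi>. ennreal (norm \<xi> powr (2 * s) * fourier_sq u \<xi>) \<partial>lborel))"
    by simp
  then show ?thesis
    using C by (simp add: ennreal_mult'[symmetric] mult.assoc[symmetric])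
qed

end
end

section \<open>Coercive forms and Rayleigh quotients\<close>

text \<open>Differences are written as linear combinations, so that linearity in the form \<open>lin\<close> below
  applies to them directly.\<close>

abbreviation fdiff :: "('x \<Rightarrow> real) \<Rightarrow> ('x \<Rightarrow> real) \<Rightarrow> 'x \<Rightarrow> real" where
  "fdiff u v \<equiv> \<lambda>x. 1 * u x + (-1) * v x"

lemma quadratic_nonneg_discriminant:
  fixes A B C :: real
  assumes "\<And>t. 0 \<le> A + 2 * t * B + t\<^sup>2 * C" and "0 \<le> C"
  shows "B\<^sup>2 \<le> A * C"
proof (cases "C = 0")
  case True
  have "B = 0"
  proof (rule ccontr)
    assume "B \<noteq> 0"
    \<comment> \<open>At this value of \<open>t\<close> the remaining linear expression equals
      \<open>-1\<close>.\<close>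
    then show False using assms(1)[of "- (A + 1) / (2 * B)"] True by (simp add: field_simps)
  qed
  then show ?thesis using True by simp
next
  case False
  with assms have C: "0 < C" by simp
  have "0 \<le> C * (A + 2 * (- B / C) * B + (- B / C)\<^sup>2 * C)"
    using assms(1)[of "- B / C"] C by simp
  also have "\<dots> = A * C - B\<^sup>2"
    using C by (simp add: field_simps power2_eq_square)
  finally show ?thesis by simp
qed

section \<open>Pairs of forms and projections onto eigenfunctions\<close>

text \<open>Vectors are representatives, not classes, so \<open>ip\<close> is only semidefinite and
  \<open>ip u u = 0\<close> plays the role of \<open>u = 0\<close>. The constant \<open>1\<close> in
  \<open>coercive\<close> comes from the summand \<open>I\<close> of the operator. The locale is
  also instantiated with \<open>a\<close> equal to \<open>ip\<close>, to obtain Bessel's inequality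
  outside the Sobolev space.\<close>

locale form_pair =
  fixes V :: "('x \<Rightarrow> real) set" and ip a :: "('x \<Rightarrow> real) \<Rightarrow> ('x \<Rightarrow> real) \<Rightarrow> real"
  assumes zero: "(\<lambda>x. 0) \<in> V"
    and lin: "u \<in> V \<Longrightarrow> v \<in> V \<Longrightarrow> (\<lambda>x. c * u x + d * v x) \<in> V"
    and ip_sym: "ip u v = ip v u"
    and a_sym: "a u v = a v u"
    and ip_lin: "u \<in> V \<Longrightarrow> v \<in> V \<Longrightarrow> w \<in> V \<Longrightarrow> ip (\<lambda>x. c * u x + d * v x) w = c * ip u w + d * ip v w"
    and a_lin: "u \<in> V \<Longrightarrow> v \<in> V \<Longrightarrow> w \<in> V \<Longrightarrow> a (\<lambda>x. c * u x + d * v x) w = c * a u w + d * a v w"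
    and ip_nonneg: "0 \<le> ip u u"
    and coercive: "u \<in> V \<Longrightarrow> ip u u \<le> a u u"
begin

lemma ip_quad:
  assumes "u \<in> V" "v \<in> V"
  shows "ip (\<lambda>x. c * u x + d * v x) (\<lambda>x. c * u x + d * v x) = c\<^sup>2 * ip u u + 2 * c * d * ip u v + d\<^sup>2 * ip v v"
proof -
  let ?q = "\<lambda>x. c * u x + d * v x"
  have "ip ?q ?q = c * ip ?q u + d * ip ?q v"
    using ip_lin[OF assms lin[OF assms], of c d c d] ip_sym[of u ?q] ip_sym[of v ?q] by simp
  also have "ip ?q u = c * ip u u + d * ip u v"
    using ip_lin[OF assms assms(1), of c d] ip_sym[of v u] by simp
  also have "ip ?q v = c * ip u v + d * ip v v"
    by (rule ip_lin[OF assms assms(2)])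
  finally show ?thesis by (simp add: power2_eq_square algebra_simps)
qed

lemma a_quad:
  assumes "u \<in> V" "v \<in> V"
  shows "a (\<lambda>x. c * u x + d * v x) (\<lambda>x. c * u x + d * v x) = c\<^sup>2 * a u u + 2 * c * d * a u v + d\<^sup>2 * a v v"
proof -
  let ?q = "\<lambda>x. c * u x + d * v x"
  have "a ?q ?q = c * a ?q u + d * a ?q v"
    using a_lin[OF assms lin[OF assms], of c d c d] a_sym[of u ?q] a_sym[of v ?q] by simp
  also have "a ?q u = c * a u u + d * a u v"
    using a_lin[OF assms assms(1), of c d] a_sym[of v u] by simp
  also have "a ?q v = c * a u v + d * a v v"
    by (rule a_lin[OF assms assms(2)])
  finally show ?thesis by (simp add: power2_eq_square algebra_simps)
qed

lemma Cauchy_Schwarz: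
  assumes "u \<in> V" "v \<in> V"
  shows "(ip u v)\<^sup>2 \<le> ip u u * ip v v"
proof (rule quadratic_nonneg_discriminant)
  show "0 \<le> ip u u + 2 * t * ip u v + t\<^sup>2 * ip v v" for t
    using ip_nonneg[of "\<lambda>x. 1 * u x + t * v x"] ip_quad[OF assms, of 1 t] by simp
qed (rule ip_nonneg)

lemma sum_mem:
  assumes "finite F" "\<And>j. j \<in> F \<Longrightarrow> e j \<in> V"
  shows "(\<lambda>x. \<Sum>j\<in>F. c j * e j x) \<in> V"
  using assms
proof (induction F rule: finite_induct)
  case (insert j F)
  have "(\<lambda>x. c j * e j x + 1 * (\<Sum>i\<in>F. c i * e i x)) \<in> V"
    using insert by (intro lin) auto
  then show ?case using insert by simp
qed (simp add: zero)

lemma ip_zero: "w \<in> V \<Longrightarrow> ip (\<lambda>x. 0) w = 0"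
  using ip_lin[OF zero zero, of w 0 0] by simp

lemma a_zero: "w \<in> V \<Longrightarrow> a (\<lambda>x. 0) w = 0"
  using a_lin[OF zero zero, of w 0 0] by simp

lemma ip_sum:
  assumes "finite F" "\<And>j. j \<in> F \<Longrightarrow> e j \<in> V" "w \<in> V"
  shows "ip (\<lambda>x. \<Sum>j\<in>F. c j * e j x) w = (\<Sum>j\<in>F. c j * ip (e j) w)"
  using assms
proof (induction F rule: finite_induct)
  case (insert j F)
  have "ip (\<lambda>x. c j * e j x + 1 * (\<Sum>i\<in>F. c i * e i x)) w = c j * ip (e j) w + 1 * ip (\<lambda>x. \<Sum>i\<in>F. c i * e i x) w"
    using insert by (intro ip_lin sum_mem) auto
  then show ?case using insert by simp
qed (simp add: ip_zero)

lemma a_sum: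
  assumes "finite F" "\<And>j. j \<in> F \<Longrightarrow> e j \<in> V" "w \<in> V"
  shows "a (\<lambda>x. \<Sum>j\<in>F. c j * e j x) w = (\<Sum>j\<in>F. c j * a (e j) w)"
  using assms
proof (induction F rule: finite_induct)
  case (insert j F)
  have "a (\<lambda>x. c j * e j x + 1 * (\<Sum>i\<in>F. c i * e i x)) w = c j * a (e j) w + 1 * a (\<lambda>x. \<Sum>i\<in>F. c i * e i x) w"
    using insert by (intro a_lin sum_mem) auto
  then show ?case using insert by simp
qed (simp add: a_zero)

definition proj :: "'j set \<Rightarrow> ('j \<Rightarrow> 'x \<Rightarrow> real) \<Rightarrow> ('x \<Rightarrow> real) \<Rightarrow> 'x \<Rightarrow> real" where
  "proj F e v x = (\<Sum>j\<in>F. ip v (e j) * e j x)"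

definition coproj :: "'j set \<Rightarrow> ('j \<Rightarrow> 'x \<Rightarrow> real) \<Rightarrow> ('x \<Rightarrow> real) \<Rightarrow> 'x \<Rightarrow> real" where
  "coproj F e v x = 1 * v x + (-1) * proj F e v x"

definition eigenfamily :: "'j set \<Rightarrow> ('j \<Rightarrow> 'x \<Rightarrow> real) \<Rightarrow> ('j \<Rightarrow> real) \<Rightarrow> bool" where
  "eigenfamily F e \<mu> \<longleftrightarrow> finite F \<and> (\<forall>j\<in>F. e j \<in> V \<and> (\<forall>v\<in>V. a (e j) v = \<mu> j * ip (e j) v)
     \<and> (\<forall>i\<in>F. ip (e i) (e j) = (if i = j then 1 else 0)))"

context
  fixes F :: "'j set" and e :: "'j \<Rightarrow> 'x \<Rightarrow> real" and \<mu> :: "'j \<Rightarrow> real"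
  assumes ef: "eigenfamily F e \<mu>"
begin

private lemma F: "finite F" and e: "\<And>j. j \<in> F \<Longrightarrow> e j \<in> V"
  and orth: "\<And>i j. i \<in> F \<Longrightarrow> j \<in> F \<Longrightarrow> ip (e i) (e j) = (if i = j then 1 else 0)"
  and eigen: "\<And>j v. j \<in> F \<Longrightarrow> v \<in> V \<Longrightarrow> a (e j) v = \<mu> j * ip (e j) v"
  using ef by (auto simp: eigenfamily_def)

lemma proj_mem: "proj F e v \<in> V"
  using sum_mem[OF F e, where c="\<lambda>j. ip v (e j)"] by (simp add: proj_def[abs_def])

lemma ip_proj: "w \<in> V \<Longrightarrow> ip (proj F e v) w = (\<Sum>j\<in>F. ip v (e j) * ip (e j) w)"
  using ip_sum[OF F e, where w=w and c="\<lambda>j. ip v (e j)"] by (simp add: proj_def[abs_def])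

lemma a_proj: "w \<in> V \<Longrightarrow> a (proj F e v) w = (\<Sum>j\<in>F. \<mu> j * ip v (e j) * ip (e j) w)"
  using a_sum[OF F e, where w=w and c="\<lambda>j. ip v (e j)"] by (simp add: proj_def[abs_def] eigen mult_ac)

lemma coproj_mem: "v \<in> V \<Longrightarrow> coproj F e v \<in> V"
  using lin[OF _ proj_mem, of v 1 "-1"] by (simp add: coproj_def[abs_def])

lemma ip_coproj: "v \<in> V \<Longrightarrow> w \<in> V \<Longrightarrow> ip (coproj F e v) w = ip v w - (\<Sum>j\<in>F. ip v (e j) * ip (e j) w)"
  using ip_lin[OF _ proj_mem, of v w 1 "-1"] by (simp add: coproj_def[abs_def] ip_proj)

lemma a_coproj: "v \<in> V \<Longrightarrow> w \<in> V \<Longrightarrow> a (coproj F e v) w = a v w - (\<Sum>j\<in>F. \<mu> j * ip v (e j) * ip (e j) w)"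
  using a_lin[OF _ proj_mem, of v w 1 "-1"] by (simp add: coproj_def[abs_def] a_proj)

lemma coproj_orth: "v \<in> V \<Longrightarrow> j \<in> F \<Longrightarrow> ip (coproj F e v) (e j) = 0"
  using F by (simp add: ip_coproj e orth sum.delta if_distrib[of "\<lambda>x. _ * x"] cong: if_cong)

lemma coproj_orth': "v \<in> V \<Longrightarrow> j \<in> F \<Longrightarrow> ip (e j) (coproj F e v) = 0"
  by (subst ip_sym) (rule coproj_orth)

lemma ip_coproj_self:
  assumes "v \<in> V" shows "ip (coproj F e v) (coproj F e v) = ip v v - (\<Sum>j\<in>F. (ip v (e j))\<^sup>2)"
proof -
  have "ip (coproj F e v) (coproj F e v) = ip (coproj F e v) v - (\<Sum>j\<in>F. ip v (e j) * ip (e j) (coproj F e v))"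
    using assms ip_coproj[of v "coproj F e v"] coproj_mem[OF assms] ip_sym[of v "coproj F e v"] by simp
  also have "\<dots> = ip (coproj F e v) v"
    using coproj_orth'[OF assms] by simp
  also have "\<dots> = ip v v - (\<Sum>j\<in>F. (ip v (e j))\<^sup>2)"
    using assms ip_sym[of "e _" v] by (simp add: ip_coproj power2_eq_square)
  finally show ?thesis .
qed

text \<open>The eigenvalue equation makes the remainder orthogonal to each \<open>e j\<close> for
  \<open>a\<close> as well as for \<open>ip\<close>, so no mixed terms occur and \<open>a\<close>
  splits like the square norm.\<close>

lemma a_coproj_self:
  assumes "v \<in> V" shows "a (coproj F e v) (coproj F e v) = a v v - (\<Sum>j\<in>F. \<mu> j * (ip v (e j))\<^sup>2)"
proof -
  have "a (coproj F e v) (coproj F e v) = a (coproj F e v) v - (\<Sum>j\<in>F. \<mu> j * ip v (e j) * ip (e j) (coproj F e v))"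
    using assms a_coproj[of v "coproj F e v"] coproj_mem[OF assms] a_sym[of v "coproj F e v"] by simp
  also have "\<dots> = a (coproj F e v) v"
    using coproj_orth'[OF assms] by simp
  also have "\<dots> = a v v - (\<Sum>j\<in>F. \<mu> j * (ip v (e j))\<^sup>2)"
    using assms ip_sym[of "e _" v] by (simp add: a_coproj power2_eq_square mult_ac)
  finally show ?thesis .
qed

lemma bessel: "v \<in> V \<Longrightarrow> (\<Sum>j\<in>F. (ip v (e j))\<^sup>2) \<le> ip v v"
  using ip_coproj_self[of v] ip_nonneg[of "coproj F e v"] by simp

end

end

section \<open>Minimisers of the Rayleigh quotient\<close>

text \<open>The axiom joins two facts needed by the direct method: the embedding into L^2 is
  compact, and \<open>a\<close> is lower semicontinuous along the extracted subsequence. The bounds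
  \<open>B n\<close> vary so that a minimising sequence can be inserted directly.\<close>

locale coercive_form = form_pair V ip a
  for V :: "('x \<Rightarrow> real) set" and ip a +
  assumes compact: "(\<And>n. W n \<in> V) \<Longrightarrow> (\<And>n. a (W n) (W n) \<le> B n) \<Longrightarrow> B \<longlonglongrightarrow> m \<Longrightarrow>
      \<exists>u\<in>V. \<exists>r :: nat \<Rightarrow> nat. strict_mono r \<and> a u u \<le> m \<and>
        (\<lambda>n. ip (fdiff (W (r n)) u) (fdiff (W (r n)) u)) \<longlonglongrightarrow> 0"
begin

context
  fixes F :: "'j set" and e :: "'j \<Rightarrow> 'x \<Rightarrow> real" and \<mu> :: "'j \<Rightarrow> real" and \<Lambda> :: real
  assumes ef: "eigenfamily F e \<mu>"
begin

private lemma F: "finite F" and e: "\<And>j. j \<in> F \<Longrightarrow> e j \<in> V"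
  and orth: "\<And>i j. i \<in> F \<Longrightarrow> j \<in> F \<Longrightarrow> ip (e i) (e j) = (if i = j then 1 else 0)"
  and eigen: "\<And>j v. j \<in> F \<Longrightarrow> v \<in> V \<Longrightarrow> a (e j) v = \<mu> j * ip (e j) v"
  using ef by (auto simp: eigenfamily_def)

text \<open>If the bound failed, the infimum \<open>m\<close> of the Rayleigh quotient on the
  orthogonal complement of the family would lie below \<Lambda>. It is attained by compactness, and
  the minimiser is a weak eigenfunction that \<open>complete\<close> forces to be null, although it
  has norm one.\<close>

lemma rayleigh_bound:
  assumes complete: "\<And>u m. u \<in> V \<Longrightarrow> m < \<Lambda> \<Longrightarrow> (\<And>v. v \<in> V \<Longrightarrow> a u v = m * ip u v) \<Longrightarrow>
      (\<And>j. j \<in> F \<Longrightarrow> ip u (e j) = 0) \<Longrightarrow> ip u u = 0"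
    and g: "g \<in> V" "\<And>j. j \<in> F \<Longrightarrow> ip g (e j) = 0"
  shows "\<Lambda> * ip g g \<le> a g g"
proof (rule ccontr)
  assume "\<not> ?thesis"
  then have less: "a g g < \<Lambda> * ip g g" by simp
  define G where "G = {g \<in> V. \<forall>j\<in>F. ip g (e j) = 0}"
  define N where "N = {g \<in> G. ip g g = 1}"
  define m where "m = (INF g\<in>N. a g g)"
  have GV: "g \<in> V" if "g \<in> G" for g using that by (simp add: G_def)
  have Glin: "(\<lambda>x. c * u x + d * v x) \<in> G" if "u \<in> G" "v \<in> G" for u v c d
    using that e by (auto simp: G_def lin ip_lin)
  have normalise: "\<exists>h\<in>N. a h h = a g g / ip g g" if "g \<in> G" "ip g g > 0" for g
  proof -
    let ?c = "1 / sqrt (ip g g)"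
    let ?h = "\<lambda>x. ?c * g x + 0 * g x"
    have "?c\<^sup>2 = 1 / ip g g" using that by (simp add: power_divide)
    then have "ip ?h ?h = 1" "a ?h ?h = a g g / ip g g"
      using that GV[OF that(1)] ip_quad[of g g ?c 0] a_quad[of g g ?c 0] by simp_all
    then show ?thesis using Glin[OF that(1) that(1), of ?c 0] by (auto simp: N_def)
  qed
  have gpos: "ip g g > 0"
    using less coercive[OF g(1)] ip_nonneg[of g] by (cases "ip g g = 0") auto
  have gG: "g \<in> G" using g by (simp add: G_def)
  have bdd: "bdd_below ((\<lambda>g. a g g) ` N)"
  proof (rule bdd_belowI2)
    show "1 \<le> a h h" if "h \<in> N" for h
      using coercive[of h] that by (simp add: N_def G_def)
  qed
  have Nne: "N \<noteq> {}" using normalise[OF gG gpos] by auto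
  have m_le: "m \<le> a h h" if "h \<in> N" for h
    unfolding m_def using bdd that by (rule cINF_lower)
  have m_le_G: "m * ip h h \<le> a h h" if hG: "h \<in> G" for h
  proof (cases "ip h h = 0")
    case True then show ?thesis using coercive[OF GV[OF hG]] by simp
  next
    case False
    then have p: "ip h h > 0" using ip_nonneg[of h] by simp
    obtain h' where "h' \<in> N" "a h' h' = a h h / ip h h" using normalise[OF hG p] by auto
    then have "m \<le> a h h / ip h h" using m_le by force
    then show ?thesis using p by (simp add: field_simps)
  qed
  have mL: "m < \<Lambda>"
  proof -
    obtain h where "h \<in> N" "a h h = a g g / ip g g" using normalise[OF gG gpos] by auto
    then have "m \<le> a g g / ip g g" using m_le by force
    also have "\<dots> < \<Lambda>" using less gpos by (simp add: field_simps)
    finally show ?thesis .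
  qed
  have "\<exists>w. w \<in> N \<and> a w w \<le> m + 1 / real (Suc n)" for n
  proof -
    have "m < m + 1 / real (Suc n)" by simp
    then obtain w where "w \<in> N" "a w w < m + 1 / real (Suc n)"
      unfolding m_def using cINF_less_iff[OF Nne bdd] by (metis (no_types, lifting))
    then show ?thesis by (auto intro: less_imp_le)
  qed
  then obtain w where wN: "\<And>n. w n \<in> N" and wa: "\<And>n. a (w n) (w n) \<le> m + 1 / real (Suc n)"
    by metis
  have wV: "w n \<in> V" and w1: "ip (w n) (w n) = 1" and wo: "j \<in> F \<Longrightarrow> ip (w n) (e j) = 0" for n j
    using wN[of n] by (auto simp: N_def G_def)
  have "(\<lambda>n. m + 1 / real (Suc n)) \<longlonglongrightarrow> m"
    using tendsto_add[OF tendsto_const[of m] LIMSEQ_inverse_real_of_nat] by (simp add: inverse_eq_divide)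
  from compact[of w, OF wV wa this] obtain u r where u: "u \<in> V" and r: "strict_mono (r :: nat \<Rightarrow> nat)"
    and au: "a u u \<le> m"
    and lim: "(\<lambda>n. ip (fdiff (w (r n)) u) (fdiff (w (r n)) u)) \<longlonglongrightarrow> 0"
    by blast
  define z where "z n x = 1 * w (r n) x + (-1) * u x" for n x
  have zV: "z n \<in> V" for n using lin[OF wV u, of 1 _ "-1"] by (simp add: z_def[abs_def])
  have zlim: "(\<lambda>n. ip (z n) (z n)) \<longlonglongrightarrow> 0" using lim by (simp add: z_def[abs_def])
  \<comment> \<open>The second argument may move with \<open>n\<close>: this serves the fixed
    functions \<open>e j\<close> as well as the sequence \<open>w (r n)\<close> itself.\<close>
  have z0: "(\<lambda>n. ip (z n) (v n)) \<longlonglongrightarrow> 0" if v: "\<And>n. v n \<in> V" "\<And>n. ip (v n) (v n) = 1" for v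
  proof (rule Lim_null_comparison)
    show "\<forall>\<^sub>F n in sequentially. norm (ip (z n) (v n)) \<le> sqrt (ip (z n) (z n))"
      using Cauchy_Schwarz[OF zV v(1)] by (intro always_eventually allI real_le_rsqrt) (simp add: v)
    show "(\<lambda>n. sqrt (ip (z n) (z n))) \<longlonglongrightarrow> 0"
      using tendsto_real_sqrt[OF zlim] by simp
  qed
  have zlin: "ip (z n) v = ip (w (r n)) v - ip u v" if "v \<in> V" for n v
    using ip_lin[OF wV u that, of 1 _ "-1"] by (simp add: z_def[abs_def])
  have uo: "ip u (e j) = 0" if j: "j \<in> F" for j
  proof -
    have "(\<lambda>n. ip (z n) (e j)) \<longlonglongrightarrow> 0" using j e orth by (intro z0) auto
    moreover have "ip (z n) (e j) = - ip u (e j)" for n using zlin[OF e[OF j]] wo[OF j] by simp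
    ultimately show ?thesis by (simp add: LIMSEQ_const_iff)
  qed
  \<comment> \<open>Strong convergence carries the normalisation to the limit; without it the
    minimiser might be null.\<close>
  have u1: "ip u u = 1"
  proof -
    have "ip u u = 1 - 2 * ip (z n) (w (r n)) + ip (z n) (z n)" for n
    proof -
      have "ip (z n) (z n) = ip (w (r n)) (z n) - ip u (z n)" by (rule zlin[OF zV])
      also have "ip (w (r n)) (z n) = 1 - ip u (w (r n))" using zlin[OF wV, of n "r n"] w1 ip_sym[of "w (r n)" "z n"] ip_sym[of "w (r n)" u] by simp
      also have "ip u (z n) = ip u (w (r n)) - ip u u" using zlin[OF u, of n] ip_sym[of u "z n"] ip_sym[of u "w (r n)"] by simp
      finally show ?thesis using zlin[OF wV, of n "r n"] w1 by simp
    qed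
    moreover have "(\<lambda>n. 1 - 2 * ip (z n) (w (r n)) + ip (z n) (z n)) \<longlonglongrightarrow> 1 - 2 * 0 + 0"
      by (intro tendsto_intros zlim z0 wV w1)
    ultimately show ?thesis by (simp add: LIMSEQ_const_iff)
  qed
  have uG: "u \<in> G" using u uo by (simp add: G_def)
  have aum: "a u u = m" using m_le_G[OF uG] au u1 by simp
  \<comment> \<open>The quadratic \<open>a - m * ip\<close> is nonnegative on the line through
    \<open>u\<close> in direction \<open>v\<close> and vanishes at \<open>u\<close>, so its linear
    coefficient vanishes. This is the discriminant inequality with constant term
    \<open>0\<close>.\<close>
  have stat: "a u v = m * ip u v" if v: "v \<in> G" for v
  proof -
    have "(a u v - m * ip u v)\<^sup>2 \<le> 0 * (a v v - m * ip v v)"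
    proof (rule quadratic_nonneg_discriminant)
      fix t
      have "m * ip (\<lambda>x. 1 * u x + t * v x) (\<lambda>x. 1 * u x + t * v x) \<le> a (\<lambda>x. 1 * u x + t * v x) (\<lambda>x. 1 * u x + t * v x)"
        by (rule m_le_G[OF Glin[OF uG v]])
      then show "0 \<le> 0 + 2 * t * (a u v - m * ip u v) + t\<^sup>2 * (a v v - m * ip v v)"
        unfolding ip_quad[OF u GV[OF v]] a_quad[OF u GV[OF v]] using aum u1 by (simp add: algebra_simps)
    qed (use m_le_G[OF v] in simp)
    then show ?thesis by simp
  qed
  \<comment> \<open>The constraint is removed: \<open>v\<close> and its coprojection differ by a
    combination of the \<open>e j\<close>, and these are orthogonal to \<open>u\<close> for both
    forms.\<close>
  have "a u v = m * ip u v" if v: "v \<in> V" for v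
  proof -
    have "coproj F e v \<in> G" using v by (simp add: G_def coproj_mem[OF ef] coproj_orth[OF ef])
    from stat[OF this] show ?thesis
      using ip_coproj[OF ef, OF v u] a_coproj[OF ef, OF v u] uo ip_sym[of "e _" u] ip_sym[of u "coproj F e v"] ip_sym[of u v] a_sym[of u "coproj F e v"] a_sym[of u v] by simp
  qed
  from complete[OF u mL this uo] u1 show False by simp
qed

text \<open>Splitting \<open>f\<close> along the family, the remainder contributes a nonpositive
  amount by \<open>rayleigh_bound\<close>, and each eigenfunction contributes exactly its
  summand.\<close>

lemma riesz_mean_lower:
  assumes complete: "\<And>u m. u \<in> V \<Longrightarrow> m < \<Lambda> \<Longrightarrow> (\<And>v. v \<in> V \<Longrightarrow> a u v = m * ip u v) \<Longrightarrow>
      (\<And>j. j \<in> F \<Longrightarrow> ip u (e j) = 0) \<Longrightarrow> ip u u = 0"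
    and f: "f \<in> V"
  shows "\<Lambda> * ip f f - a f f \<le> (\<Sum>j\<in>F. (\<Lambda> - \<mu> j) * (ip f (e j))\<^sup>2)"
proof -
  have "\<Lambda> * ip (coproj F e f) (coproj F e f) \<le> a (coproj F e f) (coproj F e f)"
    using coproj_mem[OF ef, OF f] coproj_orth[OF ef, OF f] complete by (intro rayleigh_bound) auto
  then show ?thesis
    by (simp add: ip_coproj_self[OF ef, OF f] a_coproj_self[OF ef, OF f] left_diff_distrib right_diff_distrib sum_subtractf sum_distrib_left)
qed

end
end

section \<open>The energy form on the Sobolev space\<close>

definition ip_L2 :: "('a::euclidean_space \<Rightarrow> real) \<Rightarrow> ('a \<Rightarrow> real) \<Rightarrow> real" where
  "ip_L2 u v = (LINT x|lborel. u x * v x)"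

lemma integrable_mult_L2:
  fixes u v :: "'a \<Rightarrow> real"
  assumes "u \<in> borel_measurable M" "v \<in> borel_measurable M"
    and "integrable M (\<lambda>x. (u x)\<^sup>2)" "integrable M (\<lambda>x. (v x)\<^sup>2)"
  shows "integrable M (\<lambda>x. u x * v x)"
proof (rule Bochner_Integration.integrable_bound[of _ "\<lambda>x. (u x)\<^sup>2 + (v x)\<^sup>2"])
  have "\<bar>a * b\<bar> \<le> a\<^sup>2 + b\<^sup>2" for a b :: real
  proof -
    have "2 * (\<bar>a\<bar> * \<bar>b\<bar>) \<le> a\<^sup>2 + b\<^sup>2" using sum_squares_bound[of "\<bar>a\<bar>" "\<bar>b\<bar>"] by (simp add: mult.assoc)
    moreover have "0 \<le> \<bar>a\<bar> * \<bar>b\<bar>" by simp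
    ultimately show ?thesis unfolding abs_mult by linarith
  qed
  then show "AE x in M. norm (u x * v x) \<le> norm ((u x)\<^sup>2 + (v x)\<^sup>2)" by simp
qed (use assms in auto)

lemma integrable_square_lincomb:
  fixes u v :: "'a \<Rightarrow> real"
  assumes "u \<in> borel_measurable M" "v \<in> borel_measurable M"
    and "integrable M (\<lambda>x. (u x)\<^sup>2)" "integrable M (\<lambda>x. (v x)\<^sup>2)"
  shows "integrable M (\<lambda>x. (c * u x + d * v x)\<^sup>2)"
proof -
  have "integrable M (\<lambda>x. c\<^sup>2 * (u x)\<^sup>2 + 2 * c * d * (u x * v x) + d\<^sup>2 * (v x)\<^sup>2)"
    using assms integrable_mult_L2[OF assms] by simp
  also have "(\<lambda>x. c\<^sup>2 * (u x)\<^sup>2 + 2 * c * d * (u x * v x) + d\<^sup>2 * (v x)\<^sup>2) = (\<lambda>x. (c * u x + d * v x)\<^sup>2)"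
    by (auto simp: power2_eq_square algebra_simps)
  finally show ?thesis .
qed

text \<open>The increment carries the square root of the kernel, so the Gagliardo form becomes an
  L^2 product on pairs of points and inherits its bilinearity and integrability. On the diagonal the
  value is \<open>0\<close>.\<close>

definition diff_quot :: "real \<Rightarrow> ('a::euclidean_space \<Rightarrow> real) \<Rightarrow> 'a \<times> 'a \<Rightarrow> real" where
  "diff_quot s u p = (u (fst p) - u (snd p)) / sqrt (norm (fst p - snd p) powr (real DIM('a) + 2 * s))"

lemma diff_quot_measurable [measurable]:
  assumes [measurable]: "u \<in> borel_measurable borel"
  shows "diff_quot s u \<in> borel_measurable (lborel \<Otimes>\<^sub>M lborel)"
  unfolding diff_quot_def by measurable

lemma diff_quot_mult:
  fixes u :: "'a::euclidean_space \<Rightarrow> real"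
  shows "diff_quot s u p * diff_quot s v p
    = (case p of (x, y) \<Rightarrow> (u x - u y) * (v x - v y) / norm (x - y) powr (real DIM('a) + 2 * s))"
  by (simp add: diff_quot_def case_prod_unfold)

lemma diff_quot_square:
  fixes u :: "'a::euclidean_space \<Rightarrow> real"
  shows "(diff_quot s u p)\<^sup>2 = (case p of (x, y) \<Rightarrow> (u x - u y)\<^sup>2 / norm (x - y) powr (real DIM('a) + 2 * s))"
  by (simp add: power2_eq_square diff_quot_mult)

lemma diff_quot_lin: "diff_quot s (\<lambda>x. c * u x + d * v x) p = c * diff_quot s u p + d * diff_quot s v p"
  by (simp add: diff_quot_def add_divide_distrib diff_divide_distrib algebra_simps)

lemma sobolev_H0_iff:
  fixes u :: "real ^ 'n \<Rightarrow> real"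
  shows "u \<in> sobolev_H0 s \<Omega> \<longleftrightarrow> u \<in> borel_measurable borel \<and> integrable lborel (\<lambda>x. (u x)\<^sup>2) \<and>
    integrable (lborel \<Otimes>\<^sub>M lborel) (\<lambda>p. (diff_quot s u p)\<^sup>2) \<and> (AE x in lborel. x \<notin> \<Omega> \<longrightarrow> u x = 0)"
  unfolding sobolev_H0_def sobolev_H_def L2_on_def diff_quot_square
  by (auto simp: set_borel_measurable_def set_integrable_def)

text \<open>This is \<open>form_a\<close> with the mass term taken over the whole space. The two
  agree on functions vanishing outside the domain, but this form no longer mentions the
  domain.\<close>

definition energy :: "real \<Rightarrow> ('a::euclidean_space \<Rightarrow> real) \<Rightarrow> ('a \<Rightarrow> real) \<Rightarrow> real" where
  "energy s u v = ip_L2 u v + frac_laplacian_const DIM('a) s / 2 * (LINT p|(lborel \<Otimes>\<^sub>M lborel). diff_quot s u p * diff_quot s v p)"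

context
  fixes \<Omega> :: "(real ^ 'n) set" and s :: real
begin

lemma H0_measurable: "u \<in> sobolev_H0 s \<Omega> \<Longrightarrow> u \<in> borel_measurable borel"
  and H0_square: "u \<in> sobolev_H0 s \<Omega> \<Longrightarrow> integrable lborel (\<lambda>x. (u x)\<^sup>2)"
  and H0_diff_quot: "u \<in> sobolev_H0 s \<Omega> \<Longrightarrow> integrable (lborel \<Otimes>\<^sub>M lborel) (\<lambda>p. (diff_quot s u p)\<^sup>2)"
  and H0_vanish: "u \<in> sobolev_H0 s \<Omega> \<Longrightarrow> AE x in lborel. x \<notin> \<Omega> \<longrightarrow> u x = 0"
  by (simp_all add: sobolev_H0_iff)

lemma H0_zero: "(\<lambda>x. 0) \<in> sobolev_H0 s \<Omega>"
  by (simp add: sobolev_H0_iff diff_quot_def)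

lemma H0_lin:
  assumes "u \<in> sobolev_H0 s \<Omega>" "v \<in> sobolev_H0 s \<Omega>"
  shows "(\<lambda>x. c * u x + d * v x) \<in> sobolev_H0 s \<Omega>"
  unfolding sobolev_H0_iff diff_quot_lin
proof (intro conjI)
  show "(\<lambda>x. c * u x + d * v x) \<in> borel_measurable borel"
    using assms[THEN H0_measurable] by measurable
  show "integrable lborel (\<lambda>x. (c * u x + d * v x)\<^sup>2)"
    using assms by (intro integrable_square_lincomb) (auto simp: H0_measurable H0_square)
  show "integrable (lborel \<Otimes>\<^sub>M lborel) (\<lambda>p. (c * diff_quot s u p + d * diff_quot s v p)\<^sup>2)"
    using assms by (intro integrable_square_lincomb diff_quot_measurable) (auto simp: H0_measurable H0_diff_quot)
  show "AE x in lborel. x \<notin> \<Omega> \<longrightarrow> c * u x + d * v x = 0"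
    using H0_vanish[OF assms(1)] H0_vanish[OF assms(2)] by eventually_elim auto
qed

lemma H0_mult_integrable:
  "u \<in> sobolev_H0 s \<Omega> \<Longrightarrow> v \<in> sobolev_H0 s \<Omega> \<Longrightarrow> integrable lborel (\<lambda>x. u x * v x)"
  by (intro integrable_mult_L2) (auto simp: H0_measurable H0_square)

lemma H0_diff_quot_mult_integrable:
  "u \<in> sobolev_H0 s \<Omega> \<Longrightarrow> v \<in> sobolev_H0 s \<Omega> \<Longrightarrow> integrable (lborel \<Otimes>\<^sub>M lborel) (\<lambda>p. diff_quot s u p * diff_quot s v p)"
  by (intro integrable_mult_L2 diff_quot_measurable) (auto simp: H0_measurable H0_diff_quot)

lemma ip_L2_sym: "ip_L2 u v = ip_L2 v u"
  by (simp add: ip_L2_def mult.commute)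

lemma energy_sym: "energy s u v = energy s v u"
  by (simp add: energy_def ip_L2_sym[of u] mult.commute[of "diff_quot s u _"])

lemma ip_L2_lin:
  assumes "u \<in> sobolev_H0 s \<Omega>" "v \<in> sobolev_H0 s \<Omega>" "w \<in> sobolev_H0 s \<Omega>"
  shows "ip_L2 (\<lambda>x. c * u x + d * v x) w = c * ip_L2 u w + d * ip_L2 v w"
  using H0_mult_integrable[OF assms(1,3)] H0_mult_integrable[OF assms(2,3)]
  by (simp add: ip_L2_def distrib_right mult.assoc)

lemma energy_lin:
  assumes "u \<in> sobolev_H0 s \<Omega>" "v \<in> sobolev_H0 s \<Omega>" "w \<in> sobolev_H0 s \<Omega>"
  shows "energy s (\<lambda>x. c * u x + d * v x) w = c * energy s u w + d * energy s v w"
  using H0_diff_quot_mult_integrable[OF assms(1,3)] H0_diff_quot_mult_integrable[OF assms(2,3)]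
  by (simp add: energy_def ip_L2_lin[OF assms] diff_quot_lin distrib_right mult.assoc) (simp add: algebra_simps)

lemma energy_self: "energy s u u = ip_L2 u u + frac_laplacian_const CARD('n) s / 2 * gagliardo s (u :: real ^ 'n \<Rightarrow> real)"
  by (simp add: energy_def gagliardo_def diff_quot_mult power2_eq_square)

lemma ip_L2_nonneg: "0 \<le> ip_L2 u u"
  by (simp add: ip_L2_def)

lemma form_a_eq_energy:
  assumes o: "open \<Omega>" and u: "u \<in> sobolev_H0 s \<Omega>" and v: "v \<in> sobolev_H0 s \<Omega>"
  shows "(LINT x:\<Omega>|lborel. u x * v x) = ip_L2 u v" "form_a s \<Omega> u v = energy s u v"
proof -
  have [measurable]: "u \<in> borel_measurable borel" "v \<in> borel_measurable borel" "\<Omega> \<in> sets borel"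
    using u v o by (auto simp: H0_measurable)
  show "(LINT x:\<Omega>|lborel. u x * v x) = ip_L2 u v"
    unfolding ip_L2_def set_lebesgue_integral_def
  proof (rule integral_cong_AE)
    show "AE x in lborel. indicat_real \<Omega> x *\<^sub>R (u x * v x) = u x * v x"
      using H0_vanish[OF u] by eventually_elim (auto split: split_indicator)
  qed auto
  then show "form_a s \<Omega> u v = energy s u v"
    by (simp add: form_a_def energy_def diff_quot_mult)
qed

context
  assumes \<Omega>o: "open \<Omega>" and \<Omega>b: "bounded \<Omega>" and s: "0 < s" "s < 1"
begin

lemma domain_measurable [measurable]: "\<Omega> \<in> sets borel"
  using \<Omega>o by simp

lemma domain_finite: "emeasure lborel \<Omega> < \<infinity>"
  using \<Omega>b by (rule emeasure_bounded_finite)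

lemma domain_indicator_integrable: "integrable lborel (indicator \<Omega> :: real ^ 'n \<Rightarrow> real)"
  using domain_finite by (simp add: less_top)

lemma coercive_energy: "ip_L2 u u \<le> energy s u (u :: real ^ 'n \<Rightarrow> real)"
  using frac_laplacian_const_pos[OF s, of "CARD('n)"] gagliardo_nonneg[of s u] by (simp add: energy_self)

text \<open>Pointwise, \<open>2 * \<bar>v x\<bar> \<le> c * (v x)^2 + 1 / c\<close> on \<Omega>,
  which has finite volume. The weight \<open>c\<close> stays free because a later argument balances
  it against a rate of convergence.\<close>

lemma integrable_L2_domain:
  assumes [measurable]: "v \<in> borel_measurable borel" and "integrable lborel (\<lambda>x. (v x)\<^sup>2)"
    and "AE x in lborel. x \<notin> \<Omega> \<longrightarrow> v x = 0" and c: "0 < c"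
  shows "integrable lborel v"
    and "2 * (LINT x|lborel. \<bar>v x\<bar>) \<le> c * (LINT x|lborel. (v x)\<^sup>2) + measure lborel \<Omega> / c"
proof -
  have ae: "AE x in lborel. 2 * \<bar>v x\<bar> \<le> c * (v x)\<^sup>2 + indicator \<Omega> x / c"
    using assms(3)
  proof eventually_elim
    case (elim x)
    have "2 * \<bar>v x\<bar> \<le> c * (v x)\<^sup>2 + 1 / c"
      using sum_squares_bound[of "c * \<bar>v x\<bar>" 1] c by (simp add: field_simps power2_eq_square)
    then show ?case using elim by (auto split: split_indicator)
  qed
  have i: "integrable lborel (\<lambda>x. c * (v x)\<^sup>2 + indicator \<Omega> x / c)"
    using assms domain_indicator_integrable by simp
  have i2: "integrable lborel (\<lambda>x. 2 * \<bar>v x\<bar>)"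
    by (rule Bochner_Integration.integrable_bound[OF i]) (use ae in \<open>auto elim!: eventually_mono\<close>)
  then have "integrable lborel (\<lambda>x. \<bar>v x\<bar>)" by simp
  then show "integrable lborel v" by (rule integrable_abs_cancel) simp
  have "(LINT x|lborel. 2 * \<bar>v x\<bar>) \<le> (LINT x|lborel. c * (v x)\<^sup>2 + indicator \<Omega> x / c)"
    by (rule integral_mono_AE[OF i2 i ae])
  then show "2 * (LINT x|lborel. \<bar>v x\<bar>) \<le> c * (LINT x|lborel. (v x)\<^sup>2) + measure lborel \<Omega> / c"
    using assms domain_indicator_integrable by simp
qed

lemma H0_integrable: "u \<in> sobolev_H0 s \<Omega> \<Longrightarrow> integrable lborel u"
  using integrable_L2_domain(1)[of u 1] by (simp add: H0_measurable H0_square H0_vanish)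

end
end

section \<open>Compactness\<close>

text \<open>Fatou's lemma with bounds that may themselves converge. Constant bounds yield membership
  of limits in the space, convergent ones the lower semicontinuity of the energy.\<close>

lemma fatou_bound:
  fixes f :: "nat \<Rightarrow> 'a \<Rightarrow> real"
  assumes f: "\<And>k. integrable M (f k)" "\<And>k x. 0 \<le> f k x" "\<And>k. (LINT x|M. f k x) \<le> b k" "b \<longlonglongrightarrow> \<beta>"
    and g[measurable]: "g \<in> borel_measurable M" and lim: "AE x in M. (\<lambda>k. f k x) \<longlonglongrightarrow> g x"
  shows "integrable M g" "(LINT x|M. g x) \<le> \<beta>"
proof -
  note [measurable] = borel_measurable_integrable[OF f(1)]
  have b0: "0 \<le> b k" for k
    using f(3)[of k] f(2) by (meson Bochner_Integration.integral_nonneg order_trans)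
  have \<beta>0: "0 \<le> \<beta>" using f(4) b0 by (intro LIMSEQ_le_const) auto
  have g0: "AE x in M. 0 \<le> g x"
    using lim by eventually_elim (intro LIMSEQ_le_const, auto simp: f)
  have "(\<integral>\<^sup>+x. ennreal (g x) \<partial>M) = (\<integral>\<^sup>+x. liminf (\<lambda>k. ennreal (f k x)) \<partial>M)"
  proof (rule nn_integral_cong_AE)
    show "AE x in M. ennreal (g x) = liminf (\<lambda>k. ennreal (f k x))"
      using lim by eventually_elim (metis lim_imp_Liminf sequentially_bot tendsto_ennrealI)
  qed
  also have "\<dots> \<le> liminf (\<lambda>k. \<integral>\<^sup>+x. ennreal (f k x) \<partial>M)"
    by (rule nn_integral_liminf) measurable
  also have "\<dots> \<le> liminf (\<lambda>k. ennreal (b k))"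
  proof (rule Liminf_mono, rule always_eventually, rule allI)
    fix k
    have "(\<integral>\<^sup>+x. ennreal (f k x) \<partial>M) = ennreal (LINT x|M. f k x)"
      using f by (intro nn_integral_eq_integral) auto
    then show "(\<integral>\<^sup>+x. ennreal (f k x) \<partial>M) \<le> ennreal (b k)"
      using f(3)[of k] by (simp add: ennreal_leI)
  qed
  also have "\<dots> = ennreal \<beta>"
    using f(4) by (intro lim_imp_Liminf tendsto_ennrealI) auto
  finally have le: "(\<integral>\<^sup>+x. ennreal (g x) \<partial>M) \<le> ennreal \<beta>" .
  then show i: "integrable M g"
    using g0 by (intro integrableI_nonneg) (auto simp: top.extremum_strict intro: le_less_trans)
  have "(\<integral>\<^sup>+x. ennreal (g x) \<partial>M) = ennreal (LINT x|M. g x)"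
    using i g0 by (rule nn_integral_eq_integral)
  with le show "(LINT x|M. g x) \<le> \<beta>" using \<beta>0 by simp
qed

text \<open>Cylinders over a null set are null. This transfers convergence almost everywhere from
  functions to their difference quotients.\<close>

lemma AE_lborel_fst_snd:
  assumes "AE x in lborel. P (x::'a::euclidean_space)"
  shows "AE p in lborel \<Otimes>\<^sub>M (lborel :: 'a measure). P (fst p) \<and> P (snd p)"
proof -
  obtain N :: "'a set" where N: "N \<in> null_sets lborel" "{x. \<not> P x} \<subseteq> N"
    using assms by (auto simp: eventually_ae_filter)
  have "(N \<times> UNIV) \<union> (UNIV \<times> N) \<in> null_sets (lborel \<Otimes>\<^sub>M (lborel :: 'a measure))"
    using N(1) by (intro null_sets.Un lborel.times_in_null_sets1 lborel.times_in_null_sets2) auto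
  moreover have "{p. \<not> (P (fst p) \<and> P (snd p))} \<subseteq> (N \<times> UNIV) \<union> (UNIV \<times> N)"
    using N(2) by auto
  ultimately show ?thesis
    by (auto simp: eventually_ae_filter space_pair_measure intro!: bexI[of _ "(N \<times> UNIV) \<union> (UNIV \<times> N)"])
qed

text \<open>\<open>D\<close> will be a squared distance, so the rate \<open>(1/4)^k\<close> makes
  the distances themselves summable.\<close>

lemma cauchy_fast_subseq:
  fixes D :: "nat \<Rightarrow> nat \<Rightarrow> real"
  assumes "\<And>\<epsilon>. 0 < \<epsilon> \<Longrightarrow> \<exists>M. \<forall>i\<ge>M. \<forall>j\<ge>M. D i j \<le> \<epsilon>"
  obtains r :: "nat \<Rightarrow> nat" where "strict_mono r" "\<And>k i j. r k \<le> i \<Longrightarrow> r k \<le> j \<Longrightarrow> D i j \<le> (1/4)^k"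
proof -
  have "\<exists>M. \<forall>i\<ge>M. \<forall>j\<ge>M. D i j \<le> (1/4)^k" for k by (rule assms) simp
  then obtain M where M: "\<And>k i j. M k \<le> i \<Longrightarrow> M k \<le> j \<Longrightarrow> D i j \<le> (1/4)^k" by metis
  \<comment> \<open>The summand \<open>k\<close> forces strict growth, and the partial sum dominates
    \<open>M k\<close>.\<close>
  define r where "r k = k + (\<Sum>i\<le>k. M i)" for k
  have Mr: "M k \<le> r k" for k
    unfolding r_def using member_le_sum[of k "{..k}" M] by simp
  show thesis
  proof (rule that)
    show "strict_mono r"
      by (auto simp: strict_mono_Suc_iff r_def)
    show "D i j \<le> (1/4)^k" if "r k \<le> i" "r k \<le> j" for k i j
      using M[of k i j] Mr[of k] that by linarith
  qed
qed

text \<open>The L^2 pairing of \<open>v\<close> with its Gaussian smoothing, without normalising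
  constant.\<close>

definition heat_form :: "real \<Rightarrow> ('a::euclidean_space \<Rightarrow> real) \<Rightarrow> real" where
  "heat_form \<tau> v = (\<integral>(x, y). v x * v y * exp (- \<tau> * (norm (x - y))\<^sup>2) \<partial>(lborel \<Otimes>\<^sub>M lborel))"

lemma exp_minus_diff_le:
  fixes a b :: real
  assumes "0 \<le> a" "0 \<le> b"
  shows "\<bar>exp (- a) - exp (- b)\<bar> \<le> \<bar>a - b\<bar>"
proof -
  have *: "exp (- a) - exp (- b) \<le> b - a" if "0 \<le> a" "a \<le> b" for a b :: real
  proof -
    have "exp (- a) - exp (- b) = exp (- a) * (1 - exp (a - b))"
      by (simp add: algebra_simps exp_add[symmetric])
    also have "\<dots> \<le> 1 - exp (a - b)"
      using that by (intro mult_left_le_one_le) auto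
    also have "\<dots> \<le> b - a"
    proof -
      have "1 + (a - b) \<le> exp (a - b)" by (rule exp_ge_add_one_self)
      then show ?thesis by argo
    qed
    finally show ?thesis .
  qed
  show ?thesis
  proof (cases "a \<le> b")
    case True
    then have "exp (- b) \<le> exp (- a)" by simp
    then show ?thesis using *[of a b] assms True by simp
  next
    case False
    then have "exp (- a) \<le> exp (- b)" by simp
    then show ?thesis using *[of b a] assms False by simp
  qed
qed

section \<open>Compact embedding by Gaussian smoothing\<close>

context
  fixes \<Omega> :: "(real ^ 'n) set" and s :: real
  assumes \<Omega>o: "open \<Omega>" and \<Omega>b: "bounded \<Omega>" and s: "0 < s" "s < 1"
begin

text \<open>As in the Riesz-Fischer theorem, the L^1 norms of the increments are summable on the
  bounded domain, so the series of increments converges absolutely almost everywhere.\<close>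

lemma AE_convergent_fast:
  fixes v :: "nat \<Rightarrow> real ^ 'n \<Rightarrow> real"
  assumes vH: "\<And>k. v k \<in> sobolev_H0 s \<Omega>"
    and fast: "\<And>k. ip_L2 (fdiff (v (Suc k)) (v k)) (fdiff (v (Suc k)) (v k)) \<le> (1/4)^k"
  shows "AE x in lborel. convergent (\<lambda>k. v k x)"
proof -
  define d where "d k x = 1 * v (Suc k) x + (-1) * v k x" for k x
  have dH: "d k \<in> sobolev_H0 s \<Omega>" for k
    using H0_lin[OF vH vH, of 1 "Suc k" "-1" k] by (simp add: d_def[abs_def])
  note [measurable] = H0_measurable[OF dH]
  have i: "integrable lborel (d k)" for k using H0_integrable[OF \<Omega>o \<Omega>b s dH] .
  have d1: "(LINT x|lborel. \<bar>d k x\<bar>) \<le> (1 + measure lborel \<Omega>) * (1/2)^k" for k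
  proof -
    \<comment> \<open>The weight \<open>c = 2^k\<close> balances the two terms: both the increment,
      of squared norm at most \<open>(1/4)^k\<close>, and the volume contribute order
      \<open>(1/2)^k\<close>.\<close>
    have "2 * (LINT x|lborel. \<bar>d k x\<bar>) \<le> 2^k * (LINT x|lborel. (d k x)\<^sup>2) + measure lborel \<Omega> / 2^k"
      using H0_measurable[OF dH] H0_square[OF dH] H0_vanish[OF dH]
      by (intro integrable_L2_domain(2)[OF \<Omega>o \<Omega>b s]) auto
    also have "(LINT x|lborel. (d k x)\<^sup>2) \<le> (1/4)^k"
      using fast[of k] by (simp add: ip_L2_def d_def power2_eq_square)
    also have "2^k * (1/4)^k = (1/2::real)^k"
      by (simp add: power_mult_distrib[symmetric])
    finally have "2 * (LINT x|lborel. \<bar>d k x\<bar>) \<le> (1/2)^k + measure lborel \<Omega> / 2^k" by simp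
    moreover have "0 \<le> (LINT x|lborel. \<bar>d k x\<bar>)" by simp
    moreover have "(1/2)^k + measure lborel \<Omega> / 2^k = (1 + measure lborel \<Omega>) * (1/2)^k"
      by (simp add: power_divide field_simps)
    ultimately show ?thesis by linarith
  qed
  have "(\<integral>\<^sup>+x. (\<Sum>k. ennreal \<bar>d k x\<bar>) \<partial>lborel) = (\<Sum>k. \<integral>\<^sup>+x. ennreal \<bar>d k x\<bar> \<partial>lborel)"
    by (rule nn_integral_suminf) measurable
  also have "\<dots> \<le> (\<Sum>k. ennreal ((1 + measure lborel \<Omega>) * (1/2)^k))"
  proof (intro suminf_le allI)
    fix k
    have "(\<integral>\<^sup>+x. ennreal \<bar>d k x\<bar> \<partial>lborel) = ennreal (LINT x|lborel. \<bar>d k x\<bar>)"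
      using i[of k] by (intro nn_integral_eq_integral) auto
    then show "(\<integral>\<^sup>+x. ennreal \<bar>d k x\<bar> \<partial>lborel) \<le> ennreal ((1 + measure lborel \<Omega>) * (1/2)^k)"
      using d1[of k] by (simp add: ennreal_leI)
  qed auto
  also have "\<dots> < \<infinity>"
  proof -
    have "summable (\<lambda>k. (1 + measure lborel \<Omega>) * (1/2::real)^k)"
      by (intro summable_mult summable_geometric) simp
    then show ?thesis by (simp add: ennreal_suminf_neq_top less_top)
  qed
  finally have "AE x in lborel. (\<Sum>k. ennreal \<bar>d k x\<bar>) \<noteq> \<infinity>"
    by (intro nn_integral_PInf_AE) auto
  then show ?thesis
  proof eventually_elim
    case (elim x)
    then have "summable (\<lambda>k. \<bar>d k x\<bar>)" by (intro summable_suminf_not_top) auto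
    then have "summable (\<lambda>k. d k x)" by (rule summable_rabs_cancel)
    then have "convergent (\<lambda>n. \<Sum>k<n. d k x)" by (simp add: summable_iff_convergent)
    moreover have "(\<Sum>k<n. d k x) = v n x - v 0 x" for n
      unfolding d_def using sum_lessThan_telescope[of "\<lambda>k. v k x" n] by simp
    ultimately show ?case by (simp add: convergent_diff_const_right_iff)
  qed
qed

text \<open>The smoothed functions \<open>g n\<close> are uniformly bounded and uniformly Lipschitz
  on the closure of \<Omega>, so a subsequence converges uniformly there. For
  \<open>v = W (r i) - W (r j)\<close> the form is the integral of
  \<open>v * (g (r i) - g (r j))\<close>, bounded by a uniform distance times an L^1 norm.\<close>

lemma heat_form_subseq:
  fixes W :: "nat \<Rightarrow> real ^ 'n \<Rightarrow> real"
  assumes W: "\<And>n. W n \<in> sobolev_H0 s \<Omega>" and Q: "\<And>n. ip_L2 (W n) (W n) \<le> Q" and \<tau>: "0 < \<tau>"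
  obtains r :: "nat \<Rightarrow> nat" where "strict_mono r"
    "\<And>\<epsilon>. 0 < \<epsilon> \<Longrightarrow> \<exists>M. \<forall>i\<ge>M. \<forall>j\<ge>M. heat_form \<tau> (fdiff (W (r i)) (W (r j))) \<le> \<epsilon>"
proof -
  note [measurable] = H0_measurable[OF W]
  have Wi: "integrable lborel (W n)" for n using H0_integrable[OF \<Omega>o \<Omega>b s W] .
  \<comment> \<open>A common bound for the L^1 norms of the \<open>W n\<close>; the summand
    \<open>1\<close> makes it positive, so that it can be divided by.\<close>
  define M1 where "M1 = \<bar>Q\<bar> + measure lborel \<Omega> + 1"
  have M1: "0 < M1" by (simp add: M1_def add_nonneg_pos)
  have L1: "(LINT x|lborel. \<bar>W n x\<bar>) \<le> M1" for n
  proof -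
    have "2 * (LINT x|lborel. \<bar>W n x\<bar>) \<le> 1 * (LINT x|lborel. (W n x)\<^sup>2) + measure lborel \<Omega> / 1"
      using H0_square[OF W] H0_vanish[OF W]
      by (intro integrable_L2_domain(2)[OF \<Omega>o \<Omega>b s]) auto
    moreover have "(LINT x|lborel. (W n x)\<^sup>2) \<le> Q"
      using Q[of n] by (simp add: ip_L2_def power2_eq_square)
    moreover have "0 \<le> (LINT x|lborel. \<bar>W n x\<bar>)" "0 \<le> measure lborel \<Omega>" by simp_all
    ultimately show ?thesis unfolding M1_def by linarith
  qed
  obtain R where R: "0 < R" "\<And>x. x \<in> \<Omega> \<Longrightarrow> norm x \<le> R"
    using \<Omega>b by (auto simp: bounded_pos)
  have Rc: "norm x \<le> R" if "x \<in> closure \<Omega>" for x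
  proof -
    have "closure \<Omega> \<subseteq> cball 0 R" using R(2) by (intro closure_minimal) auto
    with that show ?thesis by auto
  qed
  let ?E = "\<lambda>z::real^'n. exp (- \<tau> * (norm z)\<^sup>2)"
  define g where "g n x = (LINT y|lborel. W n y * ?E (x - y))" for n x
  have gi: "integrable lborel (\<lambda>y. W n y * ?E (x - y))" for n x
    using Wi \<tau> by (intro integrable_mult_bounded_real[where B=1]) auto
  have gb: "norm (g n x) \<le> M1" for n x
  proof -
    have "norm (g n x) \<le> (LINT y|lborel. norm (W n y * ?E (x - y)))"
      unfolding g_def by (rule integral_norm_bound)
    also have "\<dots> \<le> (LINT y|lborel. \<bar>W n y\<bar>)"
      using Wi \<tau> by (intro integral_mono integrable_norm gi) (auto simp: abs_mult intro!: mult_left_le)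
    finally show ?thesis using L1[of n] by simp
  qed
  \<comment> \<open>The function \<open>exp (- a)\<close> is 1-Lipschitz for
    \<open>a \<ge> 0\<close>. In the difference of squared distances, the sum of the two distances
    is at most \<open>4 * R\<close> because all points involved have norm at most
    \<open>R\<close>.\<close>
  have gl: "\<bar>g n x - g n y\<bar> \<le> \<tau> * (4 * R) * M1 * norm (x - y)" if xy: "x \<in> closure \<Omega>" "y \<in> closure \<Omega>" for n x y
  proof -
    have "g n x - g n y = (LINT z|lborel. W n z * ?E (x - z) - W n z * ?E (y - z))"
      unfolding g_def using gi by simp
    also have "\<bar>\<dots>\<bar> \<le> (LINT z|lborel. \<bar>W n z * ?E (x - z) - W n z * ?E (y - z)\<bar>)"
      by simp
    also have "\<dots> \<le> (LINT z|lborel. \<tau> * (4 * R) * norm (x - y) * \<bar>W n z\<bar>)"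
    proof (rule integral_mono_AE)
      show "AE z in lborel. \<bar>W n z * ?E (x - z) - W n z * ?E (y - z)\<bar> \<le> \<tau> * (4 * R) * norm (x - y) * \<bar>W n z\<bar>"
        using H0_vanish[OF W[of n]]
      proof eventually_elim
        case (elim z)
        show ?case
        proof (cases "z \<in> \<Omega>")
          case True
          have "\<bar>?E (x - z) - ?E (y - z)\<bar> \<le> \<bar>\<tau> * (norm (x - z))\<^sup>2 - \<tau> * (norm (y - z))\<^sup>2\<bar>"
            using exp_minus_diff_le[of "\<tau> * (norm (x - z))\<^sup>2" "\<tau> * (norm (y - z))\<^sup>2"] \<tau> by simp
          also have "\<dots> = \<tau> * (\<bar>norm (x - z) - norm (y - z)\<bar> * (norm (x - z) + norm (y - z)))"
          proof -
            have "\<tau> * (norm (x - z))\<^sup>2 - \<tau> * (norm (y - z))\<^sup>2 = \<tau> * ((norm (x - z) - norm (y - z)) * (norm (x - z) + norm (y - z)))"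
              by (simp add: power2_eq_square algebra_simps)
            then show ?thesis using \<tau> by (simp add: abs_mult)
          qed
          also have "\<dots> \<le> \<tau> * (norm (x - y) * (4 * R))"
          proof (intro mult_left_mono mult_mono)
            show "\<bar>norm (x - z) - norm (y - z)\<bar> \<le> norm (x - y)"
              using norm_triangle_ineq3[of "x - z" "y - z"] by simp
            show "norm (x - z) + norm (y - z) \<le> 4 * R"
              using norm_triangle_ineq4[of x z] norm_triangle_ineq4[of y z] Rc[OF xy(1)] Rc[OF xy(2)] R(2)[OF True] by linarith
          qed (use \<tau> in auto)
          finally have "\<bar>W n z\<bar> * \<bar>?E (x - z) - ?E (y - z)\<bar> \<le> \<bar>W n z\<bar> * (\<tau> * (norm (x - y) * (4 * R)))"
            by (rule mult_left_mono) simp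
          then show ?thesis by (simp add: abs_mult[symmetric] algebra_simps)
        qed (use elim in auto)
      qed
    qed (use gi Wi in auto)
    also have "\<dots> = \<tau> * (4 * R) * norm (x - y) * (LINT z|lborel. \<bar>W n z\<bar>)" by simp
    also have "\<dots> \<le> \<tau> * (4 * R) * norm (x - y) * M1"
      using L1 \<tau> R by (intro mult_left_mono) auto
    finally show ?thesis by (simp add: mult_ac)
  qed
  have "\<exists>d>0. \<forall>n y. y \<in> closure \<Omega> \<and> norm (x - y) < d \<longrightarrow> norm (g n x - g n y) < e"
    if "x \<in> closure \<Omega>" "0 < e" for x e
  proof (intro exI conjI allI impI)
    let ?L = "\<tau> * (4 * R) * M1"
    have L: "0 < ?L" using \<tau> R M1 by simp
    then show "0 < e / ?L" using that by simp
    fix n y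
    assume y: "y \<in> closure \<Omega> \<and> norm (x - y) < e / ?L"
    then have "norm (g n x - g n y) \<le> ?L * norm (x - y)" using gl[OF that(1)] by simp
    also have "\<dots> < e" using y L by (simp add: field_simps)
    finally show "norm (g n x - g n y) < e" .
  qed
  moreover have "compact (closure \<Omega>)" using \<Omega>b by (simp add: compact_closure)
  ultimately obtain G r where r: "strict_mono (r :: nat \<Rightarrow> nat)"
    and unif: "\<And>e. 0 < e \<Longrightarrow> \<exists>N. \<forall>n x. n \<ge> N \<and> x \<in> closure \<Omega> \<longrightarrow> norm (g (r n) x - G x) < e"
    using Arzela_Ascoli[of "closure \<Omega>" g M1] gb by metis
  show thesis
  proof (rule that[OF r])
    fix \<epsilon> :: real assume \<epsilon>: "0 < \<epsilon>"
    \<comment> \<open>The final estimate is \<open>2 * e\<close> times an L^1 norm of at most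
      \<open>2 * M1\<close>.\<close>
    define e where "e = \<epsilon> / (4 * M1)"
    have e: "0 < e" using \<epsilon> M1 by (simp add: e_def)
    obtain N where N: "\<And>n x. n \<ge> N \<Longrightarrow> x \<in> closure \<Omega> \<Longrightarrow> norm (g (r n) x - G x) < e"
      using unif[OF e] by blast
    show "\<exists>M. \<forall>i\<ge>M. \<forall>j\<ge>M. heat_form \<tau> (fdiff (W (r i)) (W (r j))) \<le> \<epsilon>"
    proof (intro exI allI impI)
      fix i j assume ij: "N \<le> i" "N \<le> j"
      define v where "v x = 1 * W (r i) x + (-1) * W (r j) x" for x
      have vH: "v \<in> sobolev_H0 s \<Omega>" using H0_lin[OF W W, of 1 "r i" "-1" "r j"] by (simp add: v_def[abs_def])
      have vi: "integrable lborel v" using H0_integrable[OF \<Omega>o \<Omega>b s vH] .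
      have [measurable]: "v \<in> borel_measurable borel" using H0_measurable[OF vH] .
      have I: "integrable (lborel \<Otimes>\<^sub>M lborel) (\<lambda>(x, y). v x * v y * ?E (x - y))"
        by (rule heat_double_integrable[OF vi H0_square[OF vH] \<tau>])
      have "heat_form \<tau> v = (LINT x|lborel. LINT y|lborel. v x * v y * ?E (x - y))"
        unfolding heat_form_def using lborel_pair.integral_fst[OF I] by simp
      also have "\<dots> = (LINT x|lborel. v x * (g (r i) x - g (r j) x))"
      proof (intro Bochner_Integration.integral_cong refl)
        fix x
        have "(LINT y|lborel. v x * v y * ?E (x - y)) = v x * (LINT y|lborel. W (r i) y * ?E (x - y) - W (r j) y * ?E (x - y))"
          by (subst integral_mult_right_zero[symmetric]) (simp add: v_def algebra_simps)
        then show "(LINT y|lborel. v x * v y * ?E (x - y)) = v x * (g (r i) x - g (r j) x)"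
          using gi by (simp add: g_def)
      qed
      also have "\<dots> \<le> (LINT x|lborel. 2 * e * \<bar>v x\<bar>)"
      proof (rule integral_mono_AE)
        have "integrable lborel (\<lambda>x. LINT y|lborel. v x * v y * ?E (x - y))"
          by (rule lborel_pair.integrable_fst[OF I])
        also have "(\<lambda>x. LINT y|lborel. v x * v y * ?E (x - y)) = (\<lambda>x. v x * (g (r i) x - g (r j) x))"
        proof
          fix x
          have "(LINT y|lborel. v x * v y * ?E (x - y)) = v x * (LINT y|lborel. W (r i) y * ?E (x - y) - W (r j) y * ?E (x - y))"
            by (subst integral_mult_right_zero[symmetric]) (simp add: v_def algebra_simps)
          then show "(LINT y|lborel. v x * v y * ?E (x - y)) = v x * (g (r i) x - g (r j) x)"
            using gi by (simp add: g_def)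
        qed
        finally show "integrable lborel (\<lambda>x. v x * (g (r i) x - g (r j) x))" .
        show "AE x in lborel. v x * (g (r i) x - g (r j) x) \<le> 2 * e * \<bar>v x\<bar>"
          using H0_vanish[OF vH]
        proof eventually_elim
          case (elim x)
          show ?case
          proof (cases "x \<in> \<Omega>")
            case True
            then have "x \<in> closure \<Omega>" using closure_subset by auto
            then have "\<bar>g (r i) x - g (r j) x\<bar> \<le> 2 * e"
              using N[OF ij(1), of x] N[OF ij(2), of x] by (simp add: abs_if split: if_splits)
            then have "\<bar>v x\<bar> * \<bar>g (r i) x - g (r j) x\<bar> \<le> \<bar>v x\<bar> * (2 * e)" by (rule mult_left_mono) simp
            then show ?thesis by (simp add: abs_mult[symmetric] mult.commute[of "2 * e"])
          qed (use elim in auto)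
        qed
      qed (use vi in auto)
      also have "\<dots> = 2 * e * (LINT x|lborel. \<bar>v x\<bar>)" by simp
      also have "\<dots> \<le> 2 * e * (M1 + M1)"
      proof (intro mult_left_mono)
        have "(LINT x|lborel. \<bar>v x\<bar>) \<le> (LINT x|lborel. \<bar>W (r i) x\<bar> + \<bar>W (r j) x\<bar>)"
          using vi Wi by (intro integral_mono) (auto simp: v_def)
        also have "\<dots> = (LINT x|lborel. \<bar>W (r i) x\<bar>) + (LINT x|lborel. \<bar>W (r j) x\<bar>)"
          using Wi by simp
        finally show "(LINT x|lborel. \<bar>v x\<bar>) \<le> M1 + M1" using L1[of "r i"] L1[of "r j"] by linarith
      qed (use e in auto)
      also have "\<dots> = \<epsilon>" using M1 by (simp add: e_def)
      finally show "heat_form \<tau> (fdiff (W (r i)) (W (r j))) \<le> \<epsilon>" by (simp add: v_def[abs_def])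
    qed
  qed
qed

lemma H0_diff: "u \<in> sobolev_H0 s \<Omega> \<Longrightarrow> v \<in> sobolev_H0 s \<Omega> \<Longrightarrow> (fdiff u v) \<in> sobolev_H0 s \<Omega>"
  by (rule H0_lin)

lemma gagliardo_diff_quot: "gagliardo s u = (LINT p|(lborel \<Otimes>\<^sub>M lborel). (diff_quot s u p)\<^sup>2)"
  by (simp add: gagliardo_def diff_quot_square)

lemma gagliardo_diff_le:
  assumes "u \<in> sobolev_H0 s \<Omega>" "v \<in> sobolev_H0 s \<Omega>"
  shows "gagliardo s (fdiff u v) \<le> 2 * gagliardo s u + 2 * gagliardo s v"
proof -
  have "gagliardo s (fdiff u v) \<le> (LINT p|(lborel \<Otimes>\<^sub>M lborel). 2 * (diff_quot s u p)\<^sup>2 + 2 * (diff_quot s v p)\<^sup>2)"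
    unfolding gagliardo_diff_quot
  proof (rule integral_mono)
    fix p
    have "(1 * a + - 1 * b)\<^sup>2 \<le> 2 * a\<^sup>2 + 2 * b\<^sup>2" for a b :: real
      using zero_le_power2[of "a + b"] by (simp add: power2_eq_square algebra_simps)
    then show "(diff_quot s (\<lambda>x. 1 * u x + - 1 * v x) p)\<^sup>2 \<le> 2 * (diff_quot s u p)\<^sup>2 + 2 * (diff_quot s v p)\<^sup>2"
      by (simp only: diff_quot_lin)
  qed (use H0_diff_quot[OF H0_diff[OF assms]] assms[THEN H0_diff_quot] in auto)
  also have "\<dots> = 2 * gagliardo s u + 2 * gagliardo s v"
    using assms[THEN H0_diff_quot] by (simp add: gagliardo_diff_quot)
  finally show ?thesis .
qed

text \<open>The square norm splits into a high-frequency part, which the seminorm controls with the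
  small factor \<open>\<tau> powr - s\<close>, and the smoothed part \<open>heat_form\<close>, which
  is precompact for each fixed \<tau>.\<close>

lemma ip_L2_le_heat_form:
  assumes v: "v \<in> sobolev_H0 s \<Omega>" and \<tau>: "0 < \<tau>"
  shows "ip_L2 v v \<le> (CARD('n) / 2 + s) powr (CARD('n) / 2 + s) / pi powr (CARD('n) / 2) * \<tau> powr (- s) * gagliardo s v / 2
     + (\<tau> / pi) powr (CARD('n) / 2) * heat_form \<tau> v"
proof -
  let ?n = "CARD('n) / 2"
  have v1: "integrable lborel v" using H0_integrable[OF \<Omega>o \<Omega>b s v] .
  have v2: "integrable lborel (\<lambda>x. (v x)\<^sup>2)" using H0_square[OF v] .
  have vH: "integrable (lborel \<Otimes>\<^sub>M lborel) (\<lambda>(x, y). (v x - v y)\<^sup>2 / norm (x - y) powr (real DIM(real^'n) + 2 * s))"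
    using H0_diff_quot[OF v] by (simp add: diff_quot_square)
  have b: "(\<tau> / pi) powr ?n * (pi / \<tau>) powr ?n = 1"
    using \<tau> by (simp add: powr_mult[symmetric])
  have "heat_energy v \<tau> = 2 * ((pi / \<tau>) powr ?n * ip_L2 v v - heat_form \<tau> v)"
    using heat_energy_eq[OF v1 v2 \<tau>] by (simp add: has_bochner_integral_iff heat_energy_def heat_form_def ip_L2_def power2_eq_square)
  then have "(\<tau> / pi) powr ?n * heat_energy v \<tau> = 2 * ((\<tau> / pi) powr ?n * (pi / \<tau>) powr ?n * ip_L2 v v - (\<tau> / pi) powr ?n * heat_form \<tau> v)"
    by (simp only: right_diff_distrib mult_ac)
  then have "(\<tau> / pi) powr ?n * heat_energy v \<tau> = 2 * (ip_L2 v v - (\<tau> / pi) powr ?n * heat_form \<tau> v)"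
    unfolding b by simp
  then show ?thesis
    using heat_energy_le_gagliardo[OF v1 v2 s vH \<tau>] by simp
qed

text \<open>For every accuracy, a large \<tau> makes the high-frequency part of all differences
  small at once, and \<open>heat_form_subseq\<close> treats the rest for this \<tau>. A diagonal
  sequence serves all accuracies.\<close>

lemma L2_cauchy_subseq:
  fixes W :: "nat \<Rightarrow> real ^ 'n \<Rightarrow> real"
  assumes W: "\<And>n. W n \<in> sobolev_H0 s \<Omega>" and Q: "\<And>n. energy s (W n) (W n) \<le> Q"
  obtains r :: "nat \<Rightarrow> nat" where "strict_mono r"
    "\<And>\<epsilon>. 0 < \<epsilon> \<Longrightarrow> \<exists>M. \<forall>i\<ge>M. \<forall>j\<ge>M. ip_L2 (fdiff (W (r i)) (W (r j))) (fdiff (W (r i)) (W (r j))) \<le> \<epsilon>"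
proof -
  let ?D = "\<lambda>i j x. 1 * W i x + (-1) * W j x"
  let ?C = "frac_laplacian_const CARD('n) s"
  let ?c = "(CARD('n) / 2 + s) powr (CARD('n) / 2 + s) / pi powr (CARD('n) / 2)"
  have C: "0 < ?C" using s by (rule frac_laplacian_const_pos)
  have c: "0 \<le> ?c" by simp
  define G where "G = 2 * \<bar>Q\<bar> / ?C"
  have gag: "gagliardo s (W n) \<le> G" for n
  proof -
    have "?C / 2 * gagliardo s (W n) \<le> \<bar>Q\<bar>"
      using Q[of n] ip_L2_nonneg[of "W n"] by (simp add: energy_self)
    then show ?thesis using C by (simp add: G_def field_simps)
  qed
  have gagD: "gagliardo s (?D i j) \<le> 4 * G" for i j
    using gagliardo_diff_le[OF W[of i] W[of j]] gag[of i] gag[of j] by linarith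
  have G: "0 \<le> G" using gag[of 0] gagliardo_nonneg[of s "W 0"] by linarith
  have ipQ: "ip_L2 (W n) (W n) \<le> Q" for n
    using Q[of n] coercive_energy[OF \<Omega>o \<Omega>b s, of "W n"] by linarith
  define P where "P k q \<longleftrightarrow> (\<exists>M. \<forall>i\<ge>M. \<forall>j\<ge>M. ip_L2 (?D (q i) (q j)) (?D (q i) (q j)) \<le> 1 / real (Suc k))" for k and q :: "nat \<Rightarrow> nat"
  interpret subseqs P
  proof
    fix k and q :: "nat \<Rightarrow> nat"
    assume "strict_mono q"
    \<comment> \<open>The parameter \<tau> is fixed before the subsequence: the seminorms of all
      differences have the common bound \<open>4 * G\<close>, so half of the accuracy can be spent
      on them uniformly.\<close>
    have "((\<lambda>\<tau>. ?c * \<tau> powr (- s) * (4 * G) / 2) \<longlongrightarrow> ?c * 0 * (4 * G) / 2) at_top"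
      using s by (intro tendsto_intros tendsto_neg_powr filterlim_ident) auto
    then have "\<forall>\<^sub>F \<tau> in at_top. ?c * \<tau> powr (- s) * (4 * G) / 2 < 1 / (2 * real (Suc k))"
      by (rule order_tendstoD) simp
    then have "\<forall>\<^sub>F \<tau> in at_top. 0 < \<tau> \<and> ?c * \<tau> powr (- s) * (4 * G) / 2 < 1 / (2 * real (Suc k))"
      using eventually_gt_at_top[of 0] by eventually_elim auto
    then obtain \<tau> where \<tau>: "0 < \<tau>" "?c * \<tau> powr (- s) * (4 * G) / 2 < 1 / (2 * real (Suc k))"
      by (auto simp: eventually_at_top_linorder)
    obtain r where r: "strict_mono (r :: nat \<Rightarrow> nat)"
      and rH: "\<And>\<epsilon>. 0 < \<epsilon> \<Longrightarrow> \<exists>M. \<forall>i\<ge>M. \<forall>j\<ge>M. heat_form \<tau> (fdiff ((W \<circ> q) (r i)) ((W \<circ> q) (r j))) \<le> \<epsilon>"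
      using heat_form_subseq[of "W \<circ> q" Q \<tau>] W ipQ \<tau>(1) by (auto simp del: mult_minus1)
    define T where "T = (\<tau> / pi) powr (CARD('n) / 2)"
    have T: "0 < T" using \<tau> by (simp add: T_def)
    obtain M where M: "\<And>i j. M \<le> i \<Longrightarrow> M \<le> j \<Longrightarrow> heat_form \<tau> (?D (q (r i)) (q (r j))) \<le> 1 / (2 * real (Suc k)) / T"
      using rH[of "1 / (2 * real (Suc k)) / T"] T by (auto simp del: mult_minus1 of_nat_Suc)
    have "ip_L2 (?D (q (r i)) (q (r j))) (?D (q (r i)) (q (r j))) \<le> 1 / real (Suc k)" if "M \<le> i" "M \<le> j" for i j
    proof -
      let ?v = "?D (q (r i)) (q (r j))"
      have "ip_L2 ?v ?v \<le> ?c * \<tau> powr (- s) * gagliardo s ?v / 2 + T * heat_form \<tau> ?v"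
        unfolding T_def by (rule ip_L2_le_heat_form[OF H0_diff[OF W W] \<tau>(1)])
      also have "?c * \<tau> powr (- s) * gagliardo s ?v / 2 \<le> ?c * \<tau> powr (- s) * (4 * G) / 2"
        using gagD[of "q (r i)" "q (r j)"] by (intro divide_right_mono mult_left_mono) auto
      also have "T * heat_form \<tau> ?v \<le> T * (1 / (2 * real (Suc k)) / T)"
        using M[OF that] T by (intro mult_left_mono) auto
      finally have "ip_L2 ?v ?v \<le> 1 / (2 * real (Suc k)) + 1 / (2 * real (Suc k))"
        using \<tau>(2) T by simp
      also have "\<dots> = 1 / real (Suc k)" by (simp add: field_simps del: of_nat_Suc)
      finally show ?thesis .
    qed
    then show "\<exists>r'. strict_mono r' \<and> P k (q \<circ> r')"
      using r unfolding P_def o_def by blast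
  qed
  \<comment> \<open>The property \<open>P\<close> passes to subsequences, since a strictly
    increasing \<open>r\<close> satisfies \<open>i \<le> r i\<close>; a tail of the diagonal
    sequence therefore inherits it.\<close>
  have "P k (diagseq \<circ> ((+) (Suc k)))" for k
  proof (rule diagseq_holds)
    fix r q :: "nat \<Rightarrow> nat" and n
    assume r: "strict_mono r" and "P n q"
    then obtain M where M: "\<And>i j. M \<le> i \<Longrightarrow> M \<le> j \<Longrightarrow> ip_L2 (?D (q i) (q j)) (?D (q i) (q j)) \<le> 1 / real (Suc n)"
      unfolding P_def by blast
    have "M \<le> r i" if "M \<le> i" for i using seq_suble[OF r, of i] that by linarith
    then show "P n (q \<circ> r)" unfolding P_def o_def using M by blast
  qed
  then have Pd: "\<exists>M. \<forall>i\<ge>M. \<forall>j\<ge>M. ip_L2 (?D (diagseq (Suc k + i)) (diagseq (Suc k + j))) (?D (diagseq (Suc k + i)) (diagseq (Suc k + j))) \<le> 1 / real (Suc k)" for k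
    unfolding P_def o_def by blast
  show thesis
  proof (rule that[OF subseq_diagseq])
    fix \<epsilon> :: real assume "0 < \<epsilon>"
    then obtain k where k: "1 / real (Suc k) < \<epsilon>" using nat_approx_posE by blast
    obtain M where M: "\<And>i j. M \<le> i \<Longrightarrow> M \<le> j \<Longrightarrow> ip_L2 (?D (diagseq (Suc k + i)) (diagseq (Suc k + j))) (?D (diagseq (Suc k + i)) (diagseq (Suc k + j))) \<le> 1 / real (Suc k)"
      using Pd[of k] by blast
    show "\<exists>M. \<forall>i\<ge>M. \<forall>j\<ge>M. ip_L2 (?D (diagseq i) (diagseq j)) (?D (diagseq i) (diagseq j)) \<le> \<epsilon>"
    proof (intro exI allI impI)
      fix i j assume ij: "Suc k + M \<le> i" "Suc k + M \<le> j"
      have "ip_L2 (?D (diagseq (Suc k + (i - Suc k))) (diagseq (Suc k + (j - Suc k)))) (?D (diagseq (Suc k + (i - Suc k))) (diagseq (Suc k + (j - Suc k)))) \<le> 1 / real (Suc k)"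
        using ij by (intro M) linarith+
      moreover have "Suc k + (i - Suc k) = i" "Suc k + (j - Suc k) = j" using ij by linarith+
      ultimately show "ip_L2 (?D (diagseq i) (diagseq j)) (?D (diagseq i) (diagseq j)) \<le> \<epsilon>"
        using k by simp
    qed
  qed
qed

lemma form_pair_H0: "form_pair (sobolev_H0 s \<Omega>) ip_L2 (energy s)"
proof
  show "(\<lambda>x. 0) \<in> sobolev_H0 s \<Omega>" by (rule H0_zero)
qed (auto intro: H0_lin ip_L2_sym energy_sym ip_L2_lin[of _ s \<Omega>] energy_lin[of _ s \<Omega>] ip_L2_nonneg coercive_energy[OF \<Omega>o \<Omega>b s])

text \<open>A rapidly Cauchy subsequence converges almost everywhere. Fatou's lemma places the limit
  in the space, gives convergence in L^2 with a rate, and bounds the limit energy.\<close>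

lemma H0_compact:
  fixes W :: "nat \<Rightarrow> real ^ 'n \<Rightarrow> real"
  assumes W: "\<And>n. W n \<in> sobolev_H0 s \<Omega>" and B: "\<And>n. energy s (W n) (W n) \<le> B n" "B \<longlonglongrightarrow> m"
  shows "\<exists>u\<in>sobolev_H0 s \<Omega>. \<exists>r :: nat \<Rightarrow> nat. strict_mono r \<and> energy s u u \<le> m \<and>
        (\<lambda>n. ip_L2 (fdiff (W (r n)) u) (fdiff (W (r n)) u)) \<longlonglongrightarrow> 0"
proof -
  let ?D = "\<lambda>i j x. 1 * W i x + (-1) * W j x"
  let ?C = "frac_laplacian_const CARD('n) s"
  have C: "0 < ?C" using s by (rule frac_laplacian_const_pos)
  obtain Q where Q: "\<And>n. B n \<le> Q"
    using convergent_imp_Bseq[of B] B(2) by (auto simp: convergent_def Bseq_def abs_le_iff)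
  have WQ: "energy s (W n) (W n) \<le> Q" for n using B(1)[of n] Q[of n] by linarith
  obtain r0 :: "nat \<Rightarrow> nat" where r0: "strict_mono r0"
    and cauchy: "\<And>\<epsilon>. 0 < \<epsilon> \<Longrightarrow> \<exists>M. \<forall>i\<ge>M. \<forall>j\<ge>M. ip_L2 (?D (r0 i) (r0 j)) (?D (r0 i) (r0 j)) \<le> \<epsilon>"
    using L2_cauchy_subseq[of W Q, OF W WQ] by blast
  obtain r1 :: "nat \<Rightarrow> nat" where r1: "strict_mono r1"
    and fast: "\<And>k i j. r1 k \<le> i \<Longrightarrow> r1 k \<le> j \<Longrightarrow> ip_L2 (?D (r0 i) (r0 j)) (?D (r0 i) (r0 j)) \<le> (1/4)^k"
    using cauchy_fast_subseq[of "\<lambda>i j. ip_L2 (?D (r0 i) (r0 j)) (?D (r0 i) (r0 j))"] cauchy by blast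
  define r where "r k = r0 (r1 k)" for k
  have r: "strict_mono r" using strict_mono_o[OF r0 r1] by (simp add: r_def[abs_def] o_def)
  define v where "v k = W (r k)" for k
  have vH: "v k \<in> sobolev_H0 s \<Omega>" for k by (simp add: v_def W)
  note [measurable] = H0_measurable[OF vH]
  have vfast: "ip_L2 (fdiff (v k) (v l)) (fdiff (v k) (v l)) \<le> (1/4)^k" if "k \<le> l" for k l
    using fast[of k "r1 k" "r1 l"] that r1 by (simp add: v_def r_def strict_mono_less_eq)
  have conv: "AE x in lborel. convergent (\<lambda>k. v k x)"
  proof (rule AE_convergent_fast[OF vH])
    fix k
    show "ip_L2 (fdiff (v (Suc k)) (v k)) (fdiff (v (Suc k)) (v k)) \<le> (1/4)^k"
      using fast[of k "r1 (Suc k)" "r1 k"] r1 by (simp add: v_def r_def strict_mono_less_eq)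
  qed
  \<comment> \<open>Where the sequence diverges, \<open>lim\<close> has an unspecified value; this
    concerns a null set only.\<close>
  define u where "u x = lim (\<lambda>k. v k x)" for x
  have um [measurable]: "u \<in> borel_measurable borel"
    unfolding u_def by measurable
  have lim: "AE x in lborel. (\<lambda>k. v k x) \<longlonglongrightarrow> u x"
    using conv by eventually_elim (simp add: u_def convergent_LIMSEQ_iff)
  have lim2: "AE p in lborel \<Otimes>\<^sub>M lborel. (\<lambda>k. (diff_quot s (v k) p)\<^sup>2) \<longlonglongrightarrow> (diff_quot s u p)\<^sup>2"
    using AE_lborel_fst_snd[OF lim]
  proof eventually_elim
    case (elim p)
    then show ?case
      unfolding diff_quot_def divide_inverse by (intro tendsto_intros) auto
  qed
  have bnd: "(LINT x|lborel. (v k x)\<^sup>2) \<le> Q" "(LINT p|(lborel \<Otimes>\<^sub>M lborel). (diff_quot s (v k) p)\<^sup>2) \<le> 2 * Q / ?C" for k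
  proof -
    have *: "ip_L2 (v k) (v k) + ?C / 2 * gagliardo s (v k) \<le> Q" using WQ[of "r k"] by (simp add: v_def energy_self)
    moreover have "0 \<le> ?C / 2 * gagliardo s (v k)" using C gagliardo_nonneg[of s "v k"] by simp
    ultimately show "(LINT x|lborel. (v k x)\<^sup>2) \<le> Q" by (simp add: ip_L2_def power2_eq_square)
    have "?C / 2 * gagliardo s (v k) \<le> Q" using * ip_L2_nonneg[of "v k"] by linarith
    then show "(LINT p|(lborel \<Otimes>\<^sub>M lborel). (diff_quot s (v k) p)\<^sup>2) \<le> 2 * Q / ?C"
      using C by (simp add: gagliardo_diff_quot field_simps)
  qed
  have uH: "u \<in> sobolev_H0 s \<Omega>"
    unfolding sobolev_H0_iff
  proof (intro conjI)
    show "integrable lborel (\<lambda>x. (u x)\<^sup>2)"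
    proof (rule fatou_bound(1)[OF H0_square[OF vH] _ bnd(1) tendsto_const])
      show "AE x in lborel. (\<lambda>k. (v k x)\<^sup>2) \<longlonglongrightarrow> (u x)\<^sup>2"
        using lim by eventually_elim (intro tendsto_intros)
    qed auto
    show "integrable (lborel \<Otimes>\<^sub>M lborel) (\<lambda>p. (diff_quot s u p)\<^sup>2)"
      by (rule fatou_bound(1)[OF H0_diff_quot[OF vH] _ bnd(2) tendsto_const _ lim2]) auto
    have "AE x in lborel. \<forall>k. x \<notin> \<Omega> \<longrightarrow> v k x = 0"
      using H0_vanish[OF vH] by (intro AE_all_countable[THEN iffD2] allI)
    with lim show "AE x in lborel. x \<notin> \<Omega> \<longrightarrow> u x = 0"
      by eventually_elim (auto simp: LIMSEQ_const_iff)
  qed (rule um)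
  \<comment> \<open>Fatou's lemma is applied in the later index \<open>l + k\<close>, with
    \<open>k\<close> fixed, so that the Cauchy estimate turns into a distance to the limit.\<close>
  have L2le: "ip_L2 (fdiff (v k) u) (fdiff (v k) u) \<le> (1/4)^k" for k
  proof -
    have "(LINT x|lborel. (1 * v k x + (-1) * u x)\<^sup>2) \<le> (1/4)^k"
    proof (rule fatou_bound(2)[where f = "\<lambda>l x. (1 * v k x + (-1) * v (l + k) x)\<^sup>2"])
      show "integrable lborel (\<lambda>x. (1 * v k x + (-1) * v (l + k) x)\<^sup>2)" for l
        by (rule H0_square[OF H0_diff[OF vH vH]])
      show "(LINT x|lborel. (1 * v k x + (-1) * v (l + k) x)\<^sup>2) \<le> (1/4)^k" for l
        using vfast[of k "l + k"] by (simp add: ip_L2_def power2_eq_square)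
      show "AE x in lborel. (\<lambda>l. (1 * v k x + (-1) * v (l + k) x)\<^sup>2) \<longlonglongrightarrow> (1 * v k x + (-1) * u x)\<^sup>2"
        using lim by eventually_elim (intro tendsto_intros LIMSEQ_ignore_initial_segment)
      show "(\<lambda>x. (1 * v k x + (-1) * u x)\<^sup>2) \<in> borel_measurable lborel" by measurable
    qed auto
    then show ?thesis by (simp add: ip_L2_def power2_eq_square)
  qed
  have L2lim: "(\<lambda>k. ip_L2 (fdiff (v k) u) (fdiff (v k) u)) \<longlonglongrightarrow> 0"
  proof (rule Lim_null_comparison)
    show "\<forall>\<^sub>F k in sequentially. norm (ip_L2 (fdiff (v k) u) (fdiff (v k) u)) \<le> (1/4)^k"
    proof (intro always_eventually allI)
      fix k
      show "norm (ip_L2 (fdiff (v k) u) (fdiff (v k) u)) \<le> (1/4)^k"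
        unfolding real_norm_def abs_of_nonneg[OF ip_L2_nonneg] by (rule L2le)
    qed
    show "(\<lambda>k. (1/4::real)^k) \<longlonglongrightarrow> 0" by (rule LIMSEQ_power_zero) simp
  qed
  \<comment> \<open>The mass term converges exactly because of strong convergence. Only the seminorm
    is left to Fatou's lemma, with the convergent bounds \<open>?f\<close> obtained by solving the
    energy bound for it.\<close>
  have "energy s u u \<le> m"
  proof -
    let ?f = "\<lambda>k. 2 / ?C * (B (r k) - ip_L2 (v k) (v k))"
    have ipv: "(\<lambda>k. ip_L2 (v k) (v k)) \<longlonglongrightarrow> ip_L2 u u"
    proof -
      interpret form_pair "sobolev_H0 s \<Omega>" ip_L2 "energy s" by (rule form_pair_H0)
      define z where "z k x = 1 * v k x + (-1) * u x" for k x
      have zH: "z k \<in> sobolev_H0 s \<Omega>" for k using H0_diff[OF vH uH, of k] by (simp add: z_def[abs_def])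
      have zz: "(\<lambda>k. ip_L2 (z k) (z k)) \<longlonglongrightarrow> 0" using L2lim by (simp add: z_def[abs_def])
      have zu: "(\<lambda>k. ip_L2 (z k) u) \<longlonglongrightarrow> 0"
      proof (rule Lim_null_comparison)
        show "\<forall>\<^sub>F k in sequentially. norm (ip_L2 (z k) u) \<le> sqrt (ip_L2 (z k) (z k) * ip_L2 u u)"
          using Cauchy_Schwarz[OF zH uH] by (intro always_eventually allI real_le_rsqrt) simp
        show "(\<lambda>k. sqrt (ip_L2 (z k) (z k) * ip_L2 u u)) \<longlonglongrightarrow> 0"
          using tendsto_real_sqrt[OF tendsto_mult_left_zero[OF zz, of "ip_L2 u u"]] by simp
      qed
      have "ip_L2 (v k) (v k) = ip_L2 (z k) (z k) + 2 * ip_L2 (z k) u + ip_L2 u u" for k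
      proof -
        have "v k = (\<lambda>x. 1 * z k x + 1 * u x)" by (auto simp: z_def)
        then show ?thesis using ip_quad[OF zH uH, of 1 k 1] by simp
      qed
      moreover have "(\<lambda>k. ip_L2 (z k) (z k) + 2 * ip_L2 (z k) u + ip_L2 u u) \<longlonglongrightarrow> 0 + 2 * 0 + ip_L2 u u"
        by (intro tendsto_intros zz zu)
      ultimately show ?thesis by simp
    qed
    have "(LINT p|(lborel \<Otimes>\<^sub>M lborel). (diff_quot s u p)\<^sup>2) \<le> 2 / ?C * (m - ip_L2 u u)"
    proof (rule fatou_bound(2)[OF H0_diff_quot[OF vH] _ _ _ _ lim2])
      show "?f \<longlonglongrightarrow> 2 / ?C * (m - ip_L2 u u)"
        by (intro tendsto_intros ipv LIMSEQ_subseq_LIMSEQ[OF B(2) r, unfolded o_def])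
      show "(LINT p|(lborel \<Otimes>\<^sub>M lborel). (diff_quot s (v k) p)\<^sup>2) \<le> ?f k" for k
        using B(1)[of "r k"] C by (simp add: v_def energy_self gagliardo_diff_quot field_simps)
    qed auto
    then show ?thesis using C by (simp add: energy_self gagliardo_diff_quot field_simps)
  qed
  then show ?thesis using uH r L2lim unfolding v_def by blast
qed

lemma coercive_form_H0: "coercive_form (sobolev_H0 s \<Omega>) ip_L2 (energy s)"
  by (intro coercive_form.intro form_pair_H0 coercive_form_axioms.intro H0_compact)

end

section \<open>Orthonormal eigenfunctions\<close>

context form_pair
begin

text \<open>The last conclusion states that the \<open>e i\<close> span the \<open>b l\<close> in
  dual form, through orthogonality. This suffices for completeness and avoids expansions that hold
  only almost everywhere.\<close>

lemma gram_schmidt: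
  fixes b :: "nat \<Rightarrow> 'x \<Rightarrow> real"
  assumes E: "E \<subseteq> V" "(\<lambda>x. 0) \<in> E" "\<And>u v c d. u \<in> E \<Longrightarrow> v \<in> E \<Longrightarrow> (\<lambda>x. c * u x + d * v x) \<in> E"
    and b: "\<And>i. i < k \<Longrightarrow> b i \<in> E"
    and indep: "\<And>c. ip (\<lambda>x. \<Sum>i<k. c i * b i x) (\<lambda>x. \<Sum>i<k. c i * b i x) = 0 \<Longrightarrow> \<forall>i<k. c i = 0"
  obtains e :: "nat \<Rightarrow> 'x \<Rightarrow> real" where "\<forall>i<k. e i \<in> E"
    "\<forall>i<k. \<forall>j<k. ip (e i) (e j) = (if i = j then 1 else 0)"
    "\<forall>u\<in>V. (\<forall>i<k. ip u (e i) = 0) \<longrightarrow> (\<forall>l<k. ip u (b l) = 0)"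
proof -
  define Sp where "Sp m = {u. \<exists>c. u = (\<lambda>x. \<Sum>l<m. c l * b l x)}" for m :: nat
  have SpI: "(\<lambda>x. \<Sum>l<m. c l * b l x) \<in> Sp m" for m c
    unfolding Sp_def by (intro CollectI exI[of _ c]) (rule refl)
  have Sp_lin: "(\<lambda>x. c * u x + d * v x) \<in> Sp m" if "u \<in> Sp m" "v \<in> Sp m" for u v c d m
  proof -
    obtain f where "u = (\<lambda>x. \<Sum>l<m. f l * b l x)" using \<open>u \<in> Sp m\<close> by (auto simp: Sp_def)
    moreover obtain g where "v = (\<lambda>x. \<Sum>l<m. g l * b l x)" using \<open>v \<in> Sp m\<close> by (auto simp: Sp_def)
    ultimately have "(\<lambda>x. c * u x + d * v x) = (\<lambda>x. \<Sum>l<m. (c * f l + d * g l) * b l x)"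
      by (simp add: sum.distrib sum_distrib_left algebra_simps)
    then show ?thesis using SpI[of "\<lambda>l. c * f l + d * g l" m] by simp
  qed
  have Sp_Suc: "Sp m \<subseteq> Sp (Suc m)" for m
  proof
    fix u assume "u \<in> Sp m"
    then obtain f where "u = (\<lambda>x. \<Sum>l<m. f l * b l x)" by (auto simp: Sp_def)
    then have "u = (\<lambda>x. \<Sum>l<Suc m. (if l = m then 0 else f l) * b l x)" by simp
    then show "u \<in> Sp (Suc m)" using SpI[of "\<lambda>l. if l = m then 0 else f l" "Suc m"] by simp
  qed
  have b_Sp: "b m \<in> Sp (Suc m)" for m
  proof -
    have "b m = (\<lambda>x. \<Sum>l<Suc m. (if l = m then 1 else 0) * b l x)" by simp
    then show ?thesis using SpI[of "\<lambda>l. if l = m then 1 else 0" "Suc m"] by simp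
  qed
  have Sp_sum: "(\<lambda>x. \<Sum>i<n. c i * e i x) \<in> Sp m" if "\<And>i. i < n \<Longrightarrow> e i \<in> Sp m" for n m :: nat and c e
    using that
  proof (induction n)
    case 0
    then show ?case using SpI[of "\<lambda>_. 0" m] by simp
  next
    case (Suc n)
    then show ?case using Sp_lin[of "\<lambda>x. \<Sum>i<n. c i * e i x" m "e n" 1 "c n"] by simp
  qed
  have E_sum: "(\<lambda>x. \<Sum>i<n. c i * e i x) \<in> E" if "\<And>i. i < n \<Longrightarrow> e i \<in> E" for n :: nat and c e
    using that
  proof (induction n)
    case (Suc n)
    then show ?case using E(3)[of "\<lambda>x. \<Sum>i<n. c i * e i x" "e n" 1 "c n"] by simp
  qed (simp add: E)
  have "\<exists>e. (\<forall>i<m. e i \<in> E \<and> e i \<in> Sp m) \<and> (\<forall>i<m. \<forall>j<m. ip (e i) (e j) = (if i = j then 1 else 0)) \<and>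
     (\<forall>u\<in>V. (\<forall>i<m. ip u (e i) = 0) \<longrightarrow> (\<forall>l<m. ip u (b l) = 0))" if "m \<le> k" for m
    using that
  proof (induction m)
    case (Suc m)
    from Suc.IH[OF Suc_leD[OF Suc.prems]] obtain e
      where e0: "\<forall>i<m. e i \<in> E \<and> e i \<in> Sp m" "\<forall>i<m. \<forall>j<m. ip (e i) (e j) = (if i = j then 1 else 0)"
        "\<forall>u\<in>V. (\<forall>i<m. ip u (e i) = 0) \<longrightarrow> (\<forall>l<m. ip u (b l) = 0)"
      by (elim exE conjE)
    have e: "\<And>i. i < m \<Longrightarrow> e i \<in> E" "\<And>i. i < m \<Longrightarrow> e i \<in> Sp m"
      "\<And>i j. i < m \<Longrightarrow> j < m \<Longrightarrow> ip (e i) (e j) = (if i = j then 1 else 0)"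
      using e0 by blast+
    have e4: "ip u (b l) = 0" if "u \<in> V" "\<forall>i<m. ip u (e i) = 0" "l < m" for u l
      using e0(3) that by blast
    have m: "m < k" using Suc.prems by simp
    have eV: "e i \<in> V" if "i < m" for i using e(1)[OF that] E(1) by auto
    have bV: "b m \<in> V" using b[OF m] E(1) by auto
    define p where "p x = (\<Sum>i<m. ip (b m) (e i) * e i x)" for x
    have pS: "p \<in> Sp m" unfolding p_def[abs_def] by (rule Sp_sum) (rule e(2))
    have pE: "p \<in> E" unfolding p_def[abs_def] by (rule E_sum) (rule e(1))
    have pV: "p \<in> V" using pE E(1) by auto
    have ip_p: "ip p w = (\<Sum>i<m. ip (b m) (e i) * ip (e i) w)" if "w \<in> V" for w
      unfolding p_def[abs_def] using that eV by (intro ip_sum) auto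
    define w where "w x = 1 * b m x + (-1) * p x" for x
    have wE: "w \<in> E" using E(3)[OF b[OF m] pE, of 1 "-1"] by (simp add: w_def[abs_def])
    have wV: "w \<in> V" using wE E(1) by auto
    have wS: "w \<in> Sp (Suc m)"
      using Sp_lin[OF b_Sp subsetD[OF Sp_Suc pS], of 1 "-1"] by (simp add: w_def[abs_def])
    have ip_w: "ip w v = ip (b m) v - ip p v" if "v \<in> V" for v
      using ip_lin[OF bV pV that, of 1 "-1"] by (simp add: w_def[abs_def])
    have we: "ip w (e i) = 0" if "i < m" for i
      using that by (simp add: ip_w eV ip_p e(3) if_distrib[of "\<lambda>x. _ * x"] cong: if_cong)
    \<comment> \<open>A null residual would be a dependence among the \<open>b l\<close> with
      coefficient \<open>1\<close> at index \<open>m\<close>. Membership of \<open>p\<close> in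
      \<open>Sp m\<close>, the span of the earlier \<open>b l\<close>, supplies the other
      coefficients.\<close>
    have "ip w w \<noteq> 0"
    proof
      assume 0: "ip w w = 0"
      obtain f where f: "p = (\<lambda>x. \<Sum>l<m. f l * b l x)" using pS by (auto simp: Sp_def)
      define c where "c l = (if l = m then 1 else if l < m then - f l else 0)" for l
      have "(\<Sum>l<k. c l * b l x) = (\<Sum>l<Suc m. c l * b l x)" for x
        using m by (intro sum.mono_neutral_right) (auto simp: c_def)
      also have "(\<Sum>l<Suc m. c l * b l x) = w x" for x
        by (simp add: w_def f c_def sum_negf)
      finally have "(\<lambda>x. \<Sum>l<k. c l * b l x) = w" by (simp add: fun_eq_iff)
      then have "\<forall>i<k. c i = 0" using indep[of c] 0 by simp
      then have "c m = 0" using m by blast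
      then show False by (simp add: c_def)
    qed
    then have wpos: "0 < ip w w" using ip_nonneg[of w] by simp
    define q where "q = 1 / sqrt (ip w w)"
    have q: "q \<noteq> 0" "q\<^sup>2 * ip w w = 1" using wpos by (auto simp: q_def power_divide)
    define h where "h x = q * w x + 0 * w x" for x
    have hE: "h \<in> E" unfolding h_def[abs_def] by (rule E(3)[OF wE wE])
    have hS: "h \<in> Sp (Suc m)" unfolding h_def[abs_def] by (rule Sp_lin[OF wS wS])
    have ip_h: "ip h v = q * ip w v" if "v \<in> V" for v
      using ip_lin[OF wV wV that, of q 0] by (simp add: h_def[abs_def])
    have hh: "ip h h = 1"
      using ip_quad[OF wV wV, of q 0] q by (simp add: h_def[abs_def])
    define e' where "e' = e(m := h)"
    have "\<forall>i<Suc m. e' i \<in> E \<and> e' i \<in> Sp (Suc m)"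
      using e(1) hE hS subsetD[OF Sp_Suc e(2)] by (auto simp: e'_def less_Suc_eq)
    moreover have "\<forall>i<Suc m. \<forall>j<Suc m. ip (e' i) (e' j) = (if i = j then 1 else 0)"
    proof -
      have "ip h (e i) = 0" "ip (e i) h = 0" if "i < m" for i
        using that ip_h[OF eV] we by (simp_all add: ip_sym[of "e i" h])
      then show ?thesis using e(3) hh by (auto simp: e'_def less_Suc_eq)
    qed
    moreover have b0: "ip u (b l) = 0" if u: "u \<in> V" and 0: "\<forall>i<Suc m. ip u (e' i) = 0" and l: "l < Suc m" for u l
    proof (cases "l < m")
      case True
      have "ip u (e i) = 0" if "i < m" for i using 0 that by (auto simp: e'_def less_Suc_eq)
      then show ?thesis using e4[OF u _ True] by blast
    next
      case False
      then have l: "l = m" using l by simp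
      have ue: "ip (e i) u = 0" if "i < m" for i using 0 that ip_sym[of u "e i"] by (auto simp: e'_def less_Suc_eq)
      have "ip h u = 0" using 0 ip_sym[of u h] by (auto simp: e'_def)
      then have "ip w u = 0" using ip_h[OF u] q by simp
      then have "ip (b m) u = 0" using ip_w[OF u] ip_p[OF u] ue by simp
      then show ?thesis using l ip_sym[of u "b m"] by simp
    qed
    moreover have "\<forall>u\<in>V. (\<forall>i<Suc m. ip u (e' i) = 0) \<longrightarrow> (\<forall>l<Suc m. ip u (b l) = 0)"
      using b0 by blast
    ultimately show ?case by (intro exI[of _ e'] conjI)
  qed simp
  from this[OF order_refl] obtain e where e: "\<forall>i<k. e i \<in> E \<and> e i \<in> Sp k"
      "\<forall>i<k. \<forall>j<k. ip (e i) (e j) = (if i = j then 1 else 0)"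
      "\<forall>u\<in>V. (\<forall>i<k. ip u (e i) = 0) \<longrightarrow> (\<forall>l<k. ip u (b l) = 0)"
    by (elim exE conjE)
  show thesis
    by (rule that[of e]) (use e in blast)+
qed

end

section \<open>Eigenspaces of the fractional operator\<close>

context
  fixes \<Omega> :: "(real ^ 'n) set" and s :: real
  assumes \<Omega>o: "open \<Omega>" and \<Omega>b: "bounded \<Omega>" and s: "0 < s" "s < 1"
begin

text \<open>Members of the space vanish almost everywhere outside \<Omega>, so the integrals over
  \<Omega> in the operator's graph extend to the whole space, and the right-hand side
  \<open>\<mu> * u\<close> is square integrable on \<Omega>.\<close>

lemma eigenspace_iff:
  "u \<in> eigenspace_A s \<Omega> \<mu> \<longleftrightarrow> u \<in> sobolev_H0 s \<Omega> \<and> (\<forall>v\<in>sobolev_H0 s \<Omega>. energy s u v = \<mu> * ip_L2 u v)"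
proof (cases "u \<in> sobolev_H0 s \<Omega>")
  case True
  note [measurable] = H0_measurable[OF True] domain_measurable[OF \<Omega>o \<Omega>b s]
  have "(\<lambda>x. \<mu> * u x) \<in> L2_on \<Omega>"
    unfolding L2_on_def set_borel_measurable_def set_integrable_def
  proof (intro CollectI conjI)
    have "integrable lborel (\<lambda>x. indicator \<Omega> x *\<^sub>R (\<mu>\<^sup>2 * (u x)\<^sup>2))"
      using H0_square[OF True] by (intro integrable_mult_indicator) auto
    then show "integrable lborel (\<lambda>x. indicat_real \<Omega> x *\<^sub>R (\<mu> * u x)\<^sup>2)" by (simp add: power_mult_distrib)
  qed measurable
  moreover have "(LINT x:\<Omega>|lborel. \<mu> * u x * v x) = \<mu> * ip_L2 u v" if "v \<in> sobolev_H0 s \<Omega>" for v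
    using form_a_eq_energy(1)[OF \<Omega>o True that] by (simp add: mult.assoc)
  ultimately show ?thesis
    using True form_a_eq_energy(2)[OF \<Omega>o True] by (auto simp: eigenspace_A_def op_A_graph_def)
qed (auto simp: eigenspace_A_def op_A_graph_def)

lemma ip_L2_self_eq_0:
  assumes "u \<in> sobolev_H0 s \<Omega>"
  shows "ip_L2 u u = 0 \<longleftrightarrow> (AE x\<in>\<Omega> in lborel. u x = 0)"
proof -
  have "ip_L2 u u = 0 \<longleftrightarrow> (AE x in lborel. (u x)\<^sup>2 = 0)"
    using H0_square[OF assms] by (simp add: ip_L2_def power2_eq_square[symmetric] integral_nonneg_eq_0_iff_AE)
  also have "\<dots> \<longleftrightarrow> (AE x\<in>\<Omega> in lborel. u x = 0)"
  proof
    assume "AE x\<in>\<Omega> in lborel. u x = 0"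
    with H0_vanish[OF assms] show "AE x in lborel. (u x)\<^sup>2 = 0" by eventually_elim auto
  qed (auto elim: eventually_mono)
  finally show ?thesis .
qed

text \<open>A basis modulo null sets is orthonormalised. An eigenfunction orthogonal to the result
  is orthogonal to the original basis, in which it can be expanded, hence to itself.\<close>

lemma eigenspace_orthonormal_basis:
  assumes "has_L2_dim \<Omega> (eigenspace_A s \<Omega> \<mu>) k"
  obtains e :: "nat \<Rightarrow> real ^ 'n \<Rightarrow> real" where "\<And>i. i < k \<Longrightarrow> e i \<in> eigenspace_A s \<Omega> \<mu>"
    "\<And>i j. i < k \<Longrightarrow> j < k \<Longrightarrow> ip_L2 (e i) (e j) = (if i = j then 1 else 0)"
    "\<And>u. u \<in> eigenspace_A s \<Omega> \<mu> \<Longrightarrow> (\<And>i. i < k \<Longrightarrow> ip_L2 u (e i) = 0) \<Longrightarrow> ip_L2 u u = 0"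
proof -
  interpret form_pair "sobolev_H0 s \<Omega>" ip_L2 "energy s" by (rule form_pair_H0[OF \<Omega>o \<Omega>b s])
  let ?E = "eigenspace_A s \<Omega> \<mu>"
  obtain b where b: "\<And>i. i < k \<Longrightarrow> b i \<in> ?E"
    and ind: "\<And>c. (AE x\<in>\<Omega> in lborel. (\<Sum>i<k. c i * b i x) = 0) \<Longrightarrow> \<forall>i<k. c i = 0"
    and span: "\<And>u. u \<in> ?E \<Longrightarrow> \<exists>c. AE x\<in>\<Omega> in lborel. u x = (\<Sum>i<k. c i * b i x)"
    using assms unfolding has_L2_dim_def by blast
  have EV: "?E \<subseteq> sobolev_H0 s \<Omega>" by (auto simp: eigenspace_iff)
  have E0: "(\<lambda>x. 0) \<in> ?E" by (simp add: eigenspace_iff zero ip_zero a_zero)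
  have El: "(\<lambda>x. c * u x + d * v x) \<in> ?E" if "u \<in> ?E" "v \<in> ?E" for u v c d
    using that by (auto simp: eigenspace_iff lin ip_lin a_lin algebra_simps)
  have bV: "b i \<in> sobolev_H0 s \<Omega>" if "i < k" for i using b[OF that] EV by auto
  have sumV: "(\<lambda>x. \<Sum>i<k. c i * b i x) \<in> sobolev_H0 s \<Omega>" for c
    using bV by (intro sum_mem) auto
  have ind': "\<forall>i<k. c i = 0" if "ip_L2 (\<lambda>x. \<Sum>i<k. c i * b i x) (\<lambda>x. \<Sum>i<k. c i * b i x) = 0" for c
    by (rule ind) (use that in \<open>simp only: ip_L2_self_eq_0[OF sumV]\<close>)
  obtain e where e: "\<forall>i<k. e i \<in> ?E"
    "\<forall>i<k. \<forall>j<k. ip_L2 (e i) (e j) = (if i = j then 1 else 0)"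
    "\<forall>u\<in>sobolev_H0 s \<Omega>. (\<forall>i<k. ip_L2 u (e i) = 0) \<longrightarrow> (\<forall>l<k. ip_L2 u (b l) = 0)"
    by (rule gram_schmidt[of ?E k b, OF EV E0 El b ind'])
  show thesis
  proof (rule that[of e])
    fix u assume u: "u \<in> ?E" and 0: "\<And>i. i < k \<Longrightarrow> ip_L2 u (e i) = 0"
    have uV: "u \<in> sobolev_H0 s \<Omega>" using u EV by auto
    obtain c where c: "AE x\<in>\<Omega> in lborel. u x = (\<Sum>i<k. c i * b i x)" using span[OF u] by blast
    note [measurable] = H0_measurable[OF uV] H0_measurable[OF sumV]
    have "ip_L2 u u = ip_L2 (\<lambda>x. \<Sum>i<k. c i * b i x) u"
      unfolding ip_L2_def
    proof (rule integral_cong_AE)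
      show "AE x in lborel. u x * u x = (\<Sum>i<k. c i * b i x) * u x"
        using c H0_vanish[OF uV] by eventually_elim auto
    qed auto
    also have "\<dots> = (\<Sum>i<k. c i * ip_L2 (b i) u)"
      using bV uV by (intro ip_sum) auto
    also have "\<dots> = 0"
      using e(3) uV 0 by (intro sum.neutral) (simp add: ip_sym[of "b _" u])
    finally show "ip_L2 u u = 0" .
  qed (use e in auto)
qed

text \<open>For each value \<mu>, a bijection numbers the indices \<open>j\<close> with
  \<open>ev j = \<mu>\<close> by an orthonormal basis of that eigenspace. Different eigenvalues are
  orthogonal by symmetry of the form. The last property covers every real \<open>m\<close>: if no
  \<open>ev j\<close> equals \<open>m\<close>, it says that \<open>m\<close> has only null
  eigenfunctions.\<close>

lemma eigenbasis:
  fixes ev :: "nat \<Rightarrow> real"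
  assumes "eigenvalue_sequence_A s \<Omega> ev"
  obtains e :: "nat \<Rightarrow> real ^ 'n \<Rightarrow> real" where "\<And>j. e j \<in> sobolev_H0 s \<Omega>"
    "\<And>j v. v \<in> sobolev_H0 s \<Omega> \<Longrightarrow> energy s (e j) v = ev j * ip_L2 (e j) v"
    "\<And>i j. ip_L2 (e i) (e j) = (if i = j then 1 else 0)"
    "\<And>u m. u \<in> sobolev_H0 s \<Omega> \<Longrightarrow> (\<And>v. v \<in> sobolev_H0 s \<Omega> \<Longrightarrow> energy s u v = m * ip_L2 u v) \<Longrightarrow>
      (\<And>j. ev j = m \<Longrightarrow> ip_L2 u (e j) = 0) \<Longrightarrow> ip_L2 u u = 0"
proof -
  let ?J = "\<lambda>\<mu>. {j. ev j = \<mu>}"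
  have fin: "finite (?J \<mu>)" and dim: "has_L2_dim \<Omega> (eigenspace_A s \<Omega> \<mu>) (card (?J \<mu>))" for \<mu>
    using assms by (auto simp: eigenvalue_sequence_A_def)
  define P where "P \<mu> e \<longleftrightarrow> (\<forall>i<card (?J \<mu>). e i \<in> eigenspace_A s \<Omega> \<mu>) \<and>
    (\<forall>i<card (?J \<mu>). \<forall>j<card (?J \<mu>). ip_L2 (e i) (e j) = (if i = j then 1 else 0)) \<and>
    (\<forall>u\<in>eigenspace_A s \<Omega> \<mu>. (\<forall>i<card (?J \<mu>). ip_L2 u (e i) = 0) \<longrightarrow> ip_L2 u u = 0)"
    for \<mu> and e :: "nat \<Rightarrow> real ^ 'n \<Rightarrow> real"
  have "\<exists>e. P \<mu> e" for \<mu>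
    by (rule eigenspace_orthonormal_basis[OF dim[of \<mu>]], unfold P_def) blast
  then obtain E where EP: "\<And>\<mu>. P \<mu> (E \<mu>)" by metis
  have E: "\<And>\<mu> i. i < card (?J \<mu>) \<Longrightarrow> E \<mu> i \<in> eigenspace_A s \<Omega> \<mu>"
    "\<And>\<mu> i j. i < card (?J \<mu>) \<Longrightarrow> j < card (?J \<mu>) \<Longrightarrow> ip_L2 (E \<mu> i) (E \<mu> j) = (if i = j then 1 else 0)"
    "\<And>\<mu> u. u \<in> eigenspace_A s \<Omega> \<mu> \<Longrightarrow> (\<forall>i<card (?J \<mu>). ip_L2 u (E \<mu> i) = 0) \<Longrightarrow> ip_L2 u u = 0"
    using EP unfolding P_def by blast+
  have "\<exists>h. bij_betw h (?J \<mu>) {0..<card (?J \<mu>)}" for \<mu>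
    by (rule ex_bij_betw_finite_nat[OF fin])
  then obtain h where h: "\<And>\<mu>. bij_betw (h \<mu>) (?J \<mu>) {0..<card (?J \<mu>)}" by metis
  have hl: "h (ev j) j < card (?J (ev j))" for j
    using bij_betwE[OF h[of "ev j"]] by auto
  define e where "e j = E (ev j) (h (ev j) j)" for j
  have eE: "e j \<in> eigenspace_A s \<Omega> (ev j)" for j unfolding e_def by (rule E(1)[OF hl])
  have eV: "e j \<in> sobolev_H0 s \<Omega>" for j using eE[of j] by (simp add: eigenspace_iff)
  have ee: "energy s (e j) v = ev j * ip_L2 (e j) v" if "v \<in> sobolev_H0 s \<Omega>" for j v
    using eE[of j] that by (simp add: eigenspace_iff)
  show thesis
  proof (rule that[OF eV ee])
    fix i j
    show "ip_L2 (e i) (e j) = (if i = j then 1 else 0)"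
    proof (cases "ev i = ev j")
      case True
      have "h (ev i) i = h (ev i) j \<longleftrightarrow> i = j"
        using bij_betw_imp_inj_on[OF h[of "ev i"]] True by (auto simp: inj_on_def)
      then show ?thesis using E(2)[OF hl[of i], of "h (ev j) j"] hl[of j] True by (simp add: e_def)
    next
      case False
      have "ev i * ip_L2 (e i) (e j) = energy s (e i) (e j)" by (rule ee[OF eV, symmetric])
      also have "\<dots> = energy s (e j) (e i)" by (rule energy_sym)
      also have "\<dots> = ev j * ip_L2 (e j) (e i)" by (rule ee[OF eV])
      also have "ip_L2 (e j) (e i) = ip_L2 (e i) (e j)" by (rule ip_L2_sym)
      finally have "ev i * ip_L2 (e i) (e j) = ev j * ip_L2 (e i) (e j)" .
      then show ?thesis using False by auto
    qed
  next
    fix u m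
    assume u: "u \<in> sobolev_H0 s \<Omega>" "\<And>v. v \<in> sobolev_H0 s \<Omega> \<Longrightarrow> energy s u v = m * ip_L2 u v"
      and 0: "\<And>j. ev j = m \<Longrightarrow> ip_L2 u (e j) = 0"
    have "u \<in> eigenspace_A s \<Omega> m" using u by (simp add: eigenspace_iff)
    then show "ip_L2 u u = 0"
    proof (rule E(3), intro allI impI)
      fix i assume "i < card (?J m)"
      then obtain j where "j \<in> ?J m" "h m j = i"
        using bij_betw_imp_surj_on[OF h[of m]] by (metis atLeastLessThan_iff imageE zero_le)
      then show "ip_L2 u (E m i) = 0" using 0[of j] by (simp add: e_def)
    qed
  qed (simp_all)
qed

end

section \<open>Bounds for the Riesz means\<close>

lemma symbol_sublevel:
  assumes "0 < s" "0 < \<Lambda>"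
  shows "norm (\<xi>::'a::euclidean_space) powr (2 * s) \<le> \<Lambda> \<longleftrightarrow> \<xi> \<in> cball 0 (\<Lambda> powr (1 / (2 * s)))"
proof -
  have 1: "(norm \<xi> powr (2 * s)) powr (1 / (2 * s)) = norm \<xi>"
    using assms by (cases "\<xi> = 0") (auto simp: powr_powr)
  have 2: "(\<Lambda> powr (1 / (2 * s))) powr (2 * s) = \<Lambda>"
    using assms by (simp add: powr_powr)
  have "norm \<xi> powr (2 * s) \<le> \<Lambda> \<Longrightarrow> norm \<xi> \<le> \<Lambda> powr (1 / (2 * s))"
    using powr_mono2[of "1 / (2 * s)" "norm \<xi> powr (2 * s)" \<Lambda>] assms 1 by simp
  moreover have "norm \<xi> \<le> \<Lambda> powr (1 / (2 * s)) \<Longrightarrow> norm \<xi> powr (2 * s) \<le> \<Lambda>"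
    using powr_mono2[of "2 * s" "norm \<xi>" "\<Lambda> powr (1 / (2 * s))"] assms 2 by simp
  ultimately show ?thesis by auto
qed

lemma measure_symbol_sublevel:
  assumes "0 < s" "0 < \<Lambda>"
  shows "emeasure lborel {\<xi>::'a::euclidean_space. norm \<xi> powr (2 * s) \<le> \<Lambda>}
    = ennreal (measure lborel (ball (0::'a) 1) * \<Lambda> powr (DIM('a) / (2 * s)))"
proof -
  have 1: "{\<xi>::'a. norm \<xi> powr (2 * s) \<le> \<Lambda>} = cball 0 (\<Lambda> powr (1 / (2 * s)))"
    by (intro set_eqI) (simp only: mem_Collect_eq symbol_sublevel[OF assms])
  have 2: "(\<Lambda> powr (1 / (2 * s))) ^ DIM('a) = \<Lambda> powr (DIM('a) / (2 * s))"
    by (subst powr_power) (use assms in auto)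
  show ?thesis
    unfolding 1 by (subst emeasure_cball) (simp_all add: 2 content_ball)
qed

text \<open>Layer-cake formula: the integrand is the length of the interval of those \<tau> from the
  symbol up to \<Lambda>. The sublevel sets are balls with volume a multiple of
  \<open>\<tau> powr p\<close> for \<open>p = N / (2 * s)\<close>, which is then integrated from
  \<open>0\<close> to \<Lambda>.\<close>

lemma phase_space_integral:
  fixes \<Lambda> s :: real
  assumes "0 < s" "0 < \<Lambda>"
  shows "has_bochner_integral lborel (\<lambda>\<xi>::'a::euclidean_space. max 0 (\<Lambda> - norm \<xi> powr (2 * s)))
    (measure lborel (ball (0::'a) 1) * \<Lambda> powr (DIM('a) / (2 * s) + 1) / (DIM('a) / (2 * s) + 1))"
proof -
  let ?p = "DIM('a) / (2 * s)" and ?\<omega> = "measure lborel (ball (0::'a) 1)"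
  have p: "0 < ?p" using assms by simp
  then have pm: "-1 < ?p" by linarith
  let ?i = "\<lambda>(\<xi>::'a) \<tau>. indicator {0..\<Lambda>} \<tau> * (if norm \<xi> powr (2 * s) \<le> \<tau> then 1 else 0) :: ennreal"
  have "(\<integral>\<^sup>+\<xi>. ennreal (max 0 (\<Lambda> - norm (\<xi>::'a) powr (2 * s))) \<partial>lborel)
    = (\<integral>\<^sup>+\<tau>. ennreal (indicator {0..\<Lambda>} \<tau> * (?\<omega> * \<tau> powr ?p)) \<partial>lborel)"
  proof (rule nn_integral_swap[where f = ?i])
    show "AE \<xi>::'a in lborel. (\<integral>\<^sup>+\<tau>. ?i \<xi> \<tau> \<partial>lborel) = ennreal (max 0 (\<Lambda> - norm \<xi> powr (2 * s)))"
    proof (rule AE_I2)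
      fix \<xi> :: 'a
      let ?r = "norm \<xi> powr (2 * s)"
      have "(\<integral>\<^sup>+\<tau>. ?i \<xi> \<tau> \<partial>lborel) = (\<integral>\<^sup>+\<tau>. indicator {?r..\<Lambda>} \<tau> \<partial>lborel)"
        by (intro nn_integral_cong) (auto split: split_indicator intro: order_trans[OF powr_ge_zero])
      also have "\<dots> = ennreal (max 0 (\<Lambda> - ?r))" by (auto simp: max_def emeasure_lborel_Icc_eq)
      finally show "(\<integral>\<^sup>+\<tau>. ?i \<xi> \<tau> \<partial>lborel) = ennreal (max 0 (\<Lambda> - ?r))" .
    qed
    show "AE \<tau> in lborel. (\<integral>\<^sup>+\<xi>. ?i \<xi> \<tau> \<partial>lborel) = ennreal (indicator {0..\<Lambda>} \<tau> * (?\<omega> * \<tau> powr ?p))"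
      using AE_lborel_neq[of "0::real"]
    proof eventually_elim
      case (elim \<tau>)
      show ?case
      proof (cases "0 < \<tau> \<and> \<tau> \<le> \<Lambda>")
        case True
        have "(\<integral>\<^sup>+\<xi>. ?i \<xi> \<tau> \<partial>lborel) = (\<integral>\<^sup>+\<xi>. indicator {\<xi>::'a. norm \<xi> powr (2 * s) \<le> \<tau>} \<xi> \<partial>lborel)"
          using True by (intro nn_integral_cong) (auto split: split_indicator)
        also have "\<dots> = emeasure lborel {\<xi>::'a. norm \<xi> powr (2 * s) \<le> \<tau>}"
          by (rule nn_integral_indicator) measurable
        also have "\<dots> = ennreal (?\<omega> * \<tau> powr ?p)"
          using measure_symbol_sublevel[OF assms(1), of \<tau>, where 'a='a] True by simp
        finally show ?thesis using True by simp
      qed (use elim in \<open>auto split: split_indicator\<close>)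
    qed
  qed measurable
  also have "\<dots> = ennreal (?\<omega> * (\<Lambda> powr (?p + 1) / (?p + 1)))"
  proof (rule nn_integral_has_integral_lebesgue)
    show "((\<lambda>\<tau>. ?\<omega> * \<tau> powr ?p) has_integral ?\<omega> * (\<Lambda> powr (?p + 1) / (?p + 1))) {0..\<Lambda>}"
      by (intro has_integral_mult_right has_integral_powr_from_0 pm less_imp_le assms)
  qed auto
  finally show ?thesis
    using assms p by (subst has_bochner_integral_iff, subst nn_integral_eq_integrable[symmetric]) (auto intro!: mult_nonneg_nonneg divide_nonneg_nonneg)
qed

text \<open>With both forms equal, every finite orthonormal family is an eigenfamily with eigenvalue
  \<open>1\<close>. This makes Bessel's inequality available for waves cut off sharply at the
  boundary of the domain.\<close>

lemma L2_form_pair: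
  "form_pair {u :: 'a::euclidean_space \<Rightarrow> real. u \<in> borel_measurable borel \<and> integrable lborel (\<lambda>x. (u x)\<^sup>2)} ip_L2 ip_L2"
proof
  fix u v w :: "'a \<Rightarrow> real" and c d
  assume u: "u \<in> {u. u \<in> borel_measurable borel \<and> integrable lborel (\<lambda>x. (u x)\<^sup>2)}"
    and v: "v \<in> {u. u \<in> borel_measurable borel \<and> integrable lborel (\<lambda>x. (u x)\<^sup>2)}"
  show "(\<lambda>x. c * u x + d * v x) \<in> {u. u \<in> borel_measurable borel \<and> integrable lborel (\<lambda>x. (u x)\<^sup>2)}"
    using u v integrable_square_lincomb[of u lborel v c d] by auto
  assume w: "w \<in> {u. u \<in> borel_measurable borel \<and> integrable lborel (\<lambda>x. (u x)\<^sup>2)}"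
  show "ip_L2 (\<lambda>x. c * u x + d * v x) w = c * ip_L2 u w + d * ip_L2 v w"
    using u v w integrable_mult_L2[of u lborel w] integrable_mult_L2[of v lborel w]
    by (simp add: ip_L2_def distrib_right mult.assoc)
qed (auto simp: ip_L2_sym ip_L2_nonneg)

section \<open>The Berezin-Li-Yau upper bound\<close>

context
  fixes \<Omega> :: "(real ^ 'n) set" and s :: real
  assumes \<Omega>o: "open \<Omega>" and \<Omega>b: "bounded \<Omega>" and s: "0 < s" "s < 1"
begin

lemma domain_measurable' [measurable]: "\<Omega> \<in> sets borel"
  using \<Omega>o by simp

lemma symbol_fourier:
  assumes u: "u \<in> sobolev_H0 s \<Omega>"
  shows "integrable lborel (fourier_sq u)" "integrable lborel (\<lambda>\<xi>. norm \<xi> powr (2 * s) * fourier_sq u \<xi>)"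
    "(2 * pi) powr (- real CARD('n)) * (LINT \<xi>|lborel. fourier_sq u \<xi>) = ip_L2 u u"
    "(2 * pi) powr (- real CARD('n)) * (LINT \<xi>|lborel. norm \<xi> powr (2 * s) * fourier_sq u \<xi>)
      = frac_laplacian_const CARD('n) s / 2 * gagliardo s u"
proof -
  have u1: "integrable lborel u" using H0_integrable[OF \<Omega>o \<Omega>b s u] .
  have u2: "integrable lborel (\<lambda>x. (u x)\<^sup>2)" using H0_square[OF u] .
  have uH: "integrable (lborel \<Otimes>\<^sub>M lborel) (\<lambda>(x, y). (u x - u y)\<^sup>2 / norm (x - y) powr (real DIM(real^'n) + 2 * s))"
    using H0_diff_quot[OF u] by (simp add: diff_quot_square)
  note [measurable] = H0_measurable[OF u]
  let ?C = "frac_laplacian_const CARD('n) s" and ?K = "(2 * pi) powr (- real CARD('n))"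
  have C: "0 < ?C" using s by (rule frac_laplacian_const_pos)
  have K: "0 < ?K" by simp
  show "integrable lborel (fourier_sq u)" by (rule fourier_sq_integrable[OF u1 u2 s uH])
  show "?K * (LINT \<xi>|lborel. fourier_sq u \<xi>) = ip_L2 u u"
    using plancherel_real[OF u1 u2 s uH] by (simp add: ip_L2_def power2_eq_square)
  have g: "ennreal (?C / 2 * gagliardo s u) = ennreal ?K * (\<integral>\<^sup>+\<xi>. ennreal (norm \<xi> powr (2 * s) * fourier_sq u \<xi>) \<partial>lborel)"
    using gagliardo_fourier[OF u1 u2 s uH] by simp
  show "integrable lborel (\<lambda>\<xi>. norm \<xi> powr (2 * s) * fourier_sq u \<xi>)"
    "?K * (LINT \<xi>|lborel. norm \<xi> powr (2 * s) * fourier_sq u \<xi>) = ?C / 2 * gagliardo s u"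
    using nn_integral_cmult_eqD[OF _ _ K _ g[symmetric]] C gagliardo_nonneg[of s u] by auto
qed

text \<open>Bessel's inequality is used for the cosine and the sine separately, both restricted to
  \<Omega>; the two bounds add up to the volume since the squares sum to \<open>1\<close>.\<close>

lemma fourier_sq_sum_le:
  assumes F: "finite F" and e: "\<And>j. j \<in> F \<Longrightarrow> e j \<in> sobolev_H0 s \<Omega>"
    and orth: "\<And>i j. i \<in> F \<Longrightarrow> j \<in> F \<Longrightarrow> ip_L2 (e i) (e j) = (if i = j then 1 else 0)"
  shows "(\<Sum>j\<in>F. fourier_sq (e j) \<xi>) \<le> measure lborel \<Omega>"
proof -
  let ?V = "{u :: real^'n \<Rightarrow> real. u \<in> borel_measurable borel \<and> integrable lborel (\<lambda>x. (u x)\<^sup>2)}"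
  interpret L2: form_pair ?V ip_L2 ip_L2 by (rule L2_form_pair)
  have ef: "L2.eigenfamily F e (\<lambda>_. 1)"
    using F e orth by (auto simp: L2.eigenfamily_def H0_measurable[OF e] H0_square[OF e])
  have B: "(\<Sum>j\<in>F. (LINT x|lborel. e j x * g x)\<^sup>2) \<le> (LINT x|lborel. indicator \<Omega> x * (g x)\<^sup>2)"
    if g: "g \<in> borel_measurable borel" "\<And>x. \<bar>g x\<bar> \<le> 1" for g
  proof -
    note [measurable] = g(1)
    let ?f = "\<lambda>x. indicat_real \<Omega> x * g x"
    have sq: "(?f x)\<^sup>2 = indicator \<Omega> x * (g x)\<^sup>2" for x by (auto split: split_indicator)
    have "integrable lborel (\<lambda>x. indicat_real \<Omega> x * (g x)\<^sup>2)"
      using g(2) by (intro integrable_mult_bounded_real[where B=1] domain_indicator_integrable[OF \<Omega>o \<Omega>b s])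
         (auto simp: abs_square_le_1)
    then have fV: "?f \<in> ?V" by (simp add: sq)
    have "ip_L2 ?f (e j) = (LINT x|lborel. e j x * g x)" if "j \<in> F" for j
      unfolding ip_L2_def
    proof (rule integral_cong_AE)
      show "AE x in lborel. indicat_real \<Omega> x * g x * e j x = e j x * g x"
        using H0_vanish[OF e[OF that]] by eventually_elim (auto split: split_indicator)
    qed (use H0_measurable[OF e[OF that]] in measurable)
    then have "(\<Sum>j\<in>F. (LINT x|lborel. e j x * g x)\<^sup>2) = (\<Sum>j\<in>F. (ip_L2 ?f (e j))\<^sup>2)" by simp
    also have "\<dots> \<le> ip_L2 ?f ?f" by (rule L2.bessel[OF ef fV])
    also have "\<dots> = (LINT x|lborel. indicator \<Omega> x * (g x)\<^sup>2)"
      unfolding ip_L2_def power2_eq_square[symmetric] sq ..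
    finally show ?thesis .
  qed
  have i: "integrable lborel (\<lambda>x. indicat_real \<Omega> x * (g x)\<^sup>2)" if "g \<in> borel_measurable borel" "\<And>x. \<bar>g x\<bar> \<le> 1" for g
    using that by (intro integrable_mult_bounded_real[where B=1] domain_indicator_integrable[OF \<Omega>o \<Omega>b s])
       (auto simp: abs_square_le_1)
  have "(\<Sum>j\<in>F. fourier_sq (e j) \<xi>) \<le> (LINT x|lborel. indicator \<Omega> x * (cos (\<xi> \<bullet> x))\<^sup>2) + (LINT x|lborel. indicator \<Omega> x * (sin (\<xi> \<bullet> x))\<^sup>2)"
    unfolding fourier_sq_def sum.distrib by (intro add_mono B) auto
  also have "\<dots> = (LINT x|lborel. indicator \<Omega> x * (cos (\<xi> \<bullet> x))\<^sup>2 + indicator \<Omega> x * (sin (\<xi> \<bullet> x))\<^sup>2)"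
    by (intro Bochner_Integration.integral_add[symmetric] i) auto
  also have "\<dots> = (LINT x|lborel. indicator \<Omega> x)"
    by (simp add: distrib_left[symmetric])
  also have "\<dots> = measure lborel \<Omega>" by simp
  finally show ?thesis .
qed

text \<open>Each difference \<open>\<Lambda> - \<mu> j\<close> is an average of
  \<open>\<Lambda> - 1 - norm \<xi> powr (2 * s)\<close> against the Fourier density of
  \<open>e j\<close>. Only the positive part is kept, and the total density at each frequency is at
  most the volume.\<close>

lemma riesz_mean_upper:
  assumes F: "finite F" and e: "\<And>j. j \<in> F \<Longrightarrow> e j \<in> sobolev_H0 s \<Omega>"
    and orth: "\<And>i j. i \<in> F \<Longrightarrow> j \<in> F \<Longrightarrow> ip_L2 (e i) (e j) = (if i = j then 1 else 0)"
    and eig: "\<And>j. j \<in> F \<Longrightarrow> energy s (e j) (e j) = \<mu> j" and \<Lambda>: "0 < \<Lambda>"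
  shows "(\<Sum>j\<in>F. \<Lambda> - \<mu> j) \<le> (2 * pi) powr (- real CARD('n)) * measure lborel \<Omega> *
    (measure lborel (ball (0::real^'n) 1) * \<Lambda> powr (CARD('n) / (2 * s) + 1) / (CARD('n) / (2 * s) + 1))"
proof -
  let ?K = "(2 * pi) powr (- real CARD('n))" and ?C = "frac_laplacian_const CARD('n) s"
  have one: "\<Lambda> - \<mu> j = ?K * (LINT \<xi>|lborel. (\<Lambda> - 1 - norm \<xi> powr (2 * s)) * fourier_sq (e j) \<xi>)"
    and int: "integrable lborel (\<lambda>\<xi>. (\<Lambda> - 1 - norm \<xi> powr (2 * s)) * fourier_sq (e j) \<xi>)" if "j \<in> F" for j
  proof -
    note sf = symbol_fourier[OF e[OF that]]
    have eq: "(\<lambda>\<xi>. (\<Lambda> - 1 - norm \<xi> powr (2 * s)) * fourier_sq (e j) \<xi>)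
      = (\<lambda>\<xi>. (\<Lambda> - 1) * fourier_sq (e j) \<xi> - norm \<xi> powr (2 * s) * fourier_sq (e j) \<xi>)"
      by (simp add: algebra_simps)
    show "integrable lborel (\<lambda>\<xi>. (\<Lambda> - 1 - norm \<xi> powr (2 * s)) * fourier_sq (e j) \<xi>)"
      unfolding eq using sf(1,2) by simp
    have "?K * (LINT \<xi>|lborel. (\<Lambda> - 1 - norm \<xi> powr (2 * s)) * fourier_sq (e j) \<xi>)
      = (\<Lambda> - 1) * (?K * (LINT \<xi>|lborel. fourier_sq (e j) \<xi>)) - ?K * (LINT \<xi>|lborel. norm \<xi> powr (2 * s) * fourier_sq (e j) \<xi>)"
      unfolding eq using sf(1,2) by (simp add: right_diff_distrib)
    also have "\<dots> = (\<Lambda> - 1) - ?C / 2 * gagliardo s (e j)"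
      unfolding sf(3,4) using orth[OF that that] by simp
    also have "\<dots> = \<Lambda> - \<mu> j"
      using eig[OF that] orth[OF that that] by (simp add: energy_self)
    finally show "\<Lambda> - \<mu> j = ?K * (LINT \<xi>|lborel. (\<Lambda> - 1 - norm \<xi> powr (2 * s)) * fourier_sq (e j) \<xi>)" ..
  qed
  have ph: "has_bochner_integral lborel (\<lambda>\<xi>::real^'n. max 0 (\<Lambda> - norm \<xi> powr (2 * s)))
    (measure lborel (ball (0::real^'n) 1) * \<Lambda> powr (CARD('n) / (2 * s) + 1) / (CARD('n) / (2 * s) + 1))"
    using phase_space_integral[OF s(1) \<Lambda>, where 'a="real^'n"] by simp
  have "(\<Sum>j\<in>F. \<Lambda> - \<mu> j) = ?K * (LINT \<xi>|lborel. (\<Sum>j\<in>F. (\<Lambda> - 1 - norm \<xi> powr (2 * s)) * fourier_sq (e j) \<xi>))"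
    using one int by (simp add: sum_distrib_left)
  also have "\<dots> \<le> ?K * (LINT \<xi>|lborel. max 0 (\<Lambda> - norm (\<xi>::real^'n) powr (2 * s)) * measure lborel \<Omega>)"
  proof (intro mult_left_mono integral_mono)
    show "integrable lborel (\<lambda>\<xi>. \<Sum>j\<in>F. (\<Lambda> - 1 - norm \<xi> powr (2 * s)) * fourier_sq (e j) \<xi>)"
      using int by simp
    show "integrable lborel (\<lambda>\<xi>::real^'n. max 0 (\<Lambda> - norm \<xi> powr (2 * s)) * measure lborel \<Omega>)"
      using ph by (simp add: has_bochner_integral_iff)
    fix \<xi> :: "real ^ 'n"
    have S: "0 \<le> (\<Sum>j\<in>F. fourier_sq (e j) \<xi>)" by (simp add: sum_nonneg)
    have "(\<Sum>j\<in>F. (\<Lambda> - 1 - norm \<xi> powr (2 * s)) * fourier_sq (e j) \<xi>) = (\<Lambda> - 1 - norm \<xi> powr (2 * s)) * (\<Sum>j\<in>F. fourier_sq (e j) \<xi>)"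
      by (simp add: sum_distrib_left)
    \<comment> \<open>Omitting the shift \<open>1\<close> and passing to the positive part both
      enlarge the factor, whose weight is nonnegative.\<close>
    also have "\<dots> \<le> max 0 (\<Lambda> - norm \<xi> powr (2 * s)) * (\<Sum>j\<in>F. fourier_sq (e j) \<xi>)"
      using S by (intro mult_right_mono) auto
    also have "\<dots> \<le> max 0 (\<Lambda> - norm \<xi> powr (2 * s)) * measure lborel \<Omega>"
      using fourier_sq_sum_le[OF F e orth] by (intro mult_left_mono) auto
    finally show "(\<Sum>j\<in>F. (\<Lambda> - 1 - norm \<xi> powr (2 * s)) * fourier_sq (e j) \<xi>) \<le> max 0 (\<Lambda> - norm \<xi> powr (2 * s)) * measure lborel \<Omega>" .
  qed simp
  also have "\<dots> = ?K * measure lborel \<Omega> * (measure lborel (ball (0::real^'n) 1) * \<Lambda> powr (CARD('n) / (2 * s) + 1) / (CARD('n) / (2 * s) + 1))"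
    using ph by (simp add: has_bochner_integral_iff)
  finally show ?thesis .
qed

end

section \<open>Coherent states and the lower bound\<close>

lemma symbol_kernel_integrable:
  fixes \<xi> :: "'a::euclidean_space" and s :: real
  assumes "0 < s" "s < 1"
  shows "has_bochner_integral lborel (\<lambda>h. (1 - cos (\<xi> \<bullet> h)) / norm h powr (real DIM('a) + 2 * s))
    (norm \<xi> powr (2 * s) / frac_laplacian_const DIM('a) s)"
  unfolding has_bochner_integral_iff
  using nn_integral_symbol[OF assms, of \<xi>] frac_laplacian_const_pos[OF assms, of "DIM('a)"]
  by (subst nn_integral_eq_integrable[symmetric]) (auto intro!: divide_nonneg_nonneg)

text \<open>These are the two terms that arise when \<open>2 * \<phi> x * \<phi> y\<close> is
  estimated by the sum of squares in the energy of a modulated function. The second follows from the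
  first by exchanging \<open>x\<close> and \<open>y\<close>.\<close>

lemma symbol_kernel_pair:
  fixes \<phi> :: "'a::euclidean_space \<Rightarrow> real" and s :: real
  assumes s: "0 < s" "s < 1" and \<phi>: "integrable lborel (\<lambda>x. (\<phi> x)\<^sup>2)"
  shows "has_bochner_integral (lborel \<Otimes>\<^sub>M lborel)
      (\<lambda>(x, y). (\<phi> x)\<^sup>2 * ((1 - cos (\<xi> \<bullet> (x - y))) / norm (x - y) powr (real DIM('a) + 2 * s)))
      ((LINT x|lborel. (\<phi> x)\<^sup>2) * (norm \<xi> powr (2 * s) / frac_laplacian_const DIM('a) s))" (is ?A)
    and "has_bochner_integral (lborel \<Otimes>\<^sub>M lborel)
      (\<lambda>(x, y). (\<phi> y)\<^sup>2 * ((1 - cos (\<xi> \<bullet> (x - y))) / norm (x - y) powr (real DIM('a) + 2 * s)))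
      ((LINT x|lborel. (\<phi> x)\<^sup>2) * (norm \<xi> powr (2 * s) / frac_laplacian_const DIM('a) s))" (is ?B)
proof -
  note m = symbol_kernel_integrable[OF s, of \<xi>, unfolded has_bochner_integral_iff]
  show A: ?A
    using has_bochner_integral_pair_conv[OF \<phi>, of "\<lambda>h. (1 - cos (\<xi> \<bullet> h)) / norm h powr (real DIM('a) + 2 * s)"] m by simp
  have sw: "cos (\<xi> \<bullet> (y - x)) = cos (\<xi> \<bullet> (x - y))" for x y
  proof -
    have "\<xi> \<bullet> (y - x) = - (\<xi> \<bullet> (x - y))" by (simp add: inner_diff_right)
    then show ?thesis by simp
  qed
  let ?f = "\<lambda>(x, y). (\<phi> x)\<^sup>2 * ((1 - cos (\<xi> \<bullet> (x - y))) / norm (x - y) powr (real DIM('a) + 2 * s))"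
  have "integrable (lborel \<Otimes>\<^sub>M lborel) ?f" using A by (simp add: has_bochner_integral_iff)
  from lborel_pair.integrable_product_swap[OF this] lborel_pair.integral_product_swap[OF borel_measurable_integrable[OF this]] A
  show ?B by (simp add: has_bochner_integral_iff norm_minus_commute sw)
qed

lemma powr_le_one_plus_square:
  fixes r s :: real
  assumes "0 \<le> r" "0 < s" "s < 1"
  shows "r powr (2 * s) \<le> 1 + r\<^sup>2"
proof (cases "r \<le> 1")
  case True
  then have "r powr (2 * s) \<le> 1" using assms by (intro powr_le1) auto
  then show ?thesis by (simp add: add_increasing2)
next
  case False
  then have "r powr (2 * s) \<le> r powr 2" using assms by (intro powr_mono) auto
  then show ?thesis using False by simp
qed

text \<open>Averaging \<open>1 - cos (\<xi> \<bullet> h)\<close> over \<xi> with a Gaussian of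
  parameter \<open>1 / (4 * \<sigma>)\<close> gives a multiple of
  \<open>1 - exp (- \<sigma> * (norm h)^2)\<close>. By Tonelli the integral is a Gaussian average of
  the symbol, which is finite; no separate analysis near zero and infinity is required.\<close>

lemma one_minus_gauss_kernel_integrable:
  fixes s \<sigma> :: real
  assumes s: "0 < s" "s < 1" and \<sigma>: "0 < \<sigma>"
  shows "integrable lborel (\<lambda>h::'a::euclidean_space. (1 - exp (- \<sigma> * (norm h)\<^sup>2)) / norm h powr (real DIM('a) + 2 * s))"
proof -
  define \<tau> where "\<tau> = 1 / (4 * \<sigma>)"
  have \<tau>: "0 < \<tau>" using \<sigma> by (simp add: \<tau>_def)
  let ?c = "(pi / \<tau>) powr (DIM('a) / 2)" and ?C = "frac_laplacian_const DIM('a) s"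
  let ?k = "\<lambda>h::'a. norm h powr (real DIM('a) + 2 * s)"
  have C: "0 < ?C" using s by (rule frac_laplacian_const_pos)
  have c: "0 < ?c" using \<tau> by simp
  have 1: "(\<integral>\<^sup>+\<xi>. ennreal (exp (- \<tau> * (norm \<xi>)\<^sup>2) * (1 - cos (\<xi> \<bullet> h))) \<partial>lborel) = ennreal (?c * (1 - exp (- \<sigma> * (norm h)\<^sup>2)))" for h :: 'a
  proof -
    have "has_bochner_integral lborel (\<lambda>\<xi>. exp (- \<tau> * (norm \<xi>)\<^sup>2) - exp (- \<tau> * (norm \<xi>)\<^sup>2) * cos (h \<bullet> \<xi>))
      (?c - ?c * exp (- (norm h)\<^sup>2 / (4 * \<tau>)))"
      by (intro has_bochner_integral_diff gauss_integral gauss_cos \<tau>)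
    also have "(\<lambda>\<xi>. exp (- \<tau> * (norm \<xi>)\<^sup>2) - exp (- \<tau> * (norm \<xi>)\<^sup>2) * cos (h \<bullet> \<xi>)) = (\<lambda>\<xi>. exp (- \<tau> * (norm \<xi>)\<^sup>2) * (1 - cos (\<xi> \<bullet> h)))"
      by (simp add: inner_commute right_diff_distrib)
    also have "?c - ?c * exp (- (norm h)\<^sup>2 / (4 * \<tau>)) = ?c * (1 - exp (- \<sigma> * (norm h)\<^sup>2))"
      using \<sigma> by (simp add: \<tau>_def algebra_simps)
    finally show ?thesis
      unfolding has_bochner_integral_iff by (subst nn_integral_eq_integral) auto
  qed
  have "ennreal ?c * (\<integral>\<^sup>+h. ennreal ((1 - exp (- \<sigma> * (norm h)\<^sup>2)) / ?k h) \<partial>lborel)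
    = (\<integral>\<^sup>+h. ennreal (?c * (1 - exp (- \<sigma> * (norm h)\<^sup>2))) * ennreal (1 / ?k h) \<partial>lborel)"
    using c by (subst nn_integral_cmult[symmetric]) (auto intro!: nn_integral_cong simp: ennreal_mult''[symmetric] ennreal_mult'[symmetric])
  also have "\<dots> = (\<integral>\<^sup>+\<xi>. ennreal (exp (- \<tau> * (norm (\<xi>::'a))\<^sup>2) * (norm \<xi> powr (2 * s) / ?C)) \<partial>lborel)"
  proof (rule nn_integral_swap[where f = "\<lambda>h \<xi>. ennreal (exp (- \<tau> * (norm \<xi>)\<^sup>2) * (1 - cos (\<xi> \<bullet> h))) * ennreal (1 / ?k h)"];
         (rule AE_I2)?)
    fix h :: 'a
    show "(\<integral>\<^sup>+\<xi>. ennreal (exp (- \<tau> * (norm \<xi>)\<^sup>2) * (1 - cos (\<xi> \<bullet> h))) * ennreal (1 / ?k h) \<partial>lborel)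
      = ennreal (?c * (1 - exp (- \<sigma> * (norm h)\<^sup>2))) * ennreal (1 / ?k h)"
      unfolding 1[symmetric] by (rule nn_integral_multc) measurable
  next
    fix \<xi> :: 'a
    have "(\<integral>\<^sup>+h. ennreal (exp (- \<tau> * (norm \<xi>)\<^sup>2) * (1 - cos (\<xi> \<bullet> h))) * ennreal (1 / ?k h) \<partial>lborel)
      = (\<integral>\<^sup>+h. ennreal (exp (- \<tau> * (norm \<xi>)\<^sup>2)) * ennreal ((1 - cos (\<xi> \<bullet> h)) / ?k h) \<partial>lborel)"
      by (intro nn_integral_cong) (simp add: ennreal_mult''[symmetric] ennreal_mult'[symmetric])
    also have "\<dots> = ennreal (exp (- \<tau> * (norm \<xi>)\<^sup>2)) * (\<integral>\<^sup>+h. ennreal ((1 - cos (\<xi> \<bullet> h)) / ?k h) \<partial>lborel)"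
      by (rule nn_integral_cmult) measurable
    also have "\<dots> = ennreal (exp (- \<tau> * (norm \<xi>)\<^sup>2) * (norm \<xi> powr (2 * s) / ?C))"
      unfolding nn_integral_symbol[OF s] by (simp add: ennreal_mult'[symmetric])
    finally show "(\<integral>\<^sup>+h. ennreal (exp (- \<tau> * (norm \<xi>)\<^sup>2) * (1 - cos (\<xi> \<bullet> h))) * ennreal (1 / ?k h) \<partial>lborel) = \<dots>" .
  qed measurable
  also have "\<dots> < \<infinity>"
  proof -
    let ?g = "\<lambda>\<xi>::'a. (exp (- \<tau> * (norm \<xi>)\<^sup>2) + 2 / \<tau> * exp (- (\<tau> / 2) * (norm \<xi>)\<^sup>2)) / ?C"
    have gi: "integrable lborel ?g"
      using gauss_integral[OF \<tau>, where 'a='a] gauss_integral[of "\<tau> / 2", where 'a='a] \<tau>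
      by (simp add: has_bochner_integral_iff)
    have "integrable lborel (\<lambda>\<xi>::'a. exp (- \<tau> * (norm \<xi>)\<^sup>2) * (norm \<xi> powr (2 * s) / ?C))"
    proof (rule Bochner_Integration.integrable_bound[OF gi])
      have *: "exp (- \<tau> * r\<^sup>2) * r powr (2 * s) \<le> exp (- \<tau> * r\<^sup>2) + 2 / \<tau> * exp (- (\<tau> / 2) * r\<^sup>2)" if r: "0 \<le> r" for r :: real
      proof -
        have "exp (- \<tau> * r\<^sup>2) * r powr (2 * s) \<le> exp (- \<tau> * r\<^sup>2) * (1 + r\<^sup>2)"
          using powr_le_one_plus_square[OF r s] by (intro mult_left_mono) auto
        also have "exp (- \<tau> * r\<^sup>2) * (1 + r\<^sup>2) = exp (- \<tau> * r\<^sup>2) + r\<^sup>2 * exp (- \<tau> * r\<^sup>2)"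
          by (simp add: algebra_simps)
        also have "r\<^sup>2 * exp (- \<tau> * r\<^sup>2) \<le> (2 / \<tau> * exp (\<tau> / 2 * r\<^sup>2)) * exp (- \<tau> * r\<^sup>2)"
        proof (intro mult_right_mono)
          have "\<tau> / 2 * r\<^sup>2 \<le> exp (\<tau> / 2 * r\<^sup>2)" using exp_ge_add_one_self[of "\<tau> / 2 * r\<^sup>2"] by linarith
          then show "r\<^sup>2 \<le> 2 / \<tau> * exp (\<tau> / 2 * r\<^sup>2)" using \<tau> by (simp add: field_simps)
        qed simp
        also have "(2 / \<tau> * exp (\<tau> / 2 * r\<^sup>2)) * exp (- \<tau> * r\<^sup>2) = 2 / \<tau> * exp (- (\<tau> / 2) * r\<^sup>2)"
          by (simp add: mult.assoc exp_add[symmetric])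
        finally show ?thesis by simp
      qed
      have b: "exp (- \<tau> * (norm \<xi>)\<^sup>2) * (norm \<xi> powr (2 * s) / ?C) \<le> ?g \<xi>" for \<xi> :: 'a
        using divide_right_mono[OF *[of "norm \<xi>"], of ?C] C by simp
      have n: "0 \<le> exp (- \<tau> * (norm \<xi>)\<^sup>2) * (norm \<xi> powr (2 * s) / ?C)" for \<xi> :: 'a
        using C by simp
      show "AE \<xi>::'a in lborel. norm (exp (- \<tau> * (norm \<xi>)\<^sup>2) * (norm \<xi> powr (2 * s) / ?C)) \<le> norm (?g \<xi>)"
      proof (rule AE_I2)
        fix \<xi> :: 'a
        show "norm (exp (- \<tau> * (norm \<xi>)\<^sup>2) * (norm \<xi> powr (2 * s) / ?C)) \<le> norm (?g \<xi>)"
          unfolding real_norm_def using b[of \<xi>] n[of \<xi>] by linarith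
      qed
    qed measurable
    then show ?thesis using C by (subst nn_integral_eq_integral) (auto simp: less_top)
  qed
  finally have "(\<integral>\<^sup>+h. ennreal ((1 - exp (- \<sigma> * (norm h)\<^sup>2)) / ?k h) \<partial>lborel) < \<infinity>"
    using c by (auto simp: ennreal_mult_less_top)
  moreover have "0 \<le> (1 - exp (- \<sigma> * (norm h)\<^sup>2)) / ?k h" for h
    using \<sigma> by (intro divide_nonneg_nonneg) auto
  ultimately show ?thesis by (intro integrableI_nonneg AE_I2) auto
qed

text \<open>Increments of a bounded Lipschitz function are naturally controlled by
  \<open>min 1 t\<close>; this passes to the expression for which integrability against the kernel
  is known. It rests on \<open>exp (- t) \<le> 1 / (1 + t)\<close>.\<close>

lemma min_one_le_exp:
  fixes t :: real
  assumes "0 \<le> t"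
  shows "min 1 t \<le> 2 * (1 - exp (- t))"
proof -
  have "1 + t \<le> exp t" by (rule exp_ge_add_one_self)
  then have "exp (- t) \<le> 1 / (1 + t)"
    using assms by (simp add: exp_minus divide_simps mult.commute)
  then have "2 * (1 - 1 / (1 + t)) \<le> 2 * (1 - exp (- t))" by simp
  moreover have "min 1 t \<le> 2 * (1 - 1 / (1 + t))"
  proof (cases "t \<le> 1")
    case True
    have "t * t \<le> t * 1" using True assms by (intro mult_left_mono) auto
    then show ?thesis using True assms by (simp add: min_def field_simps)
  next
    case False
    then show ?thesis by (simp add: min_def field_simps)
  qed
  ultimately show ?thesis by linarith
qed

context
  fixes \<Omega> :: "(real ^ 'n) set" and s :: real
  assumes \<Omega>o: "open \<Omega>" and \<Omega>b: "bounded \<Omega>" and s: "0 < s" "s < 1"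
begin

text \<open>The squared increment is at most \<open>min 1 (L^2 * (norm (x - y))^2)\<close> and
  vanishes unless one of the points lies in \<Omega>. So it is dominated by convolutions of the
  indicator of \<Omega> with an integrable function.\<close>

lemma lipschitz_in_H0:
  fixes \<phi> :: "real ^ 'n \<Rightarrow> real"
  assumes lip: "\<And>x y. \<bar>\<phi> x - \<phi> y\<bar> \<le> L * norm (x - y)" and L: "0 < L"
    and bnd: "\<And>x. 0 \<le> \<phi> x" "\<And>x. \<phi> x \<le> 1" and van: "\<And>x. x \<notin> \<Omega> \<Longrightarrow> \<phi> x = 0"
  shows "\<phi> \<in> sobolev_H0 s \<Omega>"
  unfolding sobolev_H0_iff
proof (intro conjI)
  have "continuous_on UNIV \<phi>"
  proof (rule continuous_on_iff[THEN iffD2], intro ballI allI impI)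
    fix x and e :: real assume e: "0 < e"
    show "\<exists>d>0. \<forall>x'\<in>UNIV. dist x' x < d \<longrightarrow> dist (\<phi> x') (\<phi> x) < e"
    proof (intro exI conjI ballI impI)
      show "0 < e / L" using e L by simp
      fix x' assume "dist x' x < e / L"
      then have "L * norm (x' - x) < e" using L by (simp add: dist_norm field_simps)
      then show "dist (\<phi> x') (\<phi> x) < e" using lip[of x' x] by (simp add: dist_norm)
    qed
  qed
  then show m [measurable]: "\<phi> \<in> borel_measurable borel" by (rule borel_measurable_continuous_onI)
  have ind: "integrable lborel (indicator \<Omega> :: real^'n \<Rightarrow> real)" by (rule domain_indicator_integrable[OF \<Omega>o \<Omega>b s])
  show "integrable lborel (\<lambda>x. (\<phi> x)\<^sup>2)"
  proof (rule Bochner_Integration.integrable_bound[OF ind])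
    have "norm ((\<phi> x)\<^sup>2) \<le> norm (indicat_real \<Omega> x)" for x
      using bnd[of x] van[of x] by (auto simp: power_le_one split: split_indicator)
    then show "AE x in lborel. norm ((\<phi> x)\<^sup>2) \<le> norm (indicat_real \<Omega> x)" by simp
  qed measurable
  let ?k = "\<lambda>h::real^'n. norm h powr (real DIM(real^'n) + 2 * s)"
  let ?m = "\<lambda>h::real^'n. (1 - exp (- (L\<^sup>2) * (norm h)\<^sup>2)) / ?k h"
  have mi: "integrable lborel ?m"
    using L by (intro one_minus_gauss_kernel_integrable s) simp
  have A: "integrable (lborel \<Otimes>\<^sub>M lborel) (\<lambda>(x, y). indicat_real \<Omega> x * ?m (x - y))"
    using has_bochner_integral_pair_conv[OF ind mi] by (simp add: has_bochner_integral_iff)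
  have B: "integrable (lborel \<Otimes>\<^sub>M lborel) (\<lambda>(x, y). indicat_real \<Omega> y * ?m (x - y))"
    using lborel_pair.integrable_product_swap[OF A] by (simp add: norm_minus_commute)
  have I: "integrable (lborel \<Otimes>\<^sub>M lborel) (\<lambda>p. 2 * ((case p of (x, y) \<Rightarrow> indicat_real \<Omega> x * ?m (x - y)) + (case p of (x, y) \<Rightarrow> indicat_real \<Omega> y * ?m (x - y))))"
    using A B by simp
  show "integrable (lborel \<Otimes>\<^sub>M lborel) (\<lambda>p. (diff_quot s \<phi> p)\<^sup>2)"
  proof (rule Bochner_Integration.integrable_bound[OF I])
    have "(\<phi> x - \<phi> y)\<^sup>2 / ?k (x - y) \<le> 2 * (indicat_real \<Omega> x * ?m (x - y) + indicat_real \<Omega> y * ?m (x - y))" for x y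
    proof (cases "x \<in> \<Omega> \<or> y \<in> \<Omega>")
      case True
      let ?t = "L\<^sup>2 * (norm (x - y))\<^sup>2"
      have m0: "0 \<le> ?m (x - y)" by (intro divide_nonneg_nonneg) auto
      have "(\<phi> x - \<phi> y)\<^sup>2 \<le> min 1 ?t"
      proof (rule min.boundedI)
        have "\<bar>\<phi> x - \<phi> y\<bar> \<le> 1" using bnd[of x] bnd[of y] by linarith
        then show "(\<phi> x - \<phi> y)\<^sup>2 \<le> 1" by (simp add: abs_square_le_1)
        have "\<bar>\<phi> x - \<phi> y\<bar>\<^sup>2 \<le> (L * norm (x - y))\<^sup>2" by (intro power_mono lip) simp
        then show "(\<phi> x - \<phi> y)\<^sup>2 \<le> ?t" by (simp add: power_mult_distrib)
      qed
      also have "\<dots> \<le> 2 * (1 - exp (- ?t))" by (rule min_one_le_exp) simp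
      finally have "(\<phi> x - \<phi> y)\<^sup>2 / ?k (x - y) \<le> 2 * ?m (x - y)"
        using divide_right_mono[of "(\<phi> x - \<phi> y)\<^sup>2" "2 * (1 - exp (- ?t))" "?k (x - y)"] by simp
      also have "\<dots> \<le> 2 * (indicat_real \<Omega> x * ?m (x - y) + indicat_real \<Omega> y * ?m (x - y))"
        using True m0 by (auto split: split_indicator)
      finally show ?thesis .
    qed (simp add: van)
    then show "AE p in lborel \<Otimes>\<^sub>M lborel. norm ((diff_quot s \<phi> p)\<^sup>2) \<le> norm (2 * ((case p of (x, y) \<Rightarrow> indicat_real \<Omega> x * ?m (x - y)) + (case p of (x, y) \<Rightarrow> indicat_real \<Omega> y * ?m (x - y))))"
      by (intro AE_I2) (auto simp: diff_quot_square split: prod.split intro: order_trans[OF _ abs_ge_self])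
  qed measurable
  show "AE x in lborel. x \<notin> \<Omega> \<longrightarrow> \<phi> x = 0" using van by simp
qed

text \<open>For the real and imaginary parts together, the squared increment is \<open>(\<phi> x -
  \<phi> y)^2 + 2 * \<phi> x * \<phi> y * (1 - cos (\<xi> \<bullet> (x - y)))\<close>. After
  \<open>2 * \<phi> x * \<phi> y \<le> (\<phi> x)^2 + (\<phi> y)^2\<close> the second term
  integrates exactly to the symbol times the square norm.\<close>

lemma modulated_in_H0:
  assumes \<phi>: "\<phi> \<in> sobolev_H0 s \<Omega>"
  shows "(\<lambda>x. \<phi> x * cos (\<xi> \<bullet> x)) \<in> sobolev_H0 s \<Omega>" "(\<lambda>x. \<phi> x * sin (\<xi> \<bullet> x)) \<in> sobolev_H0 s \<Omega>"
    and "frac_laplacian_const CARD('n) s / 2 * (gagliardo s (\<lambda>x. \<phi> x * cos (\<xi> \<bullet> x)) + gagliardo s (\<lambda>x. \<phi> x * sin (\<xi> \<bullet> x)))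
      \<le> frac_laplacian_const CARD('n) s / 2 * gagliardo s \<phi> + norm \<xi> powr (2 * s) * ip_L2 \<phi> \<phi>"
proof -
  let ?C = "frac_laplacian_const CARD('n) s"
  let ?fc = "\<lambda>x. \<phi> x * cos (\<xi> \<bullet> x)" and ?fs = "\<lambda>x. \<phi> x * sin (\<xi> \<bullet> x)"
  let ?m = "\<lambda>h::real^'n. (1 - cos (\<xi> \<bullet> h)) / norm h powr (real DIM(real^'n) + 2 * s)"
  have C: "0 < ?C" using s by (rule frac_laplacian_const_pos)
  note [measurable] = H0_measurable[OF \<phi>]
  note \<phi>2 = H0_square[OF \<phi>]
  note K = symbol_kernel_pair[OF s \<phi>2, of \<xi>]
  let ?U = "\<lambda>p. (diff_quot s \<phi> p)\<^sup>2 + ((case p of (x, y) \<Rightarrow> (\<phi> x)\<^sup>2 * ?m (x - y)) + (case p of (x, y) \<Rightarrow> (\<phi> y)\<^sup>2 * ?m (x - y)))"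
  have U: "has_bochner_integral (lborel \<Otimes>\<^sub>M lborel) ?U
    (gagliardo s \<phi> + ((LINT x|lborel. (\<phi> x)\<^sup>2) * (norm \<xi> powr (2 * s) / ?C) + (LINT x|lborel. (\<phi> x)\<^sup>2) * (norm \<xi> powr (2 * s) / ?C)))"
    using K H0_diff_quot[OF \<phi>]
    by (intro has_bochner_integral_add) (simp_all add: has_bochner_integral_iff gagliardo_diff_quot[OF \<Omega>o \<Omega>b s])
  have pt: "(diff_quot s ?fc p)\<^sup>2 + (diff_quot s ?fs p)\<^sup>2 \<le> ?U p" for p
  proof -
    obtain x y where p: "p = (x, y)" by force
    let ?k = "norm (x - y) powr (real DIM(real^'n) + 2 * s)"
    have trig: "(a * cos \<alpha> - b * cos \<beta>)\<^sup>2 + (a * sin \<alpha> - b * sin \<beta>)\<^sup>2 = (a - b)\<^sup>2 + 2 * (a * b) * (1 - cos (\<alpha> - \<beta>))" for a b \<alpha> \<beta> :: real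
    proof -
      have "(a * cos \<alpha> - b * cos \<beta>)\<^sup>2 + (a * sin \<alpha> - b * sin \<beta>)\<^sup>2
        = a\<^sup>2 * ((cos \<alpha>)\<^sup>2 + (sin \<alpha>)\<^sup>2) + b\<^sup>2 * ((cos \<beta>)\<^sup>2 + (sin \<beta>)\<^sup>2) - 2 * (a * b) * (cos \<alpha> * cos \<beta> + sin \<alpha> * sin \<beta>)"
        by algebra
      also have "\<dots> = (a - b)\<^sup>2 + 2 * (a * b) * (1 - cos (\<alpha> - \<beta>))"
        unfolding sin_cos_squared_add2 cos_diff by (simp add: power2_eq_square algebra_simps)
      finally show ?thesis .
    qed
    have "(?fc x - ?fc y)\<^sup>2 + (?fs x - ?fs y)\<^sup>2 = (\<phi> x - \<phi> y)\<^sup>2 + 2 * (\<phi> x * \<phi> y) * (1 - cos (\<xi> \<bullet> (x - y)))"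
      unfolding trig by (simp add: inner_diff_right)
    also have "\<dots> \<le> (\<phi> x - \<phi> y)\<^sup>2 + ((\<phi> x)\<^sup>2 + (\<phi> y)\<^sup>2) * (1 - cos (\<xi> \<bullet> (x - y)))"
      using sum_squares_bound[of "\<phi> x" "\<phi> y"] by (intro add_left_mono mult_right_mono) (auto simp: mult.assoc)
    finally have "((?fc x - ?fc y)\<^sup>2 + (?fs x - ?fs y)\<^sup>2) / ?k \<le> ((\<phi> x - \<phi> y)\<^sup>2 + ((\<phi> x)\<^sup>2 + (\<phi> y)\<^sup>2) * (1 - cos (\<xi> \<bullet> (x - y)))) / ?k"
      by (rule divide_right_mono) simp
    then show ?thesis
      unfolding diff_quot_square p prod.case by (simp add: add_divide_distrib distrib_right)
  qed
  have dm [measurable]: "diff_quot s ?fc \<in> borel_measurable (lborel \<Otimes>\<^sub>M lborel)" "diff_quot s ?fs \<in> borel_measurable (lborel \<Otimes>\<^sub>M lborel)"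
    by (intro diff_quot_measurable; measurable)+
  have Ui: "integrable (lborel \<Otimes>\<^sub>M lborel) ?U" using U by (simp add: has_bochner_integral_iff)
  have ci: "integrable (lborel \<Otimes>\<^sub>M lborel) (\<lambda>p. (diff_quot s ?fc p)\<^sup>2)"
  proof (rule Bochner_Integration.integrable_bound[OF Ui])
    have "(diff_quot s ?fc p)\<^sup>2 \<le> ?U p" for p using pt[of p] zero_le_power2[of "diff_quot s ?fs p"] by linarith
    then show "AE p in lborel \<Otimes>\<^sub>M lborel. norm ((diff_quot s ?fc p)\<^sup>2) \<le> norm (?U p)"
      by (intro AE_I2) (auto intro: order_trans[OF _ abs_ge_self])
  qed measurable
  have si: "integrable (lborel \<Otimes>\<^sub>M lborel) (\<lambda>p. (diff_quot s ?fs p)\<^sup>2)"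
  proof (rule Bochner_Integration.integrable_bound[OF Ui])
    have "(diff_quot s ?fs p)\<^sup>2 \<le> ?U p" for p using pt[of p] zero_le_power2[of "diff_quot s ?fc p"] by linarith
    then show "AE p in lborel \<Otimes>\<^sub>M lborel. norm ((diff_quot s ?fs p)\<^sup>2) \<le> norm (?U p)"
      by (intro AE_I2) (auto intro: order_trans[OF _ abs_ge_self])
  qed measurable
  have sq: "integrable lborel (\<lambda>x. (\<phi> x * g x)\<^sup>2)" if "g \<in> borel_measurable borel" "\<And>x. \<bar>g x\<bar> \<le> 1" for g
    unfolding power_mult_distrib using that
    by (intro integrable_mult_bounded_real[where B=1] \<phi>2) (auto simp: abs_square_le_1)
  show "?fc \<in> sobolev_H0 s \<Omega>" "?fs \<in> sobolev_H0 s \<Omega>"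
    unfolding sobolev_H0_iff
    using ci si sq[of "\<lambda>x. cos (\<xi> \<bullet> x)"] sq[of "\<lambda>x. sin (\<xi> \<bullet> x)"] H0_vanish[OF \<phi>]
    by (auto elim: eventually_mono)
  have "gagliardo s ?fc + gagliardo s ?fs = (LINT p|(lborel \<Otimes>\<^sub>M lborel). (diff_quot s ?fc p)\<^sup>2 + (diff_quot s ?fs p)\<^sup>2)"
    using ci si by (simp add: gagliardo_diff_quot[OF \<Omega>o \<Omega>b s])
  also have "\<dots> \<le> (LINT p|(lborel \<Otimes>\<^sub>M lborel). ?U p)"
    using ci si Ui pt by (intro integral_mono) auto
  also have "\<dots> = gagliardo s \<phi> + 2 * ip_L2 \<phi> \<phi> * (norm \<xi> powr (2 * s) / ?C)"
    using U by (simp add: has_bochner_integral_iff ip_L2_def power2_eq_square)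
  finally have "?C / 2 * (gagliardo s ?fc + gagliardo s ?fs) \<le> ?C / 2 * (gagliardo s \<phi> + 2 * ip_L2 \<phi> \<phi> * (norm \<xi> powr (2 * s) / ?C))"
    using C by (intro mult_left_mono) auto
  also have "\<dots> = ?C / 2 * gagliardo s \<phi> + norm \<xi> powr (2 * s) * ip_L2 \<phi> \<phi>"
    using C by (simp add: field_simps)
  finally show "?C / 2 * (gagliardo s ?fc + gagliardo s ?fs) \<le> ?C / 2 * gagliardo s \<phi> + norm \<xi> powr (2 * s) * ip_L2 \<phi> \<phi>" .
qed

text \<open>The variational inequality is applied to both parts of the coherent state at each \<xi>
  and integrated over frequencies. On the right, \<open>e j\<close> then carries the total Fourier
  mass of \<open>\<phi> * e j\<close>, which is at most \<open>1\<close> after normalisation. On the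
  left, the excess energy is paid once per unit of volume of the ball where the symbol is at most
  \<Lambda>.\<close>

lemma riesz_mean_lower_bound:
  fixes e :: "nat \<Rightarrow> real ^ 'n \<Rightarrow> real"
  assumes F: "finite F" and eH: "\<And>j. e j \<in> sobolev_H0 s \<Omega>"
    and eig: "\<And>j v. v \<in> sobolev_H0 s \<Omega> \<Longrightarrow> energy s (e j) v = \<mu> j * ip_L2 (e j) v"
    and orth: "\<And>i j. ip_L2 (e i) (e j) = (if i = j then 1 else 0)"
    and complete: "\<And>u m. u \<in> sobolev_H0 s \<Omega> \<Longrightarrow> m < \<Lambda> \<Longrightarrow>
      (\<And>v. v \<in> sobolev_H0 s \<Omega> \<Longrightarrow> energy s u v = m * ip_L2 u v) \<Longrightarrow>
      (\<And>j. j \<in> F \<Longrightarrow> ip_L2 u (e j) = 0) \<Longrightarrow> ip_L2 u u = 0"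
    and le: "\<And>j. j \<in> F \<Longrightarrow> \<mu> j \<le> \<Lambda>" and \<Lambda>: "0 < \<Lambda>"
    and \<phi>: "\<phi> \<in> sobolev_H0 s \<Omega>" "\<And>x. \<bar>\<phi> x\<bar> \<le> 1"
  shows "(2 * pi) powr (- real CARD('n)) * measure lborel (ball (0::real^'n) 1) *
      (ip_L2 \<phi> \<phi> * (\<Lambda> powr (CARD('n) / (2 * s) + 1) / (CARD('n) / (2 * s) + 1))
       - (ip_L2 \<phi> \<phi> + frac_laplacian_const CARD('n) s / 2 * gagliardo s \<phi>) * \<Lambda> powr (CARD('n) / (2 * s)))
    \<le> (\<Sum>j\<in>F. \<Lambda> - \<mu> j)"
proof -
  interpret H: coercive_form "sobolev_H0 s \<Omega>" ip_L2 "energy s" by (rule coercive_form_H0[OF \<Omega>o \<Omega>b s])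
  let ?K = "(2 * pi) powr (- real CARD('n))" and ?C = "frac_laplacian_const CARD('n) s"
    and ?p = "CARD('n) / (2 * s)" and ?\<omega> = "measure lborel (ball (0::real^'n) 1)"
  have K: "0 < ?K" by simp
  note [measurable] = H0_measurable[OF \<phi>(1)] H0_measurable[OF eH]
  have ef: "H.eigenfamily F e \<mu>"
    using F eH eig orth by (auto simp: H.eigenfamily_def)
  \<comment> \<open>The part of the energy of a coherent state that does not grow with \<xi>: the
    mass term and the energy of \<phi> itself.\<close>
  define E where "E = ip_L2 \<phi> \<phi> + ?C / 2 * gagliardo s \<phi>"
  define G where "G \<xi> = (\<Sum>j\<in>F. (\<Lambda> - \<mu> j) * fourier_sq (\<lambda>x. \<phi> x * e j x) \<xi>)" for \<xi>
  have GL: "(\<Lambda> - norm \<xi> powr (2 * s)) * ip_L2 \<phi> \<phi> - E \<le> G \<xi>" for \<xi>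
  proof -
    let ?fc = "\<lambda>x. \<phi> x * cos (\<xi> \<bullet> x)" and ?fs = "\<lambda>x. \<phi> x * sin (\<xi> \<bullet> x)"
    note M = modulated_in_H0[OF \<phi>(1), of \<xi>]
    have r: "\<Lambda> * ip_L2 f f - energy s f f \<le> (\<Sum>j\<in>F. (\<Lambda> - \<mu> j) * (ip_L2 f (e j))\<^sup>2)"
      if "f \<in> sobolev_H0 s \<Omega>" for f
      by (rule H.riesz_mean_lower[OF ef complete that])
    have ip: "ip_L2 ?fc ?fc + ip_L2 ?fs ?fs = ip_L2 \<phi> \<phi>"
    proof -
      have "ip_L2 ?fc ?fc + ip_L2 ?fs ?fs = (LINT x|lborel. ?fc x * ?fc x + ?fs x * ?fs x)"
        unfolding ip_L2_def using H0_mult_integrable[OF M(1) M(1)] H0_mult_integrable[OF M(2) M(2)] by simp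
      also have "(\<lambda>x. ?fc x * ?fc x + ?fs x * ?fs x) = (\<lambda>x. \<phi> x * \<phi> x)"
      proof
        fix x
        have "?fc x * ?fc x + ?fs x * ?fs x = \<phi> x * \<phi> x * ((cos (\<xi> \<bullet> x))\<^sup>2 + (sin (\<xi> \<bullet> x))\<^sup>2)"
          by algebra
        then show "?fc x * ?fc x + ?fs x * ?fs x = \<phi> x * \<phi> x" by simp
      qed
      finally show ?thesis by (simp add: ip_L2_def)
    qed
    have "(\<Lambda> - norm \<xi> powr (2 * s)) * ip_L2 \<phi> \<phi> - E
      = \<Lambda> * ip_L2 \<phi> \<phi> - ip_L2 \<phi> \<phi> - (?C / 2 * gagliardo s \<phi> + norm \<xi> powr (2 * s) * ip_L2 \<phi> \<phi>)"
      by (simp add: E_def algebra_simps)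
    also have "\<dots> \<le> \<Lambda> * ip_L2 \<phi> \<phi> - ip_L2 \<phi> \<phi> - ?C / 2 * (gagliardo s ?fc + gagliardo s ?fs)"
      using M(3) by linarith
    also have "\<dots> = (\<Lambda> * ip_L2 ?fc ?fc - energy s ?fc ?fc) + (\<Lambda> * ip_L2 ?fs ?fs - energy s ?fs ?fs)"
      unfolding energy_self ip[symmetric] by (simp only: algebra_simps)
    also have "\<dots> \<le> (\<Sum>j\<in>F. (\<Lambda> - \<mu> j) * (ip_L2 ?fc (e j))\<^sup>2) + (\<Sum>j\<in>F. (\<Lambda> - \<mu> j) * (ip_L2 ?fs (e j))\<^sup>2)"
      by (intro add_mono r M)
    also have "\<dots> = G \<xi>"
      unfolding G_def sum.distrib[symmetric] fourier_sq_def ip_L2_def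
      by (intro sum.cong refl) (simp add: distrib_left mult_ac)
    finally show ?thesis .
  qed
  \<comment> \<open>The product \<open>\<phi> * e j\<close> is used only as an element of L^1 and
    L^2, so Bessel's inequality takes the place of Plancherel's identity.\<close>
  have fb: "integrable lborel (fourier_sq (\<lambda>x. \<phi> x * e j x))"
    "?K * (LINT \<xi>|lborel. fourier_sq (\<lambda>x. \<phi> x * e j x) \<xi>) \<le> 1" for j
  proof -
    let ?u = "\<lambda>x. \<phi> x * e j x"
    have pw: "(?u x)\<^sup>2 \<le> (e j x)\<^sup>2" for x
      using \<phi>(2)[of x] by (simp add: power_mult_distrib abs_square_le_1 mult_left_le_one_le)
    have u2: "integrable lborel (\<lambda>x. (?u x)\<^sup>2)"
      by (rule Bochner_Integration.integrable_bound[OF H0_square[OF eH[of j]]]) (use pw in auto)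
    have u1: "integrable lborel ?u"
      by (rule H0_mult_integrable[OF \<phi>(1) eH])
    have "(LINT x|lborel. (?u x)\<^sup>2) \<le> (LINT x|lborel. (e j x)\<^sup>2)"
      by (intro integral_mono u2 H0_square[OF eH] pw)
    also have "\<dots> = 1" using orth[of j j] by (simp add: ip_L2_def power2_eq_square)
    finally have le1: "(LINT x|lborel. (?u x)\<^sup>2) \<le> 1" .
    have b: "ennreal ?K * (\<integral>\<^sup>+\<xi>. ennreal (fourier_sq ?u \<xi>) \<partial>lborel) \<le> ennreal 1"
      using order_trans[OF fourier_sq_bessel[OF u1 u2] ennreal_leI[OF le1]] by simp
    show "integrable lborel (fourier_sq ?u)" "?K * (LINT \<xi>|lborel. fourier_sq ?u \<xi>) \<le> 1"
      using nn_integral_cmult_leD[OF _ _ K _ b] by auto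
  qed
  have Gi: "integrable lborel G" unfolding G_def using fb by simp
  have G0: "0 \<le> G \<xi>" for \<xi> unfolding G_def using le by (intro sum_nonneg mult_nonneg_nonneg) auto
  have "?K * (LINT \<xi>|lborel. G \<xi>) = (\<Sum>j\<in>F. (\<Lambda> - \<mu> j) * (?K * (LINT \<xi>|lborel. fourier_sq (\<lambda>x. \<phi> x * e j x) \<xi>)))"
    unfolding G_def using fb(1) by (simp add: sum_distrib_left mult_ac)
  also have "\<dots> \<le> (\<Sum>j\<in>F. (\<Lambda> - \<mu> j) * 1)"
    using le fb(2) by (intro sum_mono mult_left_mono) auto
  finally have GR: "?K * (LINT \<xi>|lborel. G \<xi>) \<le> (\<Sum>j\<in>F. \<Lambda> - \<mu> j)" by simp
  let ?B = "{\<xi>::real^'n. norm \<xi> powr (2 * s) \<le> \<Lambda>}"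
  have Bm [measurable]: "?B \<in> sets borel" by measurable
  have ph: "has_bochner_integral lborel (\<lambda>\<xi>::real^'n. max 0 (\<Lambda> - norm \<xi> powr (2 * s))) (?\<omega> * \<Lambda> powr (?p + 1) / (?p + 1))"
    using phase_space_integral[OF s(1) \<Lambda>, where 'a="real^'n"] by simp
  have Bi: "has_bochner_integral lborel (indicat_real ?B) (?\<omega> * \<Lambda> powr ?p)"
  proof -
    have "emeasure lborel ?B = ennreal (?\<omega> * \<Lambda> powr ?p)"
      using measure_symbol_sublevel[OF s(1) \<Lambda>, where 'a="real^'n"] by simp
    then show ?thesis
      by (simp add: has_bochner_integral_iff measure_def less_top)
  qed
  have L: "has_bochner_integral lborel (\<lambda>\<xi>::real^'n. ip_L2 \<phi> \<phi> * max 0 (\<Lambda> - norm \<xi> powr (2 * s)) - E * indicat_real ?B \<xi>)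
    (ip_L2 \<phi> \<phi> * (?\<omega> * \<Lambda> powr (?p + 1) / (?p + 1)) - E * (?\<omega> * \<Lambda> powr ?p))"
    by (intro has_bochner_integral_diff has_bochner_integral_mult_right ph Bi)
  have "ip_L2 \<phi> \<phi> * (?\<omega> * \<Lambda> powr (?p + 1) / (?p + 1)) - E * (?\<omega> * \<Lambda> powr ?p)
    = (LINT \<xi>|lborel. ip_L2 \<phi> \<phi> * max 0 (\<Lambda> - norm (\<xi>::real^'n) powr (2 * s)) - E * indicat_real ?B \<xi>)"
    by (rule has_bochner_integral_integral_eq[OF L, symmetric])
  also have "\<dots> \<le> (LINT \<xi>|lborel. G \<xi>)"
  proof (rule integral_mono)
    fix \<xi> :: "real ^ 'n"
    \<comment> \<open>Inside the ball this is \<open>GL\<close>; outside it the left side is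
      \<open>0\<close> and \<open>G\<close> is nonnegative.\<close>
    show "ip_L2 \<phi> \<phi> * max 0 (\<Lambda> - norm \<xi> powr (2 * s)) - E * indicat_real ?B \<xi> \<le> G \<xi>"
      using GL[of \<xi>] G0[of \<xi>] by (auto simp: mult.commute max_def split: split_indicator)
  qed (use L Gi in \<open>auto simp: has_bochner_integral_iff\<close>)
  finally have "?K * (ip_L2 \<phi> \<phi> * (?\<omega> * \<Lambda> powr (?p + 1) / (?p + 1)) - E * (?\<omega> * \<Lambda> powr ?p)) \<le> ?K * (LINT \<xi>|lborel. G \<xi>)"
    by (rule mult_left_mono) simp
  also note GR
  also have "?K * (ip_L2 \<phi> \<phi> * (?\<omega> * \<Lambda> powr (?p + 1) / (?p + 1)) - E * (?\<omega> * \<Lambda> powr ?p))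
    = ?K * ?\<omega> * (ip_L2 \<phi> \<phi> * (\<Lambda> powr (?p + 1) / (?p + 1)) - E * \<Lambda> powr ?p)"
    by (simp add: algebra_simps)
  finally show ?thesis by (simp only: E_def)
qed

text \<open>Lipschitz with constant \<open>n + 1\<close>, zero outside \<Omega>, and equal to
  \<open>1\<close> at distance at least \<open>1 / (n + 1)\<close> from the complement.\<close>

definition cutoff :: "nat \<Rightarrow> real ^ 'n \<Rightarrow> real" where
  "cutoff n x = min 1 (real (Suc n) * infdist x (- \<Omega>))"

lemma cutoff_in_H0: "cutoff n \<in> sobolev_H0 s \<Omega>" and cutoff_abs_le: "\<bar>cutoff n x\<bar> \<le> 1"
proof -
  show "cutoff n \<in> sobolev_H0 s \<Omega>"
  proof (rule lipschitz_in_H0[where L = "real (Suc n)"])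
    fix x y
    have "\<bar>infdist x (- \<Omega>) - infdist y (- \<Omega>)\<bar> \<le> norm (x - y)"
      using infdist_triangle_abs[of x "- \<Omega>" y] by (simp add: dist_norm)
    then have "real (Suc n) * \<bar>infdist x (- \<Omega>) - infdist y (- \<Omega>)\<bar> \<le> real (Suc n) * norm (x - y)"
      by (rule mult_left_mono) simp
    then have "\<bar>real (Suc n) * infdist x (- \<Omega>) - real (Suc n) * infdist y (- \<Omega>)\<bar> \<le> real (Suc n) * norm (x - y)"
      by (simp add: abs_mult right_diff_distrib[symmetric] del: of_nat_Suc)
    then show "\<bar>cutoff n x - cutoff n y\<bar> \<le> real (Suc n) * norm (x - y)"
      unfolding cutoff_def by linarith
  qed (auto simp: cutoff_def infdist_nonneg simp del: of_nat_Suc)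
  show "\<bar>cutoff n x\<bar> \<le> 1"
    by (simp add: cutoff_def infdist_nonneg abs_of_nonneg del: of_nat_Suc)
qed

lemma cutoff_limit: "(\<lambda>n. ip_L2 (cutoff n) (cutoff n)) \<longlonglongrightarrow> measure lborel \<Omega>"
proof -
  \<comment> \<open>The complement is nonempty because \<Omega> is bounded; the distance to an empty
    set would be \<open>0\<close> by convention.\<close>
  have ne: "- \<Omega> \<noteq> {}" using \<Omega>b not_bounded_UNIV by (metis Compl_UNIV_eq double_complement)
  have cl: "closed (- \<Omega>)" using \<Omega>o by (simp add: closed_Compl)
  have van: "cutoff n x = 0" if "x \<notin> \<Omega>" for n x using that by (simp add: cutoff_def)
  have ind: "integrable lborel (indicator \<Omega> :: real^'n \<Rightarrow> real)" by (rule domain_indicator_integrable[OF \<Omega>o \<Omega>b s])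
  have "(\<lambda>n. LINT x|lborel. cutoff n x * cutoff n x) \<longlonglongrightarrow> (LINT x|lborel. indicat_real \<Omega> x)"
  proof (rule integral_dominated_convergence[OF _ _ ind])
    show "(\<lambda>x. cutoff n x * cutoff n x) \<in> borel_measurable lborel" for n
      using H0_measurable[OF cutoff_in_H0] by measurable
    show "indicat_real \<Omega> \<in> borel_measurable lborel" using ind by auto
    show "AE x in lborel. norm (cutoff n x * cutoff n x) \<le> indicator \<Omega> x" for n
    proof (rule AE_I2)
      fix x
      show "norm (cutoff n x * cutoff n x) \<le> indicator \<Omega> x"
        using cutoff_abs_le[of n x] abs_square_le_1[of "cutoff n x"] van[of x n]
        by (auto simp: power2_eq_square split: split_indicator)
    qed
    show "AE x in lborel. (\<lambda>n. cutoff n x * cutoff n x) \<longlonglongrightarrow> indicat_real \<Omega> x"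
    proof (rule AE_I2)
      fix x
      show "(\<lambda>n. cutoff n x * cutoff n x) \<longlonglongrightarrow> indicat_real \<Omega> x"
      proof (cases "x \<in> \<Omega>")
        case True
        then have d: "0 < infdist x (- \<Omega>)" using in_closed_iff_infdist_zero[OF cl ne, of x] infdist_nonneg[of x "- \<Omega>"] by auto
        obtain N where N: "1 / real (Suc N) < infdist x (- \<Omega>)" using nat_approx_posE[OF d] by blast
        have "cutoff n x = 1" if "N \<le> n" for n
        proof -
          have "1 < real (Suc N) * infdist x (- \<Omega>)" using N by (simp add: field_simps del: of_nat_Suc)
          also have "\<dots> \<le> real (Suc n) * infdist x (- \<Omega>)" using that d by (intro mult_right_mono) auto
          finally show ?thesis by (simp add: cutoff_def)
        qed
        then have "\<forall>\<^sub>F n in sequentially. cutoff n x * cutoff n x = 1"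
          by (auto simp: eventually_sequentially intro!: exI[of _ N])
        then show ?thesis using True by (simp add: tendsto_eventually)
      qed (simp add: van)
    qed
  qed
  then show ?thesis by (simp add: ip_L2_def)
qed

end

section \<open>Weyl's law\<close>

text \<open>An index with \<open>ev j \<le> a\<close> contributes exactly \<open>b - a\<close> to
  the increment, and an index between \<open>a\<close> and \<open>b\<close> contributes something
  between \<open>0\<close> and \<open>b - a\<close>.\<close>

lemma riesz_mean_increment:
  fixes ev :: "nat \<Rightarrow> real"
  assumes fin: "\<And>\<Lambda>. finite {j. ev j \<le> \<Lambda>}" and ab: "a \<le> b"
  defines "R \<equiv> \<lambda>\<Lambda>. \<Sum>j | ev j \<le> \<Lambda>. \<Lambda> - ev j"
  shows "R b - R a \<le> (b - a) * card {j. ev j \<le> b}" "(b - a) * card {j. ev j \<le> a} \<le> R b - R a"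
proof -
  let ?J = "\<lambda>\<Lambda>. {j. ev j \<le> \<Lambda>}"
  have sub: "?J a \<subseteq> ?J b" using ab by auto
  have Ra: "R a = (\<Sum>j\<in>?J b. max 0 (a - ev j))"
    unfolding R_def using sub fin by (intro sum.mono_neutral_cong_left) auto
  have diff: "R b - R a = (\<Sum>j\<in>?J b. (b - ev j) - max 0 (a - ev j))"
    unfolding Ra by (simp only: R_def sum_subtractf[symmetric])
  also have "\<dots> \<le> (\<Sum>j\<in>?J b. b - a)"
    by (intro sum_mono) auto
  finally show "R b - R a \<le> (b - a) * card (?J b)" by (simp add: mult.commute)
  have "(b - a) * card (?J a) = (\<Sum>j\<in>?J a. b - a)" by (simp add: mult.commute)
  also have "\<dots> \<le> (\<Sum>j\<in>?J a. (b - ev j) - max 0 (a - ev j))"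
    by (intro sum_mono) auto
  also have "\<dots> \<le> (\<Sum>j\<in>?J b. (b - ev j) - max 0 (a - ev j))"
    using sub fin ab by (intro sum_mono2) auto
  finally show "(b - a) * card (?J a) \<le> R b - R a" using diff by simp
qed

lemma powr_difference_quotient:
  "((\<lambda>\<theta>. ((1 + \<theta>) powr q - 1) / \<theta>) \<longlongrightarrow> q) (at (0::real))"
proof -
  have "((\<lambda>x. x powr q) has_real_derivative q * 1 powr (q - 1)) (at 1)"
    by (rule has_real_derivative_powr) simp
  then show ?thesis by (simp add: DERIV_def add.commute)
qed

text \<open>An elementary Tauberian argument: convexity squeezes the counting function between
  difference quotients of \<open>R\<close> on either side of \<Lambda>. With a window of fixed
  relative width \<theta> these converge as \<Lambda> grows, and letting \<theta> tend to
  \<open>0\<close> differentiates the power \<open>p + 1\<close>.\<close>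

lemma counting_from_riesz_mean:
  fixes ev :: "nat \<Rightarrow> real"
  assumes fin: "\<And>\<Lambda>. finite {j. ev j \<le> \<Lambda>}"
    and lim: "((\<lambda>\<Lambda>. (\<Sum>j | ev j \<le> \<Lambda>. \<Lambda> - ev j) / \<Lambda> powr (p + 1)) \<longlongrightarrow> A) at_top"
  shows "((\<lambda>\<Lambda>. real (card {j. ev j \<le> \<Lambda>}) / \<Lambda> powr p) \<longlongrightarrow> A * (p + 1)) at_top"
proof -
  define R where "R \<Lambda> = (\<Sum>j | ev j \<le> \<Lambda>. \<Lambda> - ev j)" for \<Lambda>
  define N where "N \<Lambda> = real (card {j. ev j \<le> \<Lambda>})" for \<Lambda>
  define r where "r \<Lambda> = R \<Lambda> / \<Lambda> powr (p + 1)" for \<Lambda>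
  have r: "(r \<longlongrightarrow> A) at_top" using lim by (simp add: r_def[abs_def] R_def)
  have inc: "R b - R a \<le> (b - a) * N b" "(b - a) * N a \<le> R b - R a" if "a \<le> b" for a b
    using riesz_mean_increment[OF fin that] by (simp_all add: R_def N_def)
  \<comment> \<open>The difference quotient of \<open>R\<close> over the window from \<Lambda> to
    \<open>(1 + \<theta>) * \<Lambda>\<close>, divided by \<open>\<Lambda> powr p\<close> and
    written through \<open>r\<close>, whose limit is known. Negative \<theta> describes a window to
    the left.\<close>
  define D where "D \<theta> \<Lambda> = ((1 + \<theta>) powr (p + 1) * r ((1 + \<theta>) * \<Lambda>) - r \<Lambda>) / \<theta>" for \<theta> \<Lambda>
  have Deq: "D \<theta> \<Lambda> = (R ((1 + \<theta>) * \<Lambda>) - R \<Lambda>) / (\<theta> * \<Lambda>) / \<Lambda> powr p" if "0 < \<Lambda>" "-1 < \<theta>" "\<theta> \<noteq> 0" for \<theta> \<Lambda>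
  proof -
    have "(1 + \<theta>) powr (p + 1) * r ((1 + \<theta>) * \<Lambda>) = R ((1 + \<theta>) * \<Lambda>) / \<Lambda> powr (p + 1)"
      using that by (simp add: r_def powr_mult)
    moreover have "\<Lambda> powr (p + 1) = \<Lambda> powr p * \<Lambda>" using that by (simp add: powr_add)
    moreover have "(a / (b * c) - d / (b * c)) / \<theta> = (a - d) / (\<theta> * c) / b" for a b c d
      by (simp add: diff_divide_distrib mult_ac)
    ultimately show ?thesis by (simp only: D_def r_def)
  qed
  have Dlim: "(D \<theta> \<longlongrightarrow> A * (((1 + \<theta>) powr (p + 1) - 1) / \<theta>)) at_top" if "-1 < \<theta>" "\<theta> \<noteq> 0" for \<theta>
  proof -
    have "filterlim (\<lambda>\<Lambda>. (1 + \<theta>) * \<Lambda>) at_top at_top"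
      using that by (intro filterlim_tendsto_pos_mult_at_top[OF tendsto_const _ filterlim_ident]) simp
    from filterlim_compose[OF r this] have "((\<lambda>\<Lambda>. r ((1 + \<theta>) * \<Lambda>)) \<longlongrightarrow> A) at_top" .
    then have "(D \<theta> \<longlongrightarrow> ((1 + \<theta>) powr (p + 1) * A - A) / \<theta>) at_top"
      unfolding D_def using that by (intro tendsto_intros r)
    then show ?thesis by (simp add: algebra_simps)
  qed
  have q: "((\<lambda>\<theta>. A * (((1 + \<theta>) powr (p + 1) - 1) / \<theta>)) \<longlongrightarrow> A * (p + 1)) (at 0)"
    by (intro tendsto_mult tendsto_const powr_difference_quotient)
  have "((\<lambda>\<Lambda>. N \<Lambda> / \<Lambda> powr p) \<longlongrightarrow> A * (p + 1)) at_top"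
  proof (rule order_tendstoI)
    \<comment> \<open>The upper bound uses a window to the right of \<Lambda>, where the slope of
      \<open>R\<close> is at least \<open>N \<Lambda>\<close>.\<close>
    fix c assume "A * (p + 1) < c"
    with q have "\<forall>\<^sub>F \<theta> in at 0. A * (((1 + \<theta>) powr (p + 1) - 1) / \<theta>) < c" by (rule order_tendstoD)
    then have "\<forall>\<^sub>F \<theta> in at_right 0. A * (((1 + \<theta>) powr (p + 1) - 1) / \<theta>) < c"
      by (simp add: eventually_at_split)
    then have "\<forall>\<^sub>F \<theta> in at_right 0. A * (((1 + \<theta>) powr (p + 1) - 1) / \<theta>) < c \<and> 0 < \<theta>"
      using eventually_at_right_less[of 0] by eventually_elim auto
    then obtain \<theta> where \<theta>: "A * (((1 + \<theta>) powr (p + 1) - 1) / \<theta>) < c" "0 < \<theta>"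
      using eventually_happens'[OF trivial_limit_at_right_real] by blast
    have "\<forall>\<^sub>F \<Lambda> in at_top. D \<theta> \<Lambda> < c"
      using \<theta> by (intro order_tendstoD(2)[OF Dlim]) auto
    then show "\<forall>\<^sub>F \<Lambda> in at_top. N \<Lambda> / \<Lambda> powr p < c"
      using eventually_gt_at_top[of 0]
    proof eventually_elim
      case (elim \<Lambda>)
      have "\<Lambda> \<le> (1 + \<theta>) * \<Lambda>" using elim \<theta> by (simp add: algebra_simps)
      from inc(2)[OF this] have "(\<theta> * \<Lambda>) * N \<Lambda> \<le> R ((1 + \<theta>) * \<Lambda>) - R \<Lambda>" by (simp add: algebra_simps)
      then have NR: "N \<Lambda> \<le> (R ((1 + \<theta>) * \<Lambda>) - R \<Lambda>) / (\<theta> * \<Lambda>)" using elim \<theta> by (simp add: field_simps)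
      then have "N \<Lambda> / \<Lambda> powr p \<le> D \<theta> \<Lambda>"
        using divide_right_mono[OF NR, of "\<Lambda> powr p"] elim \<theta> by (subst Deq) auto
      with elim show ?case by linarith
    qed
  next
    \<comment> \<open>The lower bound uses a window to the left of \<Lambda>, where the slope of
      \<open>R\<close> is at most \<open>N \<Lambda>\<close>.\<close>
    fix c assume "c < A * (p + 1)"
    with q have "\<forall>\<^sub>F \<theta> in at 0. c < A * (((1 + \<theta>) powr (p + 1) - 1) / \<theta>)" by (rule order_tendstoD)
    then have "\<forall>\<^sub>F \<theta> in at_left 0. c < A * (((1 + \<theta>) powr (p + 1) - 1) / \<theta>)"
      by (simp add: eventually_at_split)
    then have "\<forall>\<^sub>F \<theta> in at_left 0. c < A * (((1 + \<theta>) powr (p + 1) - 1) / \<theta>) \<and> -1 < \<theta> \<and> \<theta> < 0"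
      using eventually_at_left_field[of "\<lambda>x. -1 < x \<and> x < (0::real)" 0]
      by (auto elim: eventually_elim2 intro!: exI[of _ "-1"])
    then obtain \<theta> where \<theta>: "c < A * (((1 + \<theta>) powr (p + 1) - 1) / \<theta>)" "-1 < \<theta>" "\<theta> < 0"
      using eventually_happens'[OF trivial_limit_at_left_real] by blast
    have "\<forall>\<^sub>F \<Lambda> in at_top. c < D \<theta> \<Lambda>"
      using \<theta> by (intro order_tendstoD(1)[OF Dlim]) auto
    then show "\<forall>\<^sub>F \<Lambda> in at_top. c < N \<Lambda> / \<Lambda> powr p"
      using eventually_gt_at_top[of 0]
    proof eventually_elim
      case (elim \<Lambda>)
      have "(1 + \<theta>) * \<Lambda> \<le> \<Lambda>" using mult_right_mono[of "1 + \<theta>" 1 \<Lambda>] elim \<theta> by simp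
      from inc(1)[OF this] have *: "R \<Lambda> - R ((1 + \<theta>) * \<Lambda>) \<le> (- \<theta> * \<Lambda>) * N \<Lambda>" by (simp add: algebra_simps)
      have pos: "0 < - \<theta> * \<Lambda>" using elim \<theta> by (simp add: mult_neg_pos)
      have "(R ((1 + \<theta>) * \<Lambda>) - R \<Lambda>) / (\<theta> * \<Lambda>) = (R \<Lambda> - R ((1 + \<theta>) * \<Lambda>)) / (- \<theta> * \<Lambda>)"
        by (metis minus_diff_eq minus_divide_divide mult_minus_left)
      also have "\<dots> \<le> N \<Lambda>" using * by (subst pos_divide_le_eq[OF pos]) (simp add: mult_ac)
      finally have "(R ((1 + \<theta>) * \<Lambda>) - R \<Lambda>) / (\<theta> * \<Lambda>) \<le> N \<Lambda>" .
      from divide_right_mono[OF this, of "\<Lambda> powr p"] have "D \<theta> \<Lambda> \<le> N \<Lambda> / \<Lambda> powr p"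
        using elim \<theta> by (subst Deq) auto
      with elim show ?case by linarith
    qed
  qed
  then show ?thesis by (simp add: N_def)
qed

section \<open>Asymptotics of the Riesz means\<close>

context
  fixes \<Omega> :: "(real ^ 'n) set" and s :: real
  assumes \<Omega>o: "open \<Omega>" and \<Omega>b: "bounded \<Omega>" and s: "0 < s" "s < 1"
begin

lemma riesz_mean_asymptotics:
  fixes ev :: "nat \<Rightarrow> real"
  assumes seq: "eigenvalue_sequence_A s \<Omega> ev" and fin: "\<And>\<Lambda>. finite {j. ev j \<le> \<Lambda>}"
  shows "((\<lambda>\<Lambda>. (\<Sum>j | ev j \<le> \<Lambda>. \<Lambda> - ev j) / \<Lambda> powr (CARD('n) / (2 * s) + 1)) \<longlongrightarrow>
    (2 * pi) powr (- real CARD('n)) * measure lborel (ball (0::real^'n) 1) * measure lborel \<Omega> / (CARD('n) / (2 * s) + 1)) at_top"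
proof -
  let ?p = "CARD('n) / (2 * s)" and ?K = "(2 * pi) powr (- real CARD('n))" and ?\<omega> = "measure lborel (ball (0::real^'n) 1)"
  have p: "0 < ?p" using s by simp
  obtain e where e: "\<And>j. e j \<in> sobolev_H0 s \<Omega>"
    "\<And>j v. v \<in> sobolev_H0 s \<Omega> \<Longrightarrow> energy s (e j) v = ev j * ip_L2 (e j) v"
    "\<And>i j. ip_L2 (e i) (e j) = (if i = j then 1 else 0)"
    and complete: "\<And>u m. u \<in> sobolev_H0 s \<Omega> \<Longrightarrow> (\<And>v. v \<in> sobolev_H0 s \<Omega> \<Longrightarrow> energy s u v = m * ip_L2 u v) \<Longrightarrow>
      (\<And>j. ev j = m \<Longrightarrow> ip_L2 u (e j) = 0) \<Longrightarrow> ip_L2 u u = 0"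
    using eigenbasis[OF \<Omega>o \<Omega>b s seq] by metis
  define R where "R \<Lambda> = (\<Sum>j | ev j \<le> \<Lambda>. \<Lambda> - ev j)" for \<Lambda>
  have upper: "R \<Lambda> / \<Lambda> powr (?p + 1) \<le> ?K * ?\<omega> * measure lborel \<Omega> / (?p + 1)" if \<Lambda>: "0 < \<Lambda>" for \<Lambda>
  proof -
    have "R \<Lambda> \<le> ?K * measure lborel \<Omega> * (?\<omega> * \<Lambda> powr (?p + 1) / (?p + 1))"
      unfolding R_def by (rule riesz_mean_upper[OF \<Omega>o \<Omega>b s fin e(1) e(3) _ \<Lambda>]) (simp add: e)
    also have "\<dots> = ?K * ?\<omega> * measure lborel \<Omega> / (?p + 1) * \<Lambda> powr (?p + 1)" by simp
    finally show ?thesis using \<Lambda> by (simp add: pos_divide_le_eq)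
  qed
  have lower: "?K * ?\<omega> * (ip_L2 \<phi> \<phi> / (?p + 1) - (ip_L2 \<phi> \<phi> + frac_laplacian_const CARD('n) s / 2 * gagliardo s \<phi>) / \<Lambda>) \<le> R \<Lambda> / \<Lambda> powr (?p + 1)"
    if \<Lambda>: "0 < \<Lambda>" and \<phi>: "\<phi> \<in> sobolev_H0 s \<Omega>" "\<And>x. \<bar>\<phi> x\<bar> \<le> 1" for \<Lambda> \<phi>
  proof -
    let ?E = "ip_L2 \<phi> \<phi> + frac_laplacian_const CARD('n) s / 2 * gagliardo s \<phi>"
    have "?K * ?\<omega> * (ip_L2 \<phi> \<phi> * (\<Lambda> powr (?p + 1) / (?p + 1)) - ?E * \<Lambda> powr ?p) \<le> R \<Lambda>"
      unfolding R_def
    proof (rule riesz_mean_lower_bound[OF \<Omega>o \<Omega>b s fin e])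
      fix u m
      assume "u \<in> sobolev_H0 s \<Omega>" "m < \<Lambda>" "\<And>v. v \<in> sobolev_H0 s \<Omega> \<Longrightarrow> energy s u v = m * ip_L2 u v"
        "\<And>j. j \<in> {j. ev j \<le> \<Lambda>} \<Longrightarrow> ip_L2 u (e j) = 0"
      \<comment> \<open>Every index with \<open>ev j = m\<close> belongs to the family because
        \<open>m < \<Lambda>\<close>, so completeness within the single eigenspace applies.\<close>
      then show "ip_L2 u u = 0" by (intro complete[of u m]) auto
    qed (use \<Lambda> \<phi> in auto)
    moreover have "\<Lambda> powr ?p = \<Lambda> powr (?p + 1) / \<Lambda>"
      using \<Lambda> by (simp add: powr_add)
    moreover have "k * (x * (y / q) - z * (y / l)) = k * (x / q - z / l) * y" for k x y z q l :: real
      by (simp add: algebra_simps)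
    ultimately have "?K * ?\<omega> * (ip_L2 \<phi> \<phi> / (?p + 1) - ?E / \<Lambda>) * \<Lambda> powr (?p + 1) \<le> R \<Lambda>"
      by (simp only:)
    then show ?thesis using \<Lambda> by (simp add: pos_le_divide_eq)
  qed
  have "((\<lambda>\<Lambda>. R \<Lambda> / \<Lambda> powr (?p + 1)) \<longlongrightarrow> ?K * ?\<omega> * measure lborel \<Omega> / (?p + 1)) at_top"
  proof (rule order_tendstoI)
    fix c assume "?K * ?\<omega> * measure lborel \<Omega> / (?p + 1) < c"
    note c = this
    show "\<forall>\<^sub>F \<Lambda> in at_top. R \<Lambda> / \<Lambda> powr (?p + 1) < c"
      using eventually_gt_at_top[of 0] by eventually_elim (rule le_less_trans[OF upper c])
  next
    \<comment> \<open>The cutoff is chosen before \<Lambda>: its energy may be huge, but it is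
      divided by \<Lambda>.\<close>
    fix c assume c: "c < ?K * ?\<omega> * measure lborel \<Omega> / (?p + 1)"
    have "(\<lambda>n. ?K * ?\<omega> * (ip_L2 (cutoff \<Omega> n) (cutoff \<Omega> n) / (?p + 1))) \<longlonglongrightarrow> ?K * ?\<omega> * (measure lborel \<Omega> / (?p + 1))"
      using p by (intro tendsto_intros cutoff_limit[OF \<Omega>o \<Omega>b s]) auto
    then have "\<forall>\<^sub>F n in sequentially. c < ?K * ?\<omega> * (ip_L2 (cutoff \<Omega> n) (cutoff \<Omega> n) / (?p + 1))"
      by (rule order_tendstoD) (use c in simp)
    then obtain n where n: "c < ?K * ?\<omega> * (ip_L2 (cutoff \<Omega> n) (cutoff \<Omega> n) / (?p + 1))"
      using eventually_happens'[OF sequentially_bot] by blast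
    let ?\<phi> = "cutoff \<Omega> n"
    let ?E = "ip_L2 ?\<phi> ?\<phi> + frac_laplacian_const CARD('n) s / 2 * gagliardo s ?\<phi>"
    have "((\<lambda>\<Lambda>. ?E / \<Lambda>) \<longlongrightarrow> 0) at_top"
      by (rule tendsto_divide_0[OF tendsto_const filterlim_at_top_imp_at_infinity[OF filterlim_ident]])
    then have "((\<lambda>\<Lambda>. ?K * ?\<omega> * (ip_L2 ?\<phi> ?\<phi> / (?p + 1) - ?E / \<Lambda>)) \<longlongrightarrow> ?K * ?\<omega> * (ip_L2 ?\<phi> ?\<phi> / (?p + 1) - 0)) at_top"
      by (intro tendsto_mult tendsto_diff tendsto_const)
    then have "\<forall>\<^sub>F \<Lambda> in at_top. c < ?K * ?\<omega> * (ip_L2 ?\<phi> ?\<phi> / (?p + 1) - ?E / \<Lambda>)"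
      by (rule order_tendstoD) (use n in simp)
    then show "\<forall>\<^sub>F \<Lambda> in at_top. c < R \<Lambda> / \<Lambda> powr (?p + 1)"
      using eventually_gt_at_top[of 0]
    proof eventually_elim
      case (elim \<Lambda>)
      show ?case
        by (rule less_le_trans[OF elim(1) lower[OF elim(2) cutoff_in_H0[OF \<Omega>o \<Omega>b s] cutoff_abs_le[OF \<Omega>o \<Omega>b s]]])
    qed
  qed
  then show ?thesis by (simp add: R_def)
qed

end

lemma weyl_law:
  fixes \<Omega> :: "(real ^ 'n) set" and s :: real and ev :: "nat \<Rightarrow> real"
  assumes "open \<Omega>" "bounded \<Omega>" "\<Omega> \<noteq> {}" and s: "0 < s" "s < 1"
    and seq: "eigenvalue_sequence_A s \<Omega> ev" and top: "filterlim ev at_top sequentially"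
  shows "(\<lambda>\<Lambda>. real (card {j. ev j \<le> \<Lambda>})) \<sim>[at_top]
    (\<lambda>\<Lambda>. (2 * pi) powr (- real CARD('n)) * measure lborel (ball (0 :: real ^ 'n) 1)
       * measure lborel \<Omega> * \<Lambda> powr (real CARD('n) / (2 * s)))"
proof -
  let ?p = "real CARD('n) / (2 * s)"
  let ?c = "(2 * pi) powr (- real CARD('n)) * measure lborel (ball (0 :: real ^ 'n) 1) * measure lborel \<Omega>"
  have p: "0 < ?p" using s by simp
  have fin: "finite {j. ev j \<le> \<Lambda>}" for \<Lambda>
  proof -
    have "\<forall>\<^sub>F j in sequentially. \<Lambda> < ev j" using top by (simp add: filterlim_at_top_dense)
    then obtain N where "\<And>j. N \<le> j \<Longrightarrow> \<Lambda> < ev j" by (auto simp: eventually_sequentially)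
    then have "{j. ev j \<le> \<Lambda>} \<subseteq> {..<N}" by (auto simp: not_le[symmetric])
    then show ?thesis by (rule finite_subset) simp
  qed
  \<comment> \<open>Both the domain and the unit ball need positive volume, since asymptotic
    equivalence is obtained from a quotient by the constant.\<close>
  have mpos: "0 < measure lborel U" if "open U" "bounded U" "U \<noteq> {}" for U :: "(real ^ 'n) set"
  proof -
    have "emeasure lborel U \<noteq> 0"
      using open_not_negligible[of U] that by (auto simp: negligible_iff_null_sets null_sets_completion_iff null_sets_def)
    moreover have "emeasure lborel U < \<infinity>" using that by (intro emeasure_bounded_finite)
    ultimately show ?thesis by (simp add: measure_def enn2real_positive_iff zero_less_iff_neq_zero)
  qed
  have c: "0 < ?c" using assms(1-3) by (intro mult_pos_pos mpos) auto
  have "((\<lambda>\<Lambda>. real (card {j. ev j \<le> \<Lambda>}) / \<Lambda> powr ?p) \<longlongrightarrow> ?c / (?p + 1) * (?p + 1)) at_top"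
    by (rule counting_from_riesz_mean[OF fin riesz_mean_asymptotics[OF assms(1,2) s seq fin]])
  then have "((\<lambda>\<Lambda>. real (card {j. ev j \<le> \<Lambda>}) / \<Lambda> powr ?p) \<longlongrightarrow> ?c) at_top"
    using p by simp
  then have "((\<lambda>\<Lambda>. real (card {j. ev j \<le> \<Lambda>}) / \<Lambda> powr ?p / ?c) \<longlongrightarrow> ?c / ?c) at_top"
    using c by (intro tendsto_divide tendsto_const) auto
  moreover have "?c / ?c = 1" by (rule divide_self[OF less_imp_neq[OF c, symmetric]])
  moreover have "x / y / z = x / (z * y)" for x y z :: real by (simp add: mult.commute)
  ultimately show ?thesis by (intro asymp_equivI') (simp only:)
qed

section \<open>The threshold\<close>

lemma lambda_star_ex1:
  fixes t \<alpha> :: real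
  assumes t: "0 < t" and \<alpha>: "0 < \<alpha>" "\<alpha> \<le> exp (- 2 * t)"
  shows "\<exists>!l. 1 \<le> l \<and> inverse l * exp (- 2 * t * l) = \<alpha>"
proof (rule ex_ex1I)
  have "\<alpha> \<le> 1" using \<alpha> t by (meson exp_le_one_iff mult_nonpos_nonneg less_imp_le neg_le_0_iff_le order_trans zero_le_numeral)
  then have M: "1 \<le> 1 / \<alpha>" using \<alpha> by simp
  \<comment> \<open>The right end for the intermediate value theorem is \<open>1 / \<alpha>\<close>,
    where the first factor is already \<alpha> and the exponential is at most \<open>1\<close>. At
    the left end \<open>1\<close> the value is \<open>exp (- 2 * t)\<close>.\<close>
  have "inverse (1 / \<alpha>) * exp (- 2 * t * (1 / \<alpha>)) \<le> \<alpha>"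
    using \<alpha> t by (simp add: mult_left_le)
  then have "\<exists>l\<ge>1. l \<le> 1 / \<alpha> \<and> inverse l * exp (- 2 * t * l) = \<alpha>"
    using \<alpha> M by (intro IVT2') (auto intro!: continuous_intros)
  then show "\<exists>l. 1 \<le> l \<and> inverse l * exp (- 2 * t * l) = \<alpha>" by blast
next
  have mono: "inverse l' * exp (- 2 * t * l') < inverse l * exp (- 2 * t * l)" if "1 \<le> l" "l < l'" for l l'
    using that t by (intro mult_strict_mono) auto
  fix l l'
  assume "1 \<le> l \<and> inverse l * exp (- 2 * t * l) = \<alpha>" "1 \<le> l' \<and> inverse l' * exp (- 2 * t * l') = \<alpha>"
  then show "l = l'" using mono[of l l'] mono[of l' l] by (cases l l' rule: linorder_cases) auto
qed

lemma lambda_star_props: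
  fixes t \<alpha> :: real
  assumes "0 < t" "0 < \<alpha>" "\<alpha> \<le> exp (- 2 * t)"
  shows "1 \<le> lambda_star t \<alpha>" "inverse (lambda_star t \<alpha>) * exp (- 2 * t * lambda_star t \<alpha>) = \<alpha>"
  using theI'[OF lambda_star_ex1[OF assms]] unfolding lambda_star_def by blast+

text \<open>A positive value of \<open>v * exp v\<close> forces \<open>v\<close> to be positive, and
  on the positive half-line the function is strictly increasing. Thus the candidates between
  \<open>-1\<close> and \<open>0\<close> are excluded by sign alone.\<close>

lemma Lambert_W0_eqI:
  assumes "0 < w"
  shows "Lambert_W0 (w * exp w) = w"
proof -
  have "0 < w * exp w" using assms by simp
  then have "\<not> w * exp w < - exp (- 1)" using exp_gt_zero[of "-1::real"] by linarith
  moreover have "(THE v. - 1 \<le> v \<and> v * exp v = w * exp w) = w"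
  proof (rule the_equality)
    fix v assume v: "- 1 \<le> v \<and> v * exp v = w * exp w"
    then have "0 < v * exp v" using assms by simp
    then have vp: "0 < v" by (simp add: zero_less_mult_iff)
    have "x * exp x < y * exp y" if "0 < x" "x < y" for x y :: real
      using that by (intro mult_strict_mono) auto
    then show "v = w" using vp v assms by (metis linorder_less_linear less_irrefl)
  qed (use assms in auto)
  ultimately show ?thesis by (simp add: Lambert_W0_def)
qed

text \<open>The defining equation rearranges to
  \<open>(2 * t * l) * exp (2 * t * l) = 2 * t / \<alpha>\<close>.\<close>

lemma lambda_star_Lambert:
  fixes t \<alpha> :: real
  assumes "0 < t" "0 < \<alpha>" "\<alpha> \<le> exp (- 2 * t)"
  shows "lambda_star t \<alpha> = 1 / (2 * t) * Lambert_W0 (2 * t / \<alpha>)"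
proof -
  let ?l = "lambda_star t \<alpha>"
  note l = lambda_star_props[OF assms]
  have "2 * t / \<alpha> = (2 * t * ?l) * exp (2 * t * ?l)"
    using l(1) assms by (subst l(2)[symmetric]) (simp add: exp_minus field_simps)
  moreover have "0 < 2 * t * ?l" using assms l by simp
  ultimately have "Lambert_W0 (2 * t / \<alpha>) = 2 * t * ?l" by (simp only: Lambert_W0_eqI)
  then show ?thesis using assms by simp
qed

lemma eventually_alpha_small: "\<forall>\<^sub>F \<alpha> in at_right (0::real). 0 < \<alpha> \<and> \<alpha> \<le> exp c"
  unfolding eventually_at_right_field by (intro exI[of _ "exp c"]) auto

lemma ln_lambda_star:
  fixes t \<alpha> :: real
  assumes "0 < t" "0 < \<alpha>" "\<alpha> \<le> exp (- 2 * t)"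
  shows "ln (1 / \<alpha>) = 2 * t * lambda_star t \<alpha> + ln (lambda_star t \<alpha>)"
proof -
  note l = lambda_star_props[OF assms]
  have "ln \<alpha> = ln (inverse (lambda_star t \<alpha>)) + ln (exp (- 2 * t * lambda_star t \<alpha>))"
    using l(1) by (subst l(2)[symmetric], subst ln_mult) auto
  then show ?thesis using assms l(1) by (simp add: ln_div ln_inverse)
qed

lemma lambda_star_at_top:
  assumes t: "0 < t"
  shows "filterlim (lambda_star t) at_top (at_right 0)"
proof (rule filterlim_at_top_mono)
  \<comment> \<open>The minorant comes from the logarithm of the defining equation together with
    \<open>ln l \<le> l\<close>.\<close>
  show "filterlim (\<lambda>\<alpha>. 1 / (2 * t + 1) * ln (1 / \<alpha>)) at_top (at_right (0::real))"
  proof (rule filterlim_tendsto_pos_mult_at_top[OF tendsto_const])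
    show "0 < 1 / (2 * t + 1)" using t by simp
    show "filterlim (\<lambda>\<alpha>. ln (1 / \<alpha>)) at_top (at_right (0::real))" by real_asymp
  qed
  show "\<forall>\<^sub>F \<alpha> in at_right 0. 1 / (2 * t + 1) * ln (1 / \<alpha>) \<le> lambda_star t \<alpha>"
    using eventually_alpha_small[of "- 2 * t"]
  proof eventually_elim
    case (elim \<alpha>)
    let ?l = "lambda_star t \<alpha>"
    have "ln ?l \<le> ?l" using lambda_star_props(1)[OF t, of \<alpha>] elim ln_le_minus_one[of ?l] by auto
    then have "ln (1 / \<alpha>) \<le> (2 * t + 1) * ?l"
      using ln_lambda_star[OF t, of \<alpha>] elim by (simp add: algebra_simps)
    then show ?case using t by (simp add: field_simps)
  qed
qed

text \<open>Dividing the logarithmic equation by \<open>2 * t * l\<close> shows that the reciprocal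
  quotient is \<open>1 + ln l / (2 * t * l)\<close>, which tends to \<open>1\<close> as the
  threshold \<open>l\<close> diverges.\<close>

lemma lambda_star_asymp:
  assumes t: "0 < t"
  shows "lambda_star t \<sim>[at_right 0] (\<lambda>\<alpha>. 1 / (2 * t) * ln (1 / \<alpha>))"
proof (rule asymp_equiv_symI, rule asymp_equivI')
  have "((\<lambda>x. 1 + 1 / (2 * t) * (ln x / x)) \<longlongrightarrow> 1 + 1 / (2 * t) * 0) at_top"
    by (intro tendsto_intros) (real_asymp)
  then have "((\<lambda>x. 1 + 1 / (2 * t) * (ln x / x)) \<longlongrightarrow> 1) at_top" by simp
  from filterlim_compose[OF this lambda_star_at_top[OF t]]
  have "((\<lambda>\<alpha>. 1 + 1 / (2 * t) * (ln (lambda_star t \<alpha>) / lambda_star t \<alpha>)) \<longlongrightarrow> 1) (at_right 0)" .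
  then show "((\<lambda>\<alpha>. 1 / (2 * t) * ln (1 / \<alpha>) / lambda_star t \<alpha>) \<longlongrightarrow> 1) (at_right 0)"
  proof (rule Lim_transform_eventually)
    show "\<forall>\<^sub>F \<alpha> in at_right 0. 1 + 1 / (2 * t) * (ln (lambda_star t \<alpha>) / lambda_star t \<alpha>) = 1 / (2 * t) * ln (1 / \<alpha>) / lambda_star t \<alpha>"
      using eventually_alpha_small[of "- 2 * t"]
    proof eventually_elim
      case (elim \<alpha>)
      have "1 \<le> lambda_star t \<alpha>" using lambda_star_props(1)[OF t] elim by auto
      then show ?case using ln_lambda_star[OF t, of \<alpha>] elim t by (simp add: field_simps)
    qed
  qed
qed

theorem proposition4p13:
  fixes \<Omega> :: "(real ^ 'n) set" and s t :: real and ev :: "nat \<Rightarrow> real"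
  assumes "bounded_lipschitz_domain \<Omega>"
    and "0 < s" and "s < 1" and "0 < t"
    and "eigenvalue_sequence_A s \<Omega> ev"
    and "\<And>j. 1 \<le> ev j"
    and "filterlim ev at_top sequentially"
  shows "(\<forall>\<alpha>. 0 < \<alpha> \<and> \<alpha> \<le> exp (- 2 * t) \<longrightarrow>
            (\<exists>!l. 1 \<le> l \<and> inverse l * exp (- 2 * t * l) = \<alpha>) \<and>
            lambda_star t \<alpha> = 1 / (2 * t) * Lambert_W0 (2 * t / \<alpha>))
    \<and> lambda_star t \<sim>[at_right 0] (\<lambda>\<alpha>. 1 / (2 * t) * ln (1 / \<alpha>))
    \<and> (\<lambda>\<alpha>. real (j_star ev t \<alpha>)) \<sim>[at_right 0]
        (\<lambda>\<alpha>. (2 * pi) powr (- real CARD('n)) * measure lborel (ball (0 :: real ^ 'n) 1)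
              * measure lborel \<Omega> * (1 / (2 * t) * ln (1 / \<alpha>)) powr (real CARD('n) / (2 * s)))
    \<and> (\<forall>\<beta>. 0 < \<beta> \<and> \<beta> \<le> 1 \<longrightarrow>
        (\<lambda>\<delta>. real (j_star ev t (\<delta> powr (2 / (2 * \<beta> + 1))))) \<sim>[at_right 0]
        (\<lambda>\<delta>. (2 * pi) powr (- real CARD('n)) * measure lborel (ball (0 :: real ^ 'n) 1)
              * measure lborel \<Omega>
              * (1 / (t * (2 * \<beta> + 1)) * ln (1 / \<delta>)) powr (real CARD('n) / (2 * s))))"
proof -
  let ?p = "real CARD('n) / (2 * s)"
  let ?c = "(2 * pi) powr (- real CARD('n)) * measure lborel (ball (0 :: real ^ 'n) 1) * measure lborel \<Omega>"
  have \<Omega>: "open \<Omega>" "bounded \<Omega>" "\<Omega> \<noteq> {}"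
    using assms(1) by (auto simp: bounded_lipschitz_domain_def)
  have "(\<lambda>\<alpha>. real (card {j. ev j \<le> lambda_star t \<alpha>})) \<sim>[at_right 0] (\<lambda>\<alpha>. ?c * lambda_star t \<alpha> powr ?p)"
    by (rule asymp_equiv_compose'[OF weyl_law[OF \<Omega> assms(2,3,5,7)] lambda_star_at_top[OF assms(4)]])
  also have "(\<lambda>\<alpha>. ?c * lambda_star t \<alpha> powr ?p) \<sim>[at_right 0] (\<lambda>\<alpha>. ?c * (1 / (2 * t) * ln (1 / \<alpha>)) powr ?p)"
  proof (intro asymp_equiv_mult asymp_equiv_refl asymp_equiv_powr_real lambda_star_asymp assms(4))
    show "\<forall>\<^sub>F \<alpha> in at_right 0. 0 \<le> lambda_star t \<alpha>"
      using eventually_alpha_small[of "- 2 * t"]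
      by eventually_elim (auto dest: lambda_star_props(1)[OF assms(4)])
    show "\<forall>\<^sub>F \<alpha> in at_right 0. 0 \<le> 1 / (2 * t) * ln (1 / \<alpha>)"
      using eventually_alpha_small[of 0] by eventually_elim (use assms(4) in auto)
  qed
  finally have 3: "(\<lambda>\<alpha>. real (j_star ev t \<alpha>)) \<sim>[at_right 0] (\<lambda>\<alpha>. ?c * (1 / (2 * t) * ln (1 / \<alpha>)) powr ?p)"
    by (simp add: j_star_def)
  have 4: "(\<lambda>\<delta>. real (j_star ev t (\<delta> powr (2 / (2 * \<beta> + 1))))) \<sim>[at_right 0]
        (\<lambda>\<delta>. ?c * (1 / (t * (2 * \<beta> + 1)) * ln (1 / \<delta>)) powr ?p)" if \<beta>: "0 < \<beta>" for \<beta> :: real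
  proof -
    let ?b = "2 / (2 * \<beta> + 1)"
    have b: "0 < ?b" using \<beta> by simp
    have "filterlim (\<lambda>\<delta>::real. \<delta> powr ?b) (at_right 0) (at_right 0)"
      using b by real_asymp
    from asymp_equiv_compose'[OF 3 this]
    have "(\<lambda>\<delta>. real (j_star ev t (\<delta> powr ?b))) \<sim>[at_right 0] (\<lambda>\<delta>. ?c * (1 / (2 * t) * ln (1 / \<delta> powr ?b)) powr ?p)" .
    also have "\<forall>\<^sub>F \<delta> in at_right 0. ?c * (1 / (2 * t) * ln (1 / \<delta> powr ?b)) powr ?p = ?c * (1 / (t * (2 * \<beta> + 1)) * ln (1 / \<delta>)) powr ?p"
      using eventually_alpha_small[of 0]
    proof eventually_elim
      case (elim \<delta>)
      \<comment> \<open>The exponent \<open>?b\<close> comes out of the logarithm, and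
        \<open>?b / (2 * t)\<close> equals \<open>1 / (t * (2 * \<beta> + 1))\<close>.\<close>
      have "1 / (2 * t) * ln (1 / \<delta> powr ?b) = 1 / (t * (2 * \<beta> + 1)) * ln (1 / \<delta>)"
        using elim \<beta> assms(4) by (simp add: ln_div ln_powr field_simps)
      then show ?case by simp
    qed
    finally show ?thesis .
  qed
  show ?thesis
    using lambda_star_ex1[OF assms(4)] lambda_star_Lambert[OF assms(4)] lambda_star_asymp[OF assms(4)] 3 4 by blast
qed

end
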